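(* Suppose $B$ is an interpolating Blaschke product with zeros $\{\lambda_n\}_{n\ge1} \subset (0, 1)$. For $\{a_n\} \in \ell^2$ and $f = \sum_{n \geq 1} a_n \kappa_{\lambda_n}$, the following are equivalent: (i) $f \in \mathscr{R}(\mathcal{K}_B)$; (ii) the sum $\displaystyle\sum_{n = 1}^{\infty} \frac{|a_n|^2}{|\phi(\lambda_n)|}$ is finite for every bounded outer function $\phi$; (iii) the sum $\displaystyle\sum_{n = 1}^{\infty} |a_n|^2 \exp\Big(\frac{1}{1 - \lambda_n} \int_{0}^{1 - \lambda_n} h(t)\,dt\Big)$ is finite for every positive, decreasing, integrable function $h$ on $[0, 1]$; (iv) there is a constant $c_f>0$ such that $\displaystyle\sum_{n = 1}^{\infty} a_n \sqrt{1 - |\lambda_n|^2}\, \lambda_{n}^{N} = O(e^{-c_f \sqrt{N}})$ as $N \to \infty$.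
   Context: $\mathbb{D}$ is the open unit disk, $\mathbb{T}$ the unit circle, $m$ normalized Lebesgue measure on $\mathbb{T}$, $H^2$ the Hardy space, $H^\infty$ the bounded analytic functions on $\mathbb{D}$. A sequence $\Lambda=\{\lambda_n\}_{n\ge1}$ of distinct points of $\mathbb{D}$ is interpolating if $\inf_{n \geq 1} \prod_{k\ge 1, k \ne n} \left| \frac{\lambda_k-\lambda_n}{1-\overline{\lambda}_k \lambda_n}\right| > 0$. An interpolating Blaschke product is a Blaschke product with simple zeros forming an interpolating sequence. $\kappa_\lambda(z)=\frac{\sqrt{1-|\lambda|^2}}{1-\overline\lambda z}$ is the normalized Cauchy kernel of $H^2$. The model space is $\mathcal{K}_B=(BH^2)^\perp$; it is known that $\{\kappa_{\lambda_n}\}$ is a Riesz basis of $\mathcal{K}_B$, so each $f\in\mathcal{K}_B$ is uniquely $\sum a_n\kappa_{\lambda_n}$ with $\{a_n\}\in\ell^2$, and conversely. For $\phi\in H^\infty$, $T_{\overline\phi}f=P_+(\overline\phi f)$ on $H^2$, with $P_+$ the orthogonal projection of $L^2(\mathbb{T})$ onto $H^2$. $\mathcal{O}$ is the class of outer functions, i.e. functions of the form $\gamma\exp\big(\int_{\mathbb{T}} \frac{\xi + z}{\xi - z} W(\xi)\, dm(\xi)\big)$ with $|\gamma|=1$ and $W$ extended real-valued and integrable on $\mathbb{T}$; bounded outer functions are those in $H^\infty\cap\mathcal{O}$. $\mathscr{R}(\mathcal{K}_B) = \bigcap \{T_{\overline{\phi}} \mathcal{K}_B: \phi \in H^{\infty}\cap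 \mathcal{O}\}$. "Decreasing" means nonincreasing, and $h$ may be unbounded near $0$ (it is finite on $(0,1]$ and the value $h(0)=+\infty$ is allowed). Known theorem of McCarthy (may be assumed): $\bigcap \{T_{\overline{\phi}} H^2: \phi \in H^{\infty} \setminus \{0\}\} = \{f \in H^{\infty}: \widehat{f}(n) = O(e^{-c_f \sqrt{n}}) \text{ for some } c_f>0\}$, where $\widehat f(n)$ are the Taylor coefficients. *)

theory Defs
  imports "HOL-Complex_Analysis.Complex_Analysis" "HOL-Library.Landau_Symbols"
begin

section \<open>The circle and the Hardy spaces\<close>

text \<open>Normalized Lebesgue measure on the unit circle, as a Borel measure on the plane that is
  concentrated on \<open>sphere 0 1\<close>.\<close>

definition circle_measure :: "complex measure" where
  "circle_measure = distr (uniform_measure lborel {0..<2 * pi}) borel cis"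

definition L2_inner :: "(complex \<Rightarrow> complex) \<Rightarrow> (complex \<Rightarrow> complex) \<Rightarrow> complex" where
  "L2_inner u v = (LINT \<xi>|circle_measure. u \<xi> * cnj (v \<xi>))"

definition L2_norm :: "(complex \<Rightarrow> complex) \<Rightarrow> real" where
  "L2_norm u = sqrt (LINT \<xi>|circle_measure. (norm (u \<xi>))\<^sup>2)"

text \<open>A function on the open unit disk is represented by a total function that vanishes off the
  disk, so that equality in HOL is equality on the disk. (This makes the orthogonal projection
  below unique as a HOL function.)\<close>

definition analytic_disk :: "(complex \<Rightarrow> complex) set" where
  "analytic_disk = {f. f holomorphic_on ball 0 1 \<and> (\<forall>z. z \<notin> ball 0 1 \<longrightarrow> f z = 0)}"

definition H2 :: "(complex \<Rightarrow> complex) set" where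
  "H2 = {f \<in> analytic_disk.
     bdd_above ((\<lambda>r. LINT \<xi>|circle_measure. (norm (f (complex_of_real r * \<xi>)))\<^sup>2) ` {0..<1})}"

definition Hinf :: "(complex \<Rightarrow> complex) set" where
  "Hinf = {f \<in> analytic_disk. bounded (f ` ball 0 1)}"

text \<open>Radial boundary values. For a function in \<open>H2\<close> or \<open>Hinf\<close> the limit exists at almost every
  point of the circle (Fatou); this is how \<open>H2\<close> sits inside the space of square-integrable
  functions on the circle.\<close>

definition bdry :: "(complex \<Rightarrow> complex) \<Rightarrow> complex \<Rightarrow> complex" where
  "bdry f \<xi> = Lim (at_left 1) (\<lambda>r. f (complex_of_real r * \<xi>))"

text \<open>The orthogonal projection of a square-integrable function on the circle onto \<open>H2\<close>.\<close>

definition P_plus :: "(complex \<Rightarrow> complex) \<Rightarrow> complex \<Rightarrow> complex" where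
  "P_plus u = (THE F. F \<in> H2 \<and> (\<forall>k\<in>H2. L2_inner (\<lambda>\<xi>. u \<xi> - bdry F \<xi>) (bdry k) = 0))"

text \<open>The Toeplitz operator whose symbol is the complex conjugate of \<open>\<phi>\<close>.\<close>

definition coanalytic_Toeplitz ::
    "(complex \<Rightarrow> complex) \<Rightarrow> (complex \<Rightarrow> complex) \<Rightarrow> complex \<Rightarrow> complex" where
  "coanalytic_Toeplitz \<phi> f = P_plus (\<lambda>\<xi>. cnj (bdry \<phi> \<xi>) * bdry f \<xi>)"

text \<open>Outer functions. An extended real-valued \<open>W\<close> is integrable if it is measurable, finite almost
  everywhere, and its real part \<open>real_of_ereal \<circ> W\<close> is Lebesgue integrable.\<close>

definition outer :: "(complex \<Rightarrow> complex) set" where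
  "outer = {\<phi>. \<exists>\<gamma> (W :: complex \<Rightarrow> ereal).
     norm \<gamma> = 1 \<and> W \<in> borel_measurable circle_measure \<and>
     (AE \<xi> in circle_measure. \<bar>W \<xi>\<bar> \<noteq> \<infinity>) \<and>
     integrable circle_measure (\<lambda>\<xi>. real_of_ereal (W \<xi>)) \<and>
     (\<forall>z\<in>ball 0 1. \<phi> z =
        \<gamma> * exp (LINT \<xi>|circle_measure. (\<xi> + z) / (\<xi> - z) * of_real (real_of_ereal (W \<xi>))))}"


section \<open>Blaschke products and model spaces\<close>

text \<open>The infinite product is the limit of the (decreasing) partial products. It is not written
  with \<open>prodinf\<close>, which is unspecified when the partial products tend to \<open>0\<close>.\<close>

definition interpolating :: "(nat \<Rightarrow> complex) \<Rightarrow> bool" where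
  "interpolating \<Lambda> \<longleftrightarrow> inj \<Lambda> \<and> range \<Lambda> \<subseteq> ball 0 1 \<and>
     (INF n. lim (\<lambda>N. \<Prod>k\<in>{..<N} - {n}. norm ((\<Lambda> k - \<Lambda> n) / (1 - cnj (\<Lambda> k) * \<Lambda> n)))) > 0"

definition Blaschke_factor :: "complex \<Rightarrow> complex \<Rightarrow> complex" where
  "Blaschke_factor w z =
     (if w = 0 then z else of_real (norm w) / w * ((w - z) / (1 - cnj w * z)))"

text \<open>\<open>B\<close> is a Blaschke product whose zeros, listed with multiplicity, are the terms of \<open>\<Lambda>\<close>;
  a unimodular constant factor is allowed.\<close>

definition Blaschke_product :: "(nat \<Rightarrow> complex) \<Rightarrow> (complex \<Rightarrow> complex) \<Rightarrow> bool" where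
  "Blaschke_product \<Lambda> B \<longleftrightarrow>
     range \<Lambda> \<subseteq> ball 0 1 \<and> summable (\<lambda>n. 1 - norm (\<Lambda> n)) \<and>
     (\<exists>\<gamma>. norm \<gamma> = 1 \<and> (\<forall>z\<in>ball 0 1. B z = \<gamma> * (\<Prod>n. Blaschke_factor (\<Lambda> n) z)))"

definition interpolating_Blaschke_product ::
    "(nat \<Rightarrow> complex) \<Rightarrow> (complex \<Rightarrow> complex) \<Rightarrow> bool" where
  "interpolating_Blaschke_product \<Lambda> B \<longleftrightarrow> Blaschke_product \<Lambda> B \<and> interpolating \<Lambda>"

text \<open>The orthogonal complement of \<open>B H2\<close> in \<open>H2\<close>.\<close>

definition model_space :: "(complex \<Rightarrow> complex) \<Rightarrow> (complex \<Rightarrow> complex) set" where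
  "model_space B = {f \<in> H2. \<forall>g\<in>H2. L2_inner (bdry f) (bdry (\<lambda>z. B z * g z)) = 0}"

definition common_range :: "(complex \<Rightarrow> complex) set \<Rightarrow> (complex \<Rightarrow> complex) set" where
  "common_range K = (\<Inter>\<phi>\<in>Hinf \<inter> outer. coanalytic_Toeplitz \<phi> ` K)"

definition cauchy_kernel :: "complex \<Rightarrow> complex \<Rightarrow> complex" where
  "cauchy_kernel w z = of_real (sqrt (1 - (norm w)\<^sup>2)) / (1 - cnj w * z)"

text \<open>\<open>f\<close> is the sum in \<open>H2\<close>, i.e. with respect to the norm, of the series
  with terms \<open>u n\<close>.\<close>

definition H2_sums :: "(nat \<Rightarrow> complex \<Rightarrow> complex) \<Rightarrow> (complex \<Rightarrow> complex) \<Rightarrow> bool" where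
  "H2_sums u f \<longleftrightarrow> f \<in> H2 \<and> (\<lambda>N. L2_norm (bdry (\<lambda>z. f z - (\<Sum>n<N. u n z)))) \<longlonglongrightarrow> 0"


section \<open>Weights on the unit interval\<close>

text \<open>Positive, nonincreasing, integrable functions on \<open>[0,1]\<close>, finite on \<open>(0,1]\<close>. They are
  \<open>ereal\<close>-valued because a real value at \<open>0\<close> would, by monotonicity, bound the function.\<close>

definition decreasing_weight :: "(real \<Rightarrow> ereal) \<Rightarrow> bool" where
  "decreasing_weight h \<longleftrightarrow>
     (\<forall>t\<in>{0..1}. 0 < h t) \<and> (\<forall>t\<in>{0<..1}. h t < \<infinity>) \<and>
     (\<forall>s\<in>{0..1}. \<forall>t\<in>{0..1}. s \<le> t \<longrightarrow> h t \<le> h s) \<and>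
     set_integrable lborel {0..1} (\<lambda>t. real_of_ereal (h t))"

end

theory Submission
  imports Defs
begin

text \<open>All four conditions are equivalent to exponential decay of the coefficients:
  \<open>\<bar>a n\<bar>\<^sup>2 \<le> C exp (- c / (1 - \<Lambda> n))\<close> for some \<open>c > 0\<close>. Neither the Riesz basis property nor McCarthy's
  theorem is needed.

  If \<open>f\<close> is the image of \<open>g \<in> K\<^sub>B\<close> under the Toeplitz operator with symbol \<open>cnj \<phi>\<close>, pairing with
  \<open>\<psi> = B / (\<Lambda> n - z)\<close> gives \<open>\<bar>a n\<bar> \<le> C \<bar>\<phi> (\<Lambda> n)\<bar>\<close>, because \<open>(\<phi> - \<phi> (\<Lambda> n)) \<psi>\<close> is a multiple of \<open>B\<close>.
  Such a bound for every bounded outer \<open>\<phi>\<close> gives one for every weight \<open>h\<close>, by taking \<open>log \<bar>\<phi>\<bar> = - C h\<close>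
  on an arc ending at \<open>1\<close>, and a diagonal choice of \<open>h\<close> forces exponential decay. Decay of the Taylor
  coefficients of \<open>f\<close> forces it too: pair \<open>f\<close> with \<open>b exp (c / (1 - \<rho> z))\<close>, where \<open>b\<close> is \<open>B\<close> without its
  \<open>n\<close>-th factor, and let \<open>\<rho>\<close> tend to \<open>1\<close>. Conversely \<open>(1 - x) log \<bar>\<phi> x\<bar>\<close> tends to \<open>0\<close> as \<open>x\<close> tends to \<open>1\<close>
  for every outer \<open>\<phi>\<close>, so that decaying coefficients may be divided by \<open>cnj (\<phi> (\<Lambda> n))\<close>.

  Radial limits of \<open>H\<^sup>2\<close> functions exist almost everywhere by Poisson's formula and the weak type
  estimate for averages over intervals, which follows from Vitali's covering lemma.\<close>

section \<open>The normalized circle measure and square-integrable functions\<close>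

text \<open>Exponential decay matches the scale \<open>sqrt N\<close> in both directions: with
  \<open>y = 1 - \<Lambda> n\<close>, the quantity \<open>c / y + N * y\<close> is at least
  \<open>2 * sqrt (c * N)\<close>, and \<open>exp (\<epsilon>^2 / (1 - z))\<close> has Taylor
  coefficients at most a constant times \<open>exp (2 * \<epsilon> * sqrt N)\<close>. The conditions
  differ in powers of \<open>a n\<close>, in constants, and in asking for sums or for bounds; each
  such loss is paid with a part of \<open>c\<close>, since \<open>exp (- c / y) <= y / c\<close> and
  the sum of the \<open>y\<close> is finite.

  Division by \<open>cnj (\<phi> (\<Lambda> n))\<close> inverts the Toeplitz operator because Cauchy
  kernels are its eigenvectors.

  Functions on the disk are encoded as vanishing outside it, so nonzero polynomials and Cauchy
  kernels are not in \<open>H2\<close>. The proof therefore works weakly: the expansion of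
  \<open>f\<close> enters through the pairings of \<open>f\<close> with \<open>k\<close> in
  \<open>H2\<close>, which evaluate \<open>k\<close> at the points \<open>\<Lambda> n\<close>. Inner
  products are integrals of radial limits against an uncompleted Borel measure, so these limits must
  exist almost everywhere and be Borel on the whole plane.\<close>

lemma sets_circle_measure [measurable_cong, simp]: "sets circle_measure = sets borel"
  by (simp add: circle_measure_def)

lemma space_circle_measure [simp]: "space circle_measure = UNIV"
  by (simp add: circle_measure_def)

lemma measurable_cis [measurable]: "cis \<in> borel_measurable borel"
  by (intro borel_measurable_continuous_onI continuous_intros)

lemma borel_measurable_cnj [measurable (raw)]:
  "f \<in> borel_measurable M \<Longrightarrow> (\<lambda>x. cnj (f x)) \<in> borel_measurable M"
  by (rule measurable_compose[of f M borel cnj borel])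
     (auto intro!: borel_measurable_continuous_onI continuous_intros)

lemma uniform_circle_prob: "emeasure (uniform_measure lborel {0..<2 * pi}) UNIV = 1"
  by (subst emeasure_uniform_measure) auto

lemma prob_space_circle_measure: "emeasure circle_measure UNIV = 1"
  unfolding circle_measure_def
  by (subst emeasure_distr) (auto simp: uniform_circle_prob)

interpretation circle: finite_measure circle_measure
  by standard (simp add: prob_space_circle_measure)

lemma measure_circle_UNIV: "measure circle_measure UNIV = 1"
  by (simp add: measure_def prob_space_circle_measure)

lemma AE_circleI:
  assumes "{\<xi>. P \<xi>} \<in> sets borel" "AE t in lborel. t \<in> {0..<2*pi} \<longrightarrow> P (cis t)"
  shows "AE \<xi> in circle_measure. P \<xi>"
  unfolding circle_measure_def
  using assms by (subst AE_distr_iff) (auto intro!: AE_uniform_measureI)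

lemma AE_circle_norm: "AE \<xi> in circle_measure. norm \<xi> = 1"
  by (rule AE_circleI) auto

text \<open>Poisson kernels at points of the radius from \<open>0\<close> to \<open>1\<close>
  concentrate at \<open>1\<close>; \<open>outer_decay\<close> needs this one point to be
  null.\<close>

lemma AE_circle_neq_1: "AE \<xi> in circle_measure. \<xi> \<noteq> 1"
proof (rule AE_circleI)
  have "cis t \<noteq> 1" if "t \<noteq> 0" "t \<in> {0..<2*pi}" for t
  proof
    assume "cis t = 1"
    then have "cos t = 1" by (metis cis.sel(1) one_complex.sel(1))
    then obtain n :: int where n: "t = n * 2 * pi" by (auto simp: cos_one_2pi_int)
    then have "0 < n" "n < 1" using that pi_gt_zero by (auto simp: zero_less_mult_iff zero_le_mult_iff not_less)
    then show False by simp
  qed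
  then show "AE t in lborel. t \<in> {0..<2 * pi} \<longrightarrow> cis t \<noteq> 1"
    using AE_lborel_singleton[of "0::real"] by (auto elim!: eventually_mono)
qed auto

lemma circle_integral:
  fixes u :: "complex \<Rightarrow> 'b::{banach, second_countable_topology}"
  assumes [measurable]: "u \<in> borel_measurable borel"
  shows "(LINT \<xi>|circle_measure. u \<xi>) = (LBINT t:{0..<2*pi}. u (cis t)) /\<^sub>R (2*pi)"
    and "integrable circle_measure u \<longleftrightarrow> set_integrable lborel {0..<2*pi} (\<lambda>t. u (cis t))"
proof -
  have um: "uniform_measure lborel {0..<2 * pi} = density lborel (\<lambda>t. ennreal (indicator {0..<2*pi} t / (2*pi)))"
    unfolding uniform_measure_def
    proof (intro density_cong AE_I2)
    fix t :: real
    show "indicator {0..<2 * pi} t / emeasure lborel {0..<2 * pi} = ennreal (indicator {0..<2*pi} t / (2*pi))"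
      using divide_ennreal[of 1 "2*pi"] by (auto split: split_indicator)
  qed auto
  have "(LINT \<xi>|circle_measure. u \<xi>) = (LINT t|lborel. (indicat_real {0..<2*pi} t / (2*pi)) *\<^sub>R u (cis t))"
    unfolding circle_measure_def um by (simp add: integral_distr integral_density)
  also have "\<dots> = (LINT t|lborel. (1 / (2*pi)) *\<^sub>R (indicat_real {0..<2*pi} t *\<^sub>R u (cis t)))"
    by (rule Bochner_Integration.integral_cong) auto
  also have "\<dots> = (1 / (2*pi)) *\<^sub>R (LINT t|lborel. indicat_real {0..<2*pi} t *\<^sub>R u (cis t))"
    by (rule integral_scaleR_right)
  finally show "(LINT \<xi>|circle_measure. u \<xi>) = (LBINT t:{0..<2*pi}. u (cis t)) /\<^sub>R (2*pi)"
    by (simp add: set_lebesgue_integral_def inverse_eq_divide)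
  have "integrable circle_measure u \<longleftrightarrow> integrable lborel (\<lambda>t. (indicator {0..<2*pi} t / (2*pi)) *\<^sub>R u (cis t))"
    unfolding circle_measure_def um by (simp add: integrable_distr_eq integrable_density)
  also have "\<dots> \<longleftrightarrow> integrable lborel (\<lambda>t. (1 / (2*pi)) *\<^sub>R (indicat_real {0..<2*pi} t *\<^sub>R u (cis t)))"
    by (intro Bochner_Integration.integrable_cong) auto
  also have "\<dots> \<longleftrightarrow> integrable lborel (\<lambda>t. indicat_real {0..<2*pi} t *\<^sub>R u (cis t))"
    (is "_ \<longleftrightarrow> integrable lborel ?v")
  proof
    assume "integrable lborel (\<lambda>t. (1 / (2*pi)) *\<^sub>R ?v t)"
    from integrable_scaleR_right[OF this, of "2*pi"] show "integrable lborel ?v" by simp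
  qed (rule integrable_scaleR_right)
  finally show "integrable circle_measure u \<longleftrightarrow> set_integrable lborel {0..<2*pi} (\<lambda>t. u (cis t))"
    by (simp add: set_integrable_def)
qed

lemma circle_integral_continuous:
  fixes u :: "complex \<Rightarrow> 'b::euclidean_space"
  assumes [measurable]: "u \<in> borel_measurable borel" and "continuous_on (sphere 0 1) u"
  shows "(LINT \<xi>|circle_measure. u \<xi>) = integral {0..2*pi} (\<lambda>t. u (cis t)) /\<^sub>R (2*pi)"
    and "integrable circle_measure u"
proof -
  have c: "continuous_on {0..2*pi} (\<lambda>t. u (cis t))"
    by (rule continuous_on_compose2[OF assms(2)]) (auto intro!: continuous_intros)
  have i: "set_integrable lborel {0..2*pi} (\<lambda>t. u (cis t))"
    using c by (rule borel_integrable_atLeastAtMost')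
  have i2: "set_integrable lborel {0..<2*pi} (\<lambda>t. u (cis t))"
    by (rule set_integrable_subset[OF i]) auto
  then show "integrable circle_measure u"
    by (subst circle_integral) auto
  have "(LBINT t:{0..<2*pi}. u (cis t)) = (LBINT t:{0..2*pi}. u (cis t))"
    unfolding set_lebesgue_integral_def
    by (rule integral_cong_AE)
       (use AE_lborel_singleton[of "2*pi"] in \<open>auto elim!: eventually_mono split: split_indicator\<close>)
  also have "\<dots> = integral {0..2*pi} (\<lambda>t. u (cis t))"
    using i by (rule set_borel_integral_eq_integral)
  finally show "(LINT \<xi>|circle_measure. u \<xi>) = integral {0..2*pi} (\<lambda>t. u (cis t)) /\<^sub>R (2*pi)"
    by (simp add: circle_integral)
qed

lemma circle_orthonormal:
  "(LINT \<xi>|circle_measure. \<xi> ^ n * cnj (\<xi> ^ m)) = (if n = m then 1 else 0)"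
proof -
  let ?k = "real n - real m"
  have e: "cis t ^ n * cnj (cis t ^ m) = exp (\<i> * ?k * t)" for t
    by (simp add: Complex.DeMoivre cis_cnj cis_mult left_diff_distrib del: of_nat_diff)
       (simp add: cis_conv_exp algebra_simps)
  have "((\<lambda>t. exp (\<i> * ?k * complex_of_real t)) has_integral (if n = m then of_real (2*pi) else 0)) {0..2*pi}"
  proof (cases "n = m")
    case True
    have "((\<lambda>t. 1 :: complex) has_integral ((2*pi) *\<^sub>R 1)) {0..2*pi}"
      using has_integral_const_real[of "1::complex" 0 "2*pi"] by simp
    then show ?thesis using True by (simp add: scaleR_conv_of_real)
  next
    case False
    let ?F = "\<lambda>t::real. exp (\<i> * ?k * complex_of_real t) / (\<i> * ?k)"
    have "((\<lambda>t. exp (\<i> * ?k * complex_of_real t)) has_integral (?F (2*pi) - ?F 0)) {0..2*pi}"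
      using False by (intro fundamental_theorem_of_calculus)
        (auto intro!: derivative_eq_intros has_vector_derivative_real_field)
    moreover have "exp (\<i> * ?k * complex_of_real (2*pi)) = 1"
    proof -
      have "\<i> * ?k * complex_of_real (2*pi) = 2 * of_int (int n - int m) * pi * \<i>"
        by simp
      then show ?thesis by (metis exp_integer_2pi Ints_of_int mult.assoc)
    qed
    ultimately show ?thesis using False by simp
  qed
  then have "integral {0..2*pi} (\<lambda>t. cis t ^ n * cnj (cis t ^ m)) = (if n = m then of_real (2*pi) else 0)"
    unfolding e by (rule integral_unique)
  then show ?thesis
    by (subst circle_integral_continuous)
       (auto intro!: continuous_intros borel_measurable_continuous_onI simp: scaleR_conv_of_real field_simps)
qed

text \<open>Measurability refers to Borel sets of the plane. As \<open>circle_measure\<close> is not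
  completed, a function that is merely almost everywhere equal to a Borel function need not
  qualify.\<close>

definition square_integrable :: "(complex \<Rightarrow> complex) \<Rightarrow> bool" where
  "square_integrable u \<longleftrightarrow> u \<in> borel_measurable borel \<and> integrable circle_measure (\<lambda>\<xi>. (norm (u \<xi>))\<^sup>2)"

lemma square_integrable_measurable [measurable_dest]:
  "square_integrable u \<Longrightarrow> u \<in> borel_measurable borel"
  by (simp add: square_integrable_def)

lemma square_integrable_add:
  assumes u: "square_integrable u" and v: "square_integrable v"
  shows "square_integrable (\<lambda>\<xi>. u \<xi> + v \<xi>)"
proof -
  note [measurable] = square_integrable_measurable[OF u] square_integrable_measurable[OF v]
  have "integrable circle_measure (\<lambda>\<xi>. (norm (u \<xi> + v \<xi>))\<^sup>2)"
  proof (rule Bochner_Integration.integrable_bound)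
    show "integrable circle_measure (\<lambda>\<xi>. 2 * (norm (u \<xi>))\<^sup>2 + 2 * (norm (v \<xi>))\<^sup>2)"
      using u v by (simp add: square_integrable_def)
    have "(norm (u \<xi> + v \<xi>))\<^sup>2 \<le> 2 * (norm (u \<xi>))\<^sup>2 + 2 * (norm (v \<xi>))\<^sup>2" for \<xi>
    proof -
      have "(norm (u \<xi> + v \<xi>))\<^sup>2 \<le> (norm (u \<xi>) + norm (v \<xi>))\<^sup>2"
        by (intro power_mono norm_triangle_ineq) auto
      also have "\<dots> \<le> 2 * (norm (u \<xi>))\<^sup>2 + 2 * (norm (v \<xi>))\<^sup>2"
        using zero_le_power2[of "norm (u \<xi>) - norm (v \<xi>)"] by (simp add: power2_sum power2_diff)
      finally show ?thesis .
    qed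
    then show "AE \<xi> in circle_measure. norm ((norm (u \<xi> + v \<xi>))\<^sup>2) \<le> norm (2 * (norm (u \<xi>))\<^sup>2 + 2 * (norm (v \<xi>))\<^sup>2)"
      by (intro AE_I2) (smt (verit) real_norm_def zero_le_power2)
  qed measurable
  then show ?thesis by (auto simp: square_integrable_def)
qed

lemma square_integrable_mult_bounded:
  assumes u: "square_integrable u" and [measurable]: "b \<in> borel_measurable borel"
    and b: "AE \<xi> in circle_measure. norm (b \<xi>) \<le> C"
  shows "square_integrable (\<lambda>\<xi>. b \<xi> * u \<xi>)"
proof -
  note [measurable] = square_integrable_measurable[OF u]
  have "integrable circle_measure (\<lambda>\<xi>. (norm (b \<xi> * u \<xi>))\<^sup>2)"
  proof (rule Bochner_Integration.integrable_bound)
    show "integrable circle_measure (\<lambda>\<xi>. C\<^sup>2 * (norm (u \<xi>))\<^sup>2)"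
      using u by (simp add: square_integrable_def)
    show "AE \<xi> in circle_measure. norm ((norm (b \<xi> * u \<xi>))\<^sup>2) \<le> norm (C\<^sup>2 * (norm (u \<xi>))\<^sup>2)"
      using b by eventually_elim
        (auto simp: norm_mult power_mult_distrib intro!: mult_right_mono power_mono)
  qed measurable
  then show ?thesis by (auto simp: square_integrable_def)
qed

lemma square_integrable_uminus: "square_integrable u \<Longrightarrow> square_integrable (\<lambda>\<xi>. - u \<xi>)"
  by (auto simp: square_integrable_def)

lemma square_integrable_diff:
  "square_integrable u \<Longrightarrow> square_integrable v \<Longrightarrow> square_integrable (\<lambda>\<xi>. u \<xi> - v \<xi>)"
  using square_integrable_add[of u "\<lambda>\<xi>. - v \<xi>"] square_integrable_uminus[of v] by simp

lemma square_integrable_continuous: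
  assumes "u \<in> borel_measurable borel" "continuous_on (sphere 0 1) u"
  shows "square_integrable u"
  using assms unfolding square_integrable_def
  by (auto intro!: circle_integral_continuous(2) continuous_intros)

lemma L2_Cauchy_Schwarz:
  assumes u: "square_integrable u" and v: "square_integrable v"
  shows "integrable circle_measure (\<lambda>\<xi>. u \<xi> * cnj (v \<xi>))"
    and "norm (L2_inner u v) \<le> L2_norm u * L2_norm v"
    and "(LINT \<xi>|circle_measure. norm (u \<xi>) * norm (v \<xi>)) \<le> L2_norm u * L2_norm v"
proof -
  note [measurable] = square_integrable_measurable[OF u] square_integrable_measurable[OF v]
  have iu: "integrable circle_measure (\<lambda>\<xi>. (norm (u \<xi>))\<^sup>2)" and iv: "integrable circle_measure (\<lambda>\<xi>. (norm (v \<xi>))\<^sup>2)"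
    using u v by (auto simp: square_integrable_def)
  have i: "integrable circle_measure (\<lambda>\<xi>. norm (u \<xi>) * norm (v \<xi>))"
  proof (rule Bochner_Integration.integrable_bound)
    show "integrable circle_measure (\<lambda>\<xi>. (norm (u \<xi>))\<^sup>2 + (norm (v \<xi>))\<^sup>2)" using iu iv by simp
    have "norm (u \<xi>) * norm (v \<xi>) \<le> (norm (u \<xi>))\<^sup>2 + (norm (v \<xi>))\<^sup>2" for \<xi>
    proof -
      have "2 * (norm (u \<xi>) * norm (v \<xi>)) \<le> (norm (u \<xi>))\<^sup>2 + (norm (v \<xi>))\<^sup>2"
        using zero_le_power2[of "norm (u \<xi>) - norm (v \<xi>)"] by (simp add: power2_diff algebra_simps)
      moreover have "0 \<le> norm (u \<xi>) * norm (v \<xi>)" by simp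
      ultimately show ?thesis by linarith
    qed
    then show "AE \<xi> in circle_measure. norm (norm (u \<xi>) * norm (v \<xi>)) \<le> norm ((norm (u \<xi>))\<^sup>2 + (norm (v \<xi>))\<^sup>2)"
      by (intro AE_I2) (auto simp: abs_mult)
  qed measurable
  show i': "integrable circle_measure (\<lambda>\<xi>. u \<xi> * cnj (v \<xi>))"
    by (rule Bochner_Integration.integrable_bound[OF i]) (auto simp: norm_mult)
  have e: "(\<integral>\<^sup>+ \<xi>. ennreal (norm (w \<xi>))^2 \<partial>circle_measure) = ennreal ((L2_norm w)\<^sup>2)"
    if "square_integrable w" for w
    using that by (simp add: square_integrable_def L2_norm_def nn_integral_eq_integral ennreal_power)
  have "(\<integral>\<^sup>+ \<xi>. ennreal (norm (u \<xi>)) * ennreal (norm (v \<xi>)) \<partial>circle_measure)\<^sup>2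
      \<le> (\<integral>\<^sup>+ \<xi>. ennreal (norm (u \<xi>))^2 \<partial>circle_measure) * (\<integral>\<^sup>+ \<xi>. ennreal (norm (v \<xi>))^2 \<partial>circle_measure)"
    by (rule Cauchy_Schwarz_nn_integral) auto
  also have "(\<integral>\<^sup>+ \<xi>. ennreal (norm (u \<xi>)) * ennreal (norm (v \<xi>)) \<partial>circle_measure)
      = ennreal (LINT \<xi>|circle_measure. norm (u \<xi>) * norm (v \<xi>))"
    using i by (simp add: nn_integral_eq_integral flip: ennreal_mult')
  finally have "ennreal ((LINT \<xi>|circle_measure. norm (u \<xi>) * norm (v \<xi>))\<^sup>2) \<le> ennreal ((L2_norm u * L2_norm v)\<^sup>2)"
    unfolding e[OF u] e[OF v] by (simp add: ennreal_power power_mult_distrib flip: ennreal_mult')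
  then have "(LINT \<xi>|circle_measure. norm (u \<xi>) * norm (v \<xi>))\<^sup>2 \<le> (L2_norm u * L2_norm v)\<^sup>2"
    by (subst (asm) ennreal_le_iff) auto
  then show *: "(LINT \<xi>|circle_measure. norm (u \<xi>) * norm (v \<xi>)) \<le> L2_norm u * L2_norm v"
    by (rule power2_le_imp_le) (simp add: L2_norm_def)
  have "norm (L2_inner u v) \<le> (LINT \<xi>|circle_measure. norm (u \<xi>) * norm (v \<xi>))"
    unfolding L2_inner_def using integral_norm_bound[of circle_measure "\<lambda>\<xi>. u \<xi> * cnj (v \<xi>)"]
    by (simp add: norm_mult)
  with * show "norm (L2_inner u v) \<le> L2_norm u * L2_norm v" by linarith
qed

lemma L2_inner_diff_left:
  assumes "square_integrable u" "square_integrable v" "square_integrable w"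
  shows "L2_inner (\<lambda>\<xi>. u \<xi> - v \<xi>) w = L2_inner u w - L2_inner v w"
  unfolding L2_inner_def using L2_Cauchy_Schwarz(1)[OF assms(1,3)] L2_Cauchy_Schwarz(1)[OF assms(2,3)]
  by (simp add: left_diff_distrib)

lemma L2_inner_cnj_commute: "L2_inner v u = cnj (L2_inner u v)"
  unfolding L2_inner_def by (subst Bochner_Integration.integral_cnj[symmetric]) (simp add: mult.commute)

lemma L2_inner_tendsto_left:
  assumes "\<And>N. square_integrable (U N)" "square_integrable u" "square_integrable v"
    and "(\<lambda>N. L2_norm (\<lambda>\<xi>. u \<xi> - U N \<xi>)) \<longlonglongrightarrow> 0"
  shows "(\<lambda>N. L2_inner (U N) v) \<longlonglongrightarrow> L2_inner u v"
proof -
  have "(\<lambda>N. L2_inner u v - L2_inner (U N) v) \<longlonglongrightarrow> 0"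
  proof (rule Lim_null_comparison)
    show "\<forall>\<^sub>F N in sequentially. norm (L2_inner u v - L2_inner (U N) v) \<le> L2_norm (\<lambda>\<xi>. u \<xi> - U N \<xi>) * L2_norm v"
      using L2_Cauchy_Schwarz(2)[OF square_integrable_diff[OF assms(2,1)] assms(3)]
      by (simp add: L2_inner_diff_left assms)
    show "(\<lambda>N. L2_norm (\<lambda>\<xi>. u \<xi> - U N \<xi>) * L2_norm v) \<longlonglongrightarrow> 0"
      using tendsto_mult_right[OF assms(4), of "L2_norm v"] by simp
  qed
  from tendsto_diff[OF tendsto_const[of "L2_inner u v"] this] show ?thesis by simp
qed

lemma L2_inner_tendsto_right:
  assumes "\<And>N. square_integrable (U N)" "square_integrable u" "square_integrable v"
    and "(\<lambda>N. L2_norm (\<lambda>\<xi>. u \<xi> - U N \<xi>)) \<longlonglongrightarrow> 0"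
  shows "(\<lambda>N. L2_inner v (U N)) \<longlonglongrightarrow> L2_inner v u"
  using tendsto_cnj[OF L2_inner_tendsto_left[OF assms]] by (simp flip: L2_inner_cnj_commute)

lemma L2_norm_cong_AE:
  assumes "AE \<xi> in circle_measure. u \<xi> = v \<xi>" "u \<in> borel_measurable borel" "v \<in> borel_measurable borel"
  shows "L2_norm u = L2_norm v"
  unfolding L2_norm_def using assms
  by (intro arg_cong[where f=sqrt] integral_cong_AE) (auto elim!: eventually_mono)

lemma L2_inner_cong_AE:
  assumes "AE \<xi> in circle_measure. u \<xi> = u' \<xi>" "AE \<xi> in circle_measure. v \<xi> = v' \<xi>"
    "u \<in> borel_measurable borel" "v \<in> borel_measurable borel" "u' \<in> borel_measurable borel" "v' \<in> borel_measurable borel"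
  shows "L2_inner u v = L2_inner u' v'"
  unfolding L2_inner_def
proof (rule integral_cong_AE)
  show "AE \<xi> in circle_measure. u \<xi> * cnj (v \<xi>) = u' \<xi> * cnj (v' \<xi>)"
    using assms(1,2) by eventually_elim simp
qed (use assms(3-6) in simp_all)

text \<open>Parseval's identity by dominated convergence: on the circle the partial sums are bounded
  by the sums of the moduli of the coefficients. This version covers dilates, Poisson's formula and
  Cauchy kernels, whose expansions converge absolutely up to the circle.\<close>

lemma L2_inner_abs_series:
  assumes c: "summable (\<lambda>n. norm (c n))" and d: "summable (\<lambda>n. norm (d n))"
    and [measurable]: "F \<in> borel_measurable borel" "G \<in> borel_measurable borel"
    and F: "\<And>\<xi>. norm \<xi> = 1 \<Longrightarrow> (\<lambda>n. c n * \<xi> ^ n) sums F \<xi>"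
    and G: "\<And>\<xi>. norm \<xi> = 1 \<Longrightarrow> (\<lambda>n. d n * \<xi> ^ n) sums G \<xi>"
  shows "(\<lambda>n. c n * cnj (d n)) sums L2_inner F G"
proof -
  let ?S = "\<lambda>c N \<xi>. \<Sum>n<N. c n * \<xi> ^ n :: complex"
  have "(\<lambda>N. LINT \<xi>|circle_measure. ?S c N \<xi> * cnj (?S d N \<xi>)) \<longlonglongrightarrow> (LINT \<xi>|circle_measure. F \<xi> * cnj (G \<xi>))"
  proof (rule integral_dominated_convergence)
    show "AE \<xi> in circle_measure. (\<lambda>N. ?S c N \<xi> * cnj (?S d N \<xi>)) \<longlonglongrightarrow> F \<xi> * cnj (G \<xi>)"
      using AE_circle_norm
    proof eventually_elim
      case (elim \<xi>)
      then show ?case using F[of \<xi>] G[of \<xi>] unfolding sums_def by (intro tendsto_intros)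
    qed
    have b: "norm (?S e N \<xi>) \<le> (\<Sum>n. norm (e n))" if "norm \<xi> = 1" "summable (\<lambda>n. norm (e n))" for e N \<xi>
    proof -
      have "norm (?S e N \<xi>) \<le> (\<Sum>n<N. norm (e n))"
        by (rule order_trans[OF norm_sum]) (simp add: norm_mult norm_power that)
      also have "\<dots> \<le> (\<Sum>n. norm (e n))" using that by (intro sum_le_suminf) auto
      finally show ?thesis .
    qed
    show "AE \<xi> in circle_measure. norm (?S c N \<xi> * cnj (?S d N \<xi>)) \<le> (\<Sum>n. norm (c n)) * (\<Sum>n. norm (d n))" for N
      using AE_circle_norm
    proof eventually_elim
      case (elim \<xi>)
      have "norm (?S c N \<xi> * cnj (?S d N \<xi>)) = norm (?S c N \<xi>) * norm (?S d N \<xi>)"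
        by (simp only: norm_mult complex_mod_cnj)
      also have "\<dots> \<le> (\<Sum>n. norm (c n)) * (\<Sum>n. norm (d n))"
        using elim c d by (intro mult_mono b suminf_nonneg) auto
      finally show ?case .
    qed
  qed auto
  moreover have "(LINT \<xi>|circle_measure. ?S c N \<xi> * cnj (?S d N \<xi>)) = (\<Sum>n<N. c n * cnj (d n))" for N
  proof -
    have i: "integrable circle_measure (\<lambda>\<xi>. \<xi> ^ m * cnj (\<xi> ^ n))" for m n
      by (rule circle_integral_continuous(2)) (auto intro!: continuous_intros borel_measurable_continuous_onI)
    have "(LINT \<xi>|circle_measure. ?S c N \<xi> * cnj (?S d N \<xi>))
       = (LINT \<xi>|circle_measure. (\<Sum>m<N. \<Sum>n<N. (c m * cnj (d n)) * (\<xi> ^ m * cnj (\<xi> ^ n))))"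
      by (simp add: sum_product cnj_sum algebra_simps)
    also have "\<dots> = (\<Sum>m<N. \<Sum>n<N. (c m * cnj (d n)) * (LINT \<xi>|circle_measure. \<xi> ^ m * cnj (\<xi> ^ n)))"
      using i by (simp add: Bochner_Integration.integral_sum)
    also have "\<dots> = (\<Sum>m<N. \<Sum>n<N. if m = n then c m * cnj (d n) else 0)"
      unfolding circle_orthonormal by (intro sum.cong refl) auto
    also have "\<dots> = (\<Sum>n<N. c n * cnj (d n))" by (simp add: sum.delta)
    finally show ?thesis .
  qed
  ultimately show ?thesis by (simp add: sums_def L2_inner_def)
qed

section \<open>Taylor coefficients and the Hardy space\<close>

definition taylor :: "(complex \<Rightarrow> complex) \<Rightarrow> nat \<Rightarrow> complex" where
  "taylor F n = (deriv ^^ n) F 0 / fact n"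

lemma taylor_sums_ball:
  assumes "F holomorphic_on ball 0 R" "norm z < R"
  shows "(\<lambda>n. taylor F n * z ^ n) sums F z"
  using holomorphic_power_series[OF assms(1), of z] assms(2) by (simp add: taylor_def)

lemma taylor_abs_summable_ball:
  assumes "F holomorphic_on ball 0 R" "norm z < R"
  shows "summable (\<lambda>n. norm (taylor F n * z ^ n))"
proof -
  obtain r where r: "norm z < r" "r < R" using assms(2) dense by blast
  then have "0 \<le> r" using norm_ge_zero[of z] by linarith
  then have "summable (\<lambda>n. taylor F n * complex_of_real r ^ n)"
    using taylor_sums_ball[OF assms(1), of "of_real r"] r by (auto simp: sums_iff)
  then show ?thesis by (rule powser_insidea) (use r \<open>0 \<le> r\<close> in auto)
qed

lemma taylor_eqI:
  assumes "0 < R" "\<And>z. norm z < R \<Longrightarrow> (\<lambda>n. c n * z ^ n) sums F z"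
  shows "taylor F n = c n"
proof -
  have "F has_fps_expansion Abs_fps c"
    by (rule has_fps_expansionI)
       (use assms in \<open>auto simp: eventually_nhds_metric intro!: exI[of _ R]\<close>)
  from fps_nth_fps_expansion[OF this, of n] show ?thesis by (simp add: taylor_def)
qed

lemma analytic_disk_outside: "F \<in> analytic_disk \<Longrightarrow> 1 \<le> norm z \<Longrightarrow> F z = 0"
  by (auto simp: analytic_disk_def)

lemma analytic_disk_holomorphic: "F \<in> analytic_disk \<Longrightarrow> F holomorphic_on ball 0 1"
  by (auto simp: analytic_disk_def)

lemma analytic_disk_continuous: "F \<in> analytic_disk \<Longrightarrow> continuous_on (ball 0 1) F"
  by (rule holomorphic_on_imp_continuous_on[OF analytic_disk_holomorphic])

lemma analytic_disk_measurable [measurable_dest]: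
  assumes "F \<in> analytic_disk" shows "F \<in> borel_measurable borel"
proof -
  have "(\<lambda>z. indicator (ball 0 1) z *\<^sub>R F z) \<in> borel_measurable borel"
    by (rule borel_measurable_continuous_on_indicator) (auto intro: analytic_disk_continuous assms)
  also have "(\<lambda>z. indicator (ball 0 1) z *\<^sub>R F z) = F"
    using analytic_disk_outside[OF assms] by (auto split: split_indicator)
  finally show ?thesis .
qed

lemma analytic_disk_taylor_sums: "F \<in> analytic_disk \<Longrightarrow> norm z < 1 \<Longrightarrow> (\<lambda>n. taylor F n * z ^ n) sums F z"
  by (intro taylor_sums_ball[where R = 1] analytic_disk_holomorphic)

lemma analytic_disk_eqI:
  assumes "F \<in> analytic_disk" "G \<in> analytic_disk" "\<And>n. taylor F n = taylor G n"
  shows "F = G"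
proof
  fix z
  show "F z = G z"
  proof (cases "norm z < 1")
    case True
    then show ?thesis
      using sums_unique2[OF analytic_disk_taylor_sums[OF assms(1), of z], of "G z"]
        analytic_disk_taylor_sums[OF assms(2), of z] assms(3) by auto
  next
    case False
    then show ?thesis
      using analytic_disk_outside[OF assms(1), of z] analytic_disk_outside[OF assms(2), of z] by simp
  qed
qed

text \<open>The cut at the circle puts the sum into \<open>analytic_disk\<close>; without it a
  finite sum such as \<open>z ^ n\<close> would be nonzero outside the disk.\<close>

definition disk_series :: "(nat \<Rightarrow> complex) \<Rightarrow> complex \<Rightarrow> complex" where
  "disk_series c z = (if norm z < 1 then \<Sum>n. c n * z ^ n else 0)"

lemma disk_series_sums:
  assumes "Bseq c" "norm z < 1"
  shows "(\<lambda>n. c n * z ^ n) sums disk_series c z"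
proof -
  obtain K where K: "\<And>n. norm (c n) \<le> K" using assms(1) by (auto simp: Bseq_def)
  have "summable (\<lambda>n. c n * z ^ n)"
  proof (rule summable_comparison_test')
    show "summable (\<lambda>n. K * norm z ^ n)" using assms(2) by (intro summable_mult summable_geometric) auto
    show "norm (c n * z ^ n) \<le> K * norm z ^ n" for n
      by (auto simp: norm_mult norm_power intro!: mult_right_mono K)
  qed
  then show ?thesis using assms(2) by (simp add: disk_series_def sums_iff)
qed

lemma disk_series_analytic:
  assumes "Bseq c" shows "disk_series c \<in> analytic_disk"
proof -
  have "disk_series c holomorphic_on ball 0 1"
    by (rule power_series_holomorphic[where a = c]) (use disk_series_sums[OF assms] in auto)
  then show ?thesis by (auto simp: analytic_disk_def disk_series_def)
qed

lemma taylor_disk_series: "Bseq c \<Longrightarrow> taylor (disk_series c) n = c n"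
  by (rule taylor_eqI[of 1]) (auto intro: disk_series_sums)

lemma Bseq_square_summable:
  fixes c :: "nat \<Rightarrow> complex"
  assumes "summable (\<lambda>n. (norm (c n))\<^sup>2)"
  shows "Bseq c"
proof -
  have "(\<lambda>n. sqrt ((norm (c n))\<^sup>2)) \<longlonglongrightarrow> sqrt 0"
    by (intro tendsto_intros summable_LIMSEQ_zero assms)
  then have "(\<lambda>n. norm (c n)) \<longlonglongrightarrow> 0" by simp
  then have "c \<longlonglongrightarrow> 0" by (simp add: tendsto_norm_zero_iff)
  then show ?thesis by (intro convergent_imp_Bseq convergentI)
qed

lemma dilate_measurable [measurable]:
  "F \<in> borel_measurable borel \<Longrightarrow> (\<lambda>\<xi>. F (w * \<xi>)) \<in> borel_measurable (borel :: complex measure)"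
  by (rule measurable_compose[of "\<lambda>\<xi>. w * \<xi>" borel borel]) auto

lemma dilate_continuous:
  assumes "F \<in> analytic_disk" "norm w < 1"
  shows "continuous_on (sphere 0 1) (\<lambda>\<xi>. F (w * \<xi>))"
  by (rule continuous_on_compose2[OF analytic_disk_continuous[OF assms(1)]])
     (use assms in \<open>auto intro!: continuous_intros simp: norm_mult\<close>)

lemma circle_norm2_dilate:
  assumes F: "F \<in> analytic_disk" and r: "0 \<le> r" "r < 1"
  shows "(\<lambda>n. (norm (taylor F n))\<^sup>2 * r ^ (2 * n)) sums (LINT \<xi>|circle_measure. (norm (F (complex_of_real r * \<xi>)))\<^sup>2)"
proof -
  note [measurable] = analytic_disk_measurable[OF F]
  let ?c = "\<lambda>n. taylor F n * complex_of_real r ^ n"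
  have s: "summable (\<lambda>n. norm (?c n))"
    by (rule taylor_abs_summable_ball[OF analytic_disk_holomorphic[OF F]]) (use r in auto)
  have t: "(\<lambda>n. ?c n * \<xi> ^ n) sums F (complex_of_real r * \<xi>)" if "norm \<xi> = 1" for \<xi>
    using analytic_disk_taylor_sums[OF F, of "of_real r * \<xi>"] that r
    by (simp add: norm_mult power_mult_distrib mult.assoc)
  have "(\<lambda>n. ?c n * cnj (?c n)) sums L2_inner (\<lambda>\<xi>. F (complex_of_real r * \<xi>)) (\<lambda>\<xi>. F (complex_of_real r * \<xi>))"
    by (rule L2_inner_abs_series[OF s s _ _ t t]) auto
  moreover have "L2_inner (\<lambda>\<xi>. F (complex_of_real r * \<xi>)) (\<lambda>\<xi>. F (complex_of_real r * \<xi>))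
      = of_real (LINT \<xi>|circle_measure. (norm (F (complex_of_real r * \<xi>)))\<^sup>2)"
    unfolding L2_inner_def complex_norm_square[symmetric] by (rule integral_complex_of_real)
  moreover have "?c n * cnj (?c n) = of_real ((norm (taylor F n))\<^sup>2 * r ^ (2 * n))" for n
  proof -
    have "(norm (?c n))\<^sup>2 = (norm (taylor F n))\<^sup>2 * r ^ (2 * n)"
      by (simp add: norm_mult norm_power power_mult_distrib power_mult mult.commute power_even_abs flip: power_mult)
    then show ?thesis by (simp only: complex_norm_square[symmetric])
  qed
  ultimately show ?thesis by (simp only: sums_of_real_iff)
qed

text \<open>By Parseval the mean on the circle of radius \<open>r\<close> is the sum with weights
  \<open>r ^ (2 * n)\<close>. In one direction \<open>r\<close> tends to \<open>1\<close> in a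
  finite partial sum, in the other the weights are at most \<open>1\<close>. From here on
  \<open>H2\<close> is handled through coefficients.\<close>

lemma H2_iff:
  "F \<in> H2 \<longleftrightarrow> F \<in> analytic_disk \<and> summable (\<lambda>n. (norm (taylor F n))\<^sup>2)"
proof (intro iffI conjI; (elim conjE)?)
  assume "F \<in> H2"
  then show F: "F \<in> analytic_disk" by (simp add: H2_def)
  obtain M where M: "\<And>r. 0 \<le> r \<Longrightarrow> r < 1 \<Longrightarrow> (LINT \<xi>|circle_measure. (norm (F (complex_of_real r * \<xi>)))\<^sup>2) \<le> M"
    using \<open>F \<in> H2\<close> unfolding H2_def bdd_above_def by fastforce
  have "(\<Sum>n<N. (norm (taylor F n))\<^sup>2) \<le> M" for N
  proof (rule tendsto_upperbound)
    show "((\<lambda>r. \<Sum>n<N. (norm (taylor F n))\<^sup>2 * r ^ (2 * n)) \<longlongrightarrow> (\<Sum>n<N. (norm (taylor F n))\<^sup>2)) (at_left 1)"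
      by (auto intro!: tendsto_eq_intros)
    show "\<forall>\<^sub>F r in at_left 1. (\<Sum>n<N. (norm (taylor F n))\<^sup>2 * r ^ (2 * n)) \<le> M"
      using eventually_at_left_real[of 0 "1::real", OF zero_less_one]
    proof eventually_elim
      case (elim r)
      then have r: "0 \<le> r" "r < 1" by auto
      have "(\<Sum>n<N. (norm (taylor F n))\<^sup>2 * r ^ (2 * n)) \<le> (LINT \<xi>|circle_measure. (norm (F (complex_of_real r * \<xi>)))\<^sup>2)"
        unfolding sums_unique[OF circle_norm2_dilate[OF F r]]
        using sums_summable[OF circle_norm2_dilate[OF F r]] r by (intro sum_le_suminf) auto
      with M[OF r] show ?case by linarith
    qed
  qed auto
  then show "summable (\<lambda>n. (norm (taylor F n))\<^sup>2)"
    by (intro summableI_nonneg_bounded) auto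
next
  assume F: "F \<in> analytic_disk" and s: "summable (\<lambda>n. (norm (taylor F n))\<^sup>2)"
  have "(LINT \<xi>|circle_measure. (norm (F (complex_of_real r * \<xi>)))\<^sup>2) \<le> (\<Sum>n. (norm (taylor F n))\<^sup>2)"
    if r: "0 \<le> r" "r < 1" for r
    by (rule sums_le[OF _ circle_norm2_dilate[OF F r] summable_sums[OF s]])
       (use r in \<open>auto intro!: mult_left_le power_le_one\<close>)
  then show "F \<in> H2" using F by (auto simp: H2_def intro!: bdd_aboveI)
qed

section \<open>The coefficient norm and Poisson's formula\<close>

definition H2_norm2 :: "(complex \<Rightarrow> complex) \<Rightarrow> real" where
  "H2_norm2 F = (\<Sum>n. (norm (taylor F n))\<^sup>2)"

lemma H2_analytic: "F \<in> H2 \<Longrightarrow> F \<in> analytic_disk"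
  by (simp add: H2_iff)

lemma H2_dilate_le:
  assumes "F \<in> H2" "0 \<le> r" "r < 1"
  shows "(LINT \<xi>|circle_measure. (norm (F (complex_of_real r * \<xi>)))\<^sup>2) \<le> H2_norm2 F"
  unfolding H2_norm2_def using assms H2_iff[of F]
  by (intro sums_le[OF _ circle_norm2_dilate summable_sums])
     (auto intro!: mult_left_le power_le_one)

text \<open>Pairing with the geometric series \<open>1 / (1 - r * \<xi>)\<close> evaluates a
  function at \<open>r\<close>. Applied to \<open>F (w * z) / (1 - r * z)\<close>, the two
  denominators combine on the circle to \<open>|1 - r * \<xi>|^2\<close>, and the factor
  \<open>1 - r^2\<close> removes the denominator at \<open>r\<close>.\<close>

lemma Poisson_dilate:
  assumes F: "F \<in> analytic_disk" and \<rho>: "0 \<le> \<rho>" "\<rho> < 1" and r: "0 \<le> r" "r < 1"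
  shows "F (of_real (\<rho> * r) * cis \<theta>) =
    integral {0..2*pi} (\<lambda>t. of_real ((1 - r\<^sup>2) / (norm (1 - of_real r * cis t))\<^sup>2) * F (of_real \<rho> * cis (\<theta> + t))) /\<^sub>R (2*pi)"
proof -
  note [measurable] = analytic_disk_measurable[OF F]
  define w where "w = of_real \<rho> * cis \<theta>"
  have w: "norm w = \<rho>" using \<rho> by (simp add: w_def norm_mult)
  \<comment> \<open>\<open>K\<close> must be holomorphic beyond the closed disk so that its Taylor
    series converges absolutely on the circle. The choice \<open>2 / (1 + m)\<close> with
    \<open>m = max \<rho> r\<close> exceeds \<open>1\<close>, and its product with \<open>m\<close>
    stays below \<open>1\<close> because \<open>2 * m < 1 + m\<close>.\<close>
  obtain R where R: "1 < R" "R * \<rho> < 1" "R * r < 1"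
  proof
    let ?m = "max \<rho> r"
    have m: "0 \<le> ?m" "?m < 1" using \<rho> r by auto
    show "1 < 2 / (1 + ?m)" using m by (simp add: field_simps)
    have "2 / (1 + ?m) * x < 1" if "x \<le> ?m" "0 \<le> x" for x
    proof -
      have "2 * x < 1 + ?m" using m that by linarith
      then show ?thesis using m by (simp add: field_simps)
    qed
    then show "2 / (1 + ?m) * \<rho> < 1" "2 / (1 + ?m) * r < 1" using \<rho> r by auto
  qed
  define K where "K = (\<lambda>z. F (w * z) / (1 - of_real r * z))"
  have nz: "1 - of_real r * z \<noteq> 0" if "norm z < R" for z :: complex
  proof
    assume "1 - of_real r * z = 0"
    then have "norm (of_real r * z) = 1" by (simp add: algebra_simps)
    then have "r * norm z = 1" using r by (simp add: norm_mult)
    moreover have "r * norm z \<le> r * R" using that r by (intro mult_left_mono) auto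
    ultimately show False using R by (simp add: mult.commute)
  qed
  have wz: "norm (w * z) < 1" if "norm z < R" for z
    using that mult_left_mono[of "norm z" R \<rho>] \<rho> R by (simp add: norm_mult w mult.commute)
  have holK: "K holomorphic_on ball 0 R"
    unfolding K_def using nz wz
    by (intro holomorphic_intros holomorphic_on_compose_gen[OF _ analytic_disk_holomorphic[OF F], unfolded o_def]) auto
  have K: "summable (\<lambda>n. norm (taylor K n))" "\<And>\<xi>. norm \<xi> = 1 \<Longrightarrow> (\<lambda>n. taylor K n * \<xi> ^ n) sums K \<xi>"
    "(\<lambda>n. taylor K n * of_real r ^ n) sums K (of_real r)"
    using taylor_abs_summable_ball[OF holK, of 1] taylor_sums_ball[OF holK] R(1) r by auto
  have Km: "K \<in> borel_measurable borel" unfolding K_def by measurable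
  have D: "(\<lambda>n. of_real r ^ n * \<xi> ^ n) sums (1 / (1 - of_real r * \<xi>))" if "norm \<xi> = 1" for \<xi> :: complex
    using geometric_sums[of "of_real r * \<xi>"] r that by (simp add: norm_mult power_mult_distrib)
  have "(\<lambda>n. taylor K n * cnj (of_real r ^ n)) sums L2_inner K (\<lambda>\<xi>. 1 / (1 - of_real r * \<xi>))"
    by (rule L2_inner_abs_series[OF K(1) _ Km _ K(2) D])
       (use r in \<open>auto simp: norm_power intro!: summable_geometric\<close>)
  with K(3) have "L2_inner K (\<lambda>\<xi>. 1 / (1 - of_real r * \<xi>)) = K (of_real r)"
    by (simp add: sums_unique2)
  moreover have "L2_inner K (\<lambda>\<xi>. 1 / (1 - of_real r * \<xi>)) =
    integral {0..2*pi} (\<lambda>t. K (cis t) * cnj (1 / (1 - of_real r * cis t))) /\<^sub>R (2*pi)"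
    unfolding L2_inner_def
  proof (rule circle_integral_continuous)
    show "continuous_on (sphere 0 1) (\<lambda>\<xi>. K \<xi> * cnj (1 / (1 - complex_of_real r * \<xi>)))"
      using nz R by (intro continuous_intros continuous_on_subset[OF holomorphic_on_imp_continuous_on[OF holK]]) auto
    show "(\<lambda>\<xi>. K \<xi> * cnj (1 / (1 - complex_of_real r * \<xi>))) \<in> borel_measurable borel"
      using Km by measurable
  qed
  moreover have "K (cis t) * cnj (1 / (1 - of_real r * cis t)) =
     of_real (1 / (norm (1 - of_real r * cis t))\<^sup>2) * F (of_real \<rho> * cis (\<theta> + t))" for t
    unfolding K_def by (simp add: complex_norm_square[symmetric] w_def cis_mult mult.assoc del: complex_cnj_diff)
  ultimately have "K (of_real r) = integral {0..2*pi} (\<lambda>t. of_real (1 / (norm (1 - of_real r * cis t))\<^sup>2) * F (of_real \<rho> * cis (\<theta> + t))) /\<^sub>R (2*pi)"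
    by simp
  moreover have "F (of_real (\<rho> * r) * cis \<theta>) = of_real (1 - r\<^sup>2) * K (of_real r)"
  proof -
    have "1 - complex_of_real r * of_real r \<noteq> 0" using nz[of r] R r by simp
    moreover have "of_real (1 - r\<^sup>2) = 1 - complex_of_real r * of_real r" by (simp add: power2_eq_square)
    moreover have "of_real (\<rho> * r) * cis \<theta> = w * of_real r" by (simp add: w_def)
    ultimately show ?thesis by (simp only: K_def) simp
  qed
  ultimately show ?thesis
    by (simp add: mult.assoc integral_mult_right[symmetric] flip: integral_mult_right)
qed

section \<open>Poisson averages and the maximal inequality\<close>

lemma continuous_antiderivative_interval:
  fixes g :: "real \<Rightarrow> real"
  assumes "continuous_on UNIV g"
  obtains G where "\<And>x. x \<in> {a<..<b} \<Longrightarrow> (G has_real_derivative g x) (at x)"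
proof -
  obtain G where G: "\<And>x. x \<in> {a..b} \<Longrightarrow> (G has_vector_derivative g x) (at x within {a..b})"
    using antiderivative_continuous[of a b g] continuous_on_subset[OF assms] by auto
  show ?thesis
  proof (rule that)
    fix x assume x: "x \<in> {a<..<b}"
    then have "at x within {a..b} = at x" by (intro at_within_interior) auto
    with G[of x] x show "(G has_real_derivative g x) (at x)"
      by (simp add: has_real_derivative_iff_has_vector_derivative)
  qed
qed

lemma integral_antiderivative:
  fixes g :: "real \<Rightarrow> real"
  assumes "\<And>x. x \<in> {a<..<b} \<Longrightarrow> (G has_real_derivative g x) (at x)" "a < s" "s \<le> t" "t < b"
  shows "integral {s..t} g = G t - G s"
proof (rule integral_unique, rule fundamental_theorem_of_calculus[OF assms(3)])
  fix x assume "x \<in> {s..t}"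
  then have "(G has_real_derivative g x) (at x)" using assms(2,4) by (intro assms(1)) auto
  then show "(G has_vector_derivative g x) (at x within {s..t})"
    unfolding has_real_derivative_iff_has_vector_derivative by (rule has_vector_derivative_at_within)
qed

definition Poisson_kernel :: "real \<Rightarrow> real \<Rightarrow> real" where
  "Poisson_kernel r t = (1 - r\<^sup>2) / (norm (1 - of_real r * cis t))\<^sup>2"

lemma Poisson_kernel_eq: "Poisson_kernel r t = (1 - r\<^sup>2) / (1 - 2 * r * cos t + r\<^sup>2)"
proof -
  have "(norm (1 - of_real r * cis t))\<^sup>2 = (1 - r * cos t)\<^sup>2 + (r * sin t)\<^sup>2"
    unfolding cmod_power2 by simp
  also have "\<dots> = 1 - 2 * r * cos t + r\<^sup>2 * ((sin t)\<^sup>2 + (cos t)\<^sup>2)"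
    by algebra
  finally have "(norm (1 - of_real r * cis t))\<^sup>2 = 1 - 2 * r * cos t + r\<^sup>2" by simp
  then show ?thesis by (simp add: Poisson_kernel_def)
qed

lemma Poisson_denom_pos:
  fixes r t :: real
  assumes "0 \<le> r" "r < 1" shows "0 < 1 - 2 * r * cos t + r\<^sup>2"
proof -
  have "2 * r * cos t \<le> 2 * r * 1" using assms by (intro mult_left_mono) auto
  then have "1 - 2 * r * cos t + r\<^sup>2 \<ge> (1 - r)\<^sup>2" by (simp add: power2_eq_square algebra_simps)
  moreover have "0 < (1 - r)\<^sup>2" using assms by simp
  ultimately show ?thesis by linarith
qed

lemma Poisson_kernel_nonneg: "0 \<le> r \<Longrightarrow> r < 1 \<Longrightarrow> 0 \<le> Poisson_kernel r t"
  by (simp add: Poisson_kernel_def abs_square_le_1)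

lemma Poisson_kernel_continuous:
  assumes "0 \<le> r" "r < 1" shows "continuous_on A (Poisson_kernel r)"
proof -
  have "1 - 2 * r * cos t + r\<^sup>2 \<noteq> 0" for t
    using Poisson_denom_pos[OF assms, of t] by linarith
  then show ?thesis unfolding Poisson_kernel_eq[abs_def] by (intro continuous_intros ballI)
qed

lemma Poisson_kernel_deriv:
  assumes "0 \<le> r" "r < 1"
  shows "(Poisson_kernel r has_real_derivative - ((1 - r\<^sup>2) * (2 * r * sin t)) / (1 - 2 * r * cos t + r\<^sup>2)\<^sup>2) (at t)"
proof -
  have "((\<lambda>t. 1 - 2 * r * cos t + r\<^sup>2) has_real_derivative 2 * r * sin t) (at t)"
    by (auto intro!: derivative_eq_intros)
  from DERIV_divide[OF DERIV_const[of "1 - r\<^sup>2"] this] Poisson_denom_pos[OF assms, of t]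
  show ?thesis unfolding Poisson_kernel_eq[abs_def] by (simp add: power2_eq_square)
qed

text \<open>Poisson's formula with \<open>\<rho> = 0\<close> for the constant \<open>1\<close>,
  which is written as the indicator of the disk in order to lie in
  \<open>analytic_disk\<close>.\<close>

lemma integral_Poisson_kernel:
  assumes r: "0 \<le> r" "r < 1" shows "integral {0..2*pi} (Poisson_kernel r) = 2 * pi"
proof -
  let ?F = "indicator (ball 0 1) :: complex \<Rightarrow> complex"
  have "?F holomorphic_on ball 0 1"
    by (rule holomorphic_transform[of "\<lambda>_. 1"]) auto
  then have F: "?F \<in> analytic_disk" by (auto simp: analytic_disk_def)
  have "(\<lambda>t. complex_of_real (Poisson_kernel r t)) integrable_on {0..2*pi}"
    by (intro integrable_continuous_interval continuous_intros Poisson_kernel_continuous r)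
  then have "integral {0..2*pi} (Re \<circ> (\<lambda>t. complex_of_real (Poisson_kernel r t)))
      = Re (integral {0..2*pi} (\<lambda>t. complex_of_real (Poisson_kernel r t)))"
    by (rule integral_linear) (rule bounded_linear_Re)
  moreover have "integral {0..2*pi} (\<lambda>t. complex_of_real (Poisson_kernel r t)) = 2 * pi"
    using Poisson_dilate[OF F order_refl zero_less_one r, of 0]
    by (simp add: Poisson_kernel_def scaleR_conv_of_real field_simps)
  ultimately show ?thesis by (simp add: o_def)
qed

text \<open>The Poisson kernel decreases away from its peak, so a Poisson average is controlled by the
  averages over centred intervals. The antiderivatives replace an integration by parts.\<close>

lemma Poisson_average_le:
  fixes g :: "real \<Rightarrow> real"
  assumes g: "continuous_on UNIV g" and per: "\<And>t. g (t + 2 * pi) = g t"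
    and r: "0 \<le> r" "r < 1" and \<theta>: "\<theta> \<in> {0..2*pi}"
    and avg: "\<And>\<eta>. 0 < \<eta> \<Longrightarrow> \<eta> \<le> pi \<Longrightarrow> integral {\<theta> - \<eta>..\<theta> + \<eta>} g \<le> 2 * \<eta> * A"
  shows "integral {0..2*pi} (\<lambda>t. Poisson_kernel r t * g (\<theta> + t)) \<le> 2 * pi * A"
proof -
  let ?P = "Poisson_kernel r"
  have pi4: "pi < 4" by (rule pi_less_4)
  \<comment> \<open>The bounds only provide room: since \<open>pi < 4\<close>, all points
    \<open>\<theta> + x\<close>, \<open>\<theta> - x\<close> and \<open>2*pi - x\<close> with
    \<open>0 <= x <= pi\<close> lie inside the open interval.\<close>
  obtain G where G: "\<And>x. x \<in> {-10<..<20} \<Longrightarrow> (G has_real_derivative g x) (at x)"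
    using continuous_antiderivative_interval[OF g] by blast
  have Pg: "continuous_on UNIV (\<lambda>t. ?P t * g (\<theta> + t))"
    by (intro continuous_intros Poisson_kernel_continuous r continuous_on_compose2[OF g]) auto
  obtain J where J: "\<And>x. x \<in> {-10<..<20} \<Longrightarrow> (J has_real_derivative ?P x * g (\<theta> + x)) (at x)"
    using continuous_antiderivative_interval[OF Pg] by blast
  obtain I where I: "\<And>x. x \<in> {-10<..<20} \<Longrightarrow> (I has_real_derivative ?P x) (at x)"
    using continuous_antiderivative_interval[OF Poisson_kernel_continuous[OF r]] by blast
  let ?\<Gamma> = "\<lambda>x. G (\<theta> + x) - G (\<theta> - x) - 2 * x * A"
  let ?P' = "\<lambda>x. - ((1 - r\<^sup>2) * (2 * r * sin x)) / (1 - 2 * r * cos x + r\<^sup>2)\<^sup>2"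
  \<comment> \<open>\<open>?D 0\<close> is the integral minus \<open>2 * pi * A\<close>, and
    \<open>?D pi = ?P pi * ?\<Gamma> pi\<close> is nonpositive. The derivative collapses to
    \<open>?P' x * ?\<Gamma> x\<close>, a product of two nonpositive factors. The reflected
    arguments \<open>2*pi - x\<close> fold the two halves of the circle onto each other.\<close>
  let ?D = "\<lambda>x. ?P x * ?\<Gamma> x - (J x - J (2*pi - x)) + A * (I x - I (2*pi - x))"
  have \<Gamma>: "?\<Gamma> x \<le> 0" if "0 \<le> x" "x \<le> pi" for x
  proof (cases "x = 0")
    case False
    have "integral {\<theta> - x..\<theta> + x} g = G (\<theta> + x) - G (\<theta> - x)"
      by (rule integral_antiderivative[where a = "-10" and b = 20, OF G]) (use that \<theta> pi4 in auto)
    with avg[of x] that False show ?thesis by auto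
  qed auto
  have "?D 0 \<le> ?D pi"
  proof (rule DERIV_nonneg_imp_nondecreasing[where f = ?D and a = 0 and b = pi])
    show "0 \<le> pi" by simp
    fix x assume x: "0 \<le> x" "x \<le> pi"
    have e: "?P (2*pi - x) = ?P x" by (simp add: Poisson_kernel_eq cos_diff)
    have e2: "g (\<theta> + (2*pi - x)) = g (\<theta> - x)" using per[of "\<theta> - x"] by (simp add: algebra_simps)
    have d: "(G has_real_derivative g (\<theta> + x)) (at (\<theta> + x))" "(G has_real_derivative g (\<theta> - x)) (at (\<theta> - x))"
      "(J has_real_derivative ?P x * g (\<theta> + x)) (at x)"
      "(J has_real_derivative ?P (2*pi - x) * g (\<theta> + (2*pi - x))) (at (2*pi - x))"
      "(I has_real_derivative ?P x) (at x)" "(I has_real_derivative ?P (2*pi - x)) (at (2*pi - x))"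
      using \<theta> x pi4 by (auto intro!: G J I)
    have c: "((\<lambda>x. G (\<theta> + x)) has_real_derivative g (\<theta> + x)) (at x)"
      "((\<lambda>x. G (\<theta> - x)) has_real_derivative - g (\<theta> - x)) (at x)"
      "((\<lambda>x. J (2*pi - x)) has_real_derivative - (?P x * g (\<theta> - x))) (at x)"
      "((\<lambda>x. I (2*pi - x)) has_real_derivative - ?P x) (at x)"
    proof -
      have l: "((\<lambda>x. \<theta> + x) has_real_derivative 1) (at x)" "((\<lambda>x. a - x) has_real_derivative -1) (at x)" for a
        by (auto intro!: derivative_eq_intros)
      show "((\<lambda>x. G (\<theta> + x)) has_real_derivative g (\<theta> + x)) (at x)"
        using DERIV_chain2[where f = G and g = "\<lambda>x. \<theta> + x" and x = x, OF d(1) l(1)] by simp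
      show "((\<lambda>x. G (\<theta> - x)) has_real_derivative - g (\<theta> - x)) (at x)"
        using DERIV_chain2[where f = G and g = "\<lambda>x. \<theta> - x" and x = x, OF d(2) l(2)] by simp
      show "((\<lambda>x. J (2*pi - x)) has_real_derivative - (?P x * g (\<theta> - x))) (at x)"
        using DERIV_chain2[where f = J and g = "\<lambda>x. 2*pi - x" and x = x, OF d(4) l(2)] unfolding e e2 by simp
      show "((\<lambda>x. I (2*pi - x)) has_real_derivative - ?P x) (at x)"
        using DERIV_chain2[where f = I and g = "\<lambda>x. 2*pi - x" and x = x, OF d(6) l(2)] unfolding e by simp
    qed
    have "((\<lambda>x. 2 * x * A) has_real_derivative 2 * A) (at x)"
      by (auto intro!: derivative_eq_intros)
    from DERIV_diff[OF DERIV_diff[OF c(1,2)] this]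
    have G': "(?\<Gamma> has_real_derivative (g (\<theta> + x) + g (\<theta> - x) - 2 * A)) (at x)" by simp
    have "(?D has_real_derivative ?P' x * ?\<Gamma> x + (g (\<theta> + x) + g (\<theta> - x) - 2 * A) * ?P x
        - (?P x * g (\<theta> + x) - - (?P x * g (\<theta> - x))) + A * (?P x - - ?P x)) (at x)"
      by (intro DERIV_add DERIV_diff DERIV_mult DERIV_cmult Poisson_kernel_deriv r G' c d)
    moreover have "?P' x * ?\<Gamma> x + (g (\<theta> + x) + g (\<theta> - x) - 2 * A) * ?P x
        - (?P x * g (\<theta> + x) - - (?P x * g (\<theta> - x))) + A * (?P x - - ?P x) = ?P' x * ?\<Gamma> x"
      by (simp add: algebra_simps)
    moreover have "?P' x * ?\<Gamma> x \<ge> 0"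
    proof (rule mult_nonpos_nonpos[OF _ \<Gamma>[OF x]])
      have "0 \<le> (1 - r\<^sup>2) * (2 * r * sin x)"
        using r x by (intro mult_nonneg_nonneg sin_ge_zero) (auto simp: abs_square_le_1)
      then show "?P' x \<le> 0" by (intro divide_nonpos_nonneg) auto
    qed
    ultimately have "(?D has_real_derivative ?P' x * ?\<Gamma> x) (at x) \<and> ?P' x * ?\<Gamma> x \<ge> 0"
      by (simp only: conj_absorb simp_thms)
    then show "\<exists>y. (?D has_real_derivative y) (at x) \<and> y \<ge> 0" by (rule exI)
  qed
  moreover have "?P pi * ?\<Gamma> pi \<le> 0" by (intro mult_nonneg_nonpos Poisson_kernel_nonneg \<Gamma> r) auto
  moreover have "I (2*pi) - I 0 = 2 * pi"
    using integral_antiderivative[where a = "-10" and b = 20 and s = 0 and t = "2*pi", OF I] integral_Poisson_kernel[OF r] pi4 by auto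
  moreover have "integral {0..2*pi} (\<lambda>t. ?P t * g (\<theta> + t)) = J (2*pi) - J 0"
    by (rule integral_antiderivative[where a = "-10" and b = 20, OF J]) (use pi4 in auto)
  ultimately show ?thesis by (simp add: algebra_simps)
qed

text \<open>The constant \<open>10\<close> is \<open>5 * 2\<close>: the Vitali balls enlarged five
  times cover \<open>E\<close>, and the disjoint balls themselves lie in \<open>{-pi..3*pi}\<close>,
  which is two periods of \<open>g\<close>. On each ball the mass of \<open>g\<close> exceeds
  \<open>A\<close> times the length.\<close>

lemma interval_maximal_weak_type:
  fixes g :: "real \<Rightarrow> real"
  assumes g: "continuous_on UNIV g" and g0: "\<And>t. 0 \<le> g t" and per: "\<And>t. g (t + 2 * pi) = g t"
    and A: "0 < A" and E: "E \<in> sets lborel" "E \<subseteq> {0..2*pi}"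
    and avg: "\<And>\<theta>. \<theta> \<in> E \<Longrightarrow> \<exists>\<eta>. 0 < \<eta> \<and> \<eta> \<le> pi \<and> integral {\<theta> - \<eta>..\<theta> + \<eta>} g > 2 * \<eta> * A"
  shows "emeasure lborel E \<le> ennreal (10 / A * integral {0..2*pi} g)"
proof -
  have "\<forall>\<theta>\<in>E. \<exists>\<eta>. 0 < \<eta> \<and> \<eta> \<le> pi \<and> integral {\<theta> - \<eta>..\<theta> + \<eta>} g > 2 * \<eta> * A"
  proof
    fix \<theta> assume "\<theta> \<in> E"
    then show "\<exists>\<eta>. 0 < \<eta> \<and> \<eta> \<le> pi \<and> integral {\<theta> - \<eta>..\<theta> + \<eta>} g > 2 * \<eta> * A" by (rule avg)
  qed
  from bchoice[OF this] obtain \<eta>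
    where \<eta>': "\<forall>\<theta>\<in>E. 0 < \<eta> \<theta> \<and> \<eta> \<theta> \<le> pi \<and> integral {\<theta> - \<eta> \<theta>..\<theta> + \<eta> \<theta>} g > 2 * \<eta> \<theta> * A" ..
  note \<eta> = bspec[OF \<eta>']
  \<comment> \<open>Vitali's lemma requires bounded radii; here the bound is
    \<open>pi\<close>.\<close>
  obtain C where C: "countable C" "C \<subseteq> E"
     and disj: "pairwise (\<lambda>i j. disjnt (cball i (\<eta> i)) (cball j (\<eta> j))) C"
     and cover: "E \<subseteq> (\<Union>i\<in>C. cball i (5 * \<eta> i))"
  proof (rule Vitali_covering_lemma_cballs[where S = E and K = E and a = "\<lambda>x. x" and r = \<eta> and B = pi])
    show "E \<subseteq> (\<Union>i\<in>E. cball i (\<eta> i))"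
    proof
      fix x assume "x \<in> E"
      then show "x \<in> (\<Union>i\<in>E. cball i (\<eta> i))" using \<eta>[of x] by (intro UN_I[of x]) simp_all
    qed
    show "0 < \<eta> i \<and> \<eta> i \<le> pi" if "i \<in> E" for i using \<eta>[OF that] by simp
  qed
  have int: "set_integrable lborel {s..t} g" for s t
    by (rule borel_integrable_atLeastAtMost') (rule continuous_on_subset[OF g], simp)
  have nn: "(\<integral>\<^sup>+ x. indicator {s..t} x * ennreal (g x) \<partial>lborel) = ennreal (integral {s..t} g)" for s t
  proof -
    have "(\<integral>\<^sup>+ x. indicator {s..t} x * ennreal (g x) \<partial>lborel) = (\<integral>\<^sup>+ x. ennreal (indicat_real {s..t} x *\<^sub>R g x) \<partial>lborel)"
      by (intro nn_integral_cong) (auto split: split_indicator)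
    also have "\<dots> = ennreal (LBINT x:{s..t}. g x)"
      unfolding set_lebesgue_integral_def using int[of s t]
      by (intro nn_integral_eq_integral) (auto simp: set_integrable_def g0)
    finally show ?thesis using set_borel_integral_eq_integral(2)[OF int, of s t] by simp
  qed
  \<comment> \<open>\<open>C\<close> may be finite, so it is enumerated over an index set
    \<open>N\<close>, and indices outside \<open>N\<close> contribute empty sets. Finite and
    infinite families are then treated by the same series.\<close>
  define N where "N = to_nat_on C ` C"
  define c where "c = from_nat_into C"
  have c: "c n \<in> C" if "n \<in> N" for n using that C by (auto simp: N_def c_def)
  have cinj: "c m \<noteq> c n" if "m \<in> N" "n \<in> N" "m \<noteq> n" for m n using that C by (auto simp: N_def c_def)
  have cC: "(\<Union>i\<in>C. f i) = (\<Union>n. if n \<in> N then f (c n) else {})" for f :: "real \<Rightarrow> real set"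
  proof -
    have "\<exists>n\<in>N. c n = i" if "i \<in> C" for i using that C by (auto simp: N_def c_def)
    with c show ?thesis by (fastforce split: if_splits)
  qed
  let ?\<mu> = "density lborel (\<lambda>x. ennreal (g x))"
  let ?B = "\<lambda>n. if n \<in> N then cball (c n) (\<eta> (c n)) else {}"
  let ?B5 = "\<lambda>n. if n \<in> N then cball (c n) (5 * \<eta> (c n)) else {}"
  have "emeasure lborel E \<le> emeasure lborel (\<Union>n. ?B5 n)"
    using cover unfolding cC by (rule emeasure_mono) auto
  also have "\<dots> \<le> (\<Sum>n. emeasure lborel (?B5 n))"
    by (rule emeasure_subadditive_countably) auto
  also have "\<dots> \<le> (\<Sum>n. ennreal (5 / A) * emeasure ?\<mu> (?B n))"
  proof (rule suminf_le)
    fix n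
    show "emeasure lborel (?B5 n) \<le> ennreal (5 / A) * emeasure ?\<mu> (?B n)"
    proof (cases "n \<in> N")
      case True
      then have i: "c n \<in> E" using c C by auto
      have "emeasure lborel (cball (c n) (5 * \<eta> (c n))) = ennreal (10 * \<eta> (c n))"
        using \<eta>[OF i] by (simp add: cball_eq_atLeastAtMost)
      also have "\<dots> \<le> ennreal (5 / A * integral {c n - \<eta> (c n)..c n + \<eta> (c n)} g)"
        using \<eta>[OF i] A by (intro ennreal_leI) (simp add: field_simps)
      also have "\<dots> = ennreal (5 / A) * emeasure ?\<mu> (cball (c n) (\<eta> (c n)))"
        using borel_measurable_continuous_onI[OF g] nn
          ennreal_mult'[of "5 / A" "integral {c n - \<eta> (c n)..c n + \<eta> (c n)} g"] A
        by (simp only: cball_eq_atLeastAtMost) (simp add: emeasure_density mult.commute)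
      finally show ?thesis using True by simp
    qed auto
  qed auto
  also have "\<dots> = ennreal (5 / A) * (\<Sum>n. emeasure ?\<mu> (?B n))"
    by (rule ennreal_suminf_cmult)
  also have "(\<Sum>n. emeasure ?\<mu> (?B n)) = emeasure ?\<mu> (\<Union>n. ?B n)"
  proof (rule suminf_emeasure)
    show "disjoint_family ?B"
      unfolding disjoint_family_on_def
    proof (intro ballI impI)
      fix m n :: nat assume "m \<noteq> n"
      then show "?B m \<inter> ?B n = {}"
        using disj c cinj by (cases "m \<in> N"; cases "n \<in> N") (auto simp: pairwise_def disjnt_def)
    qed
  qed auto
  also have "emeasure ?\<mu> (\<Union>n. ?B n) = emeasure ?\<mu> (\<Union>i\<in>C. cball i (\<eta> i))" by (simp only: cC)
  also have "\<dots> \<le> emeasure (density lborel (\<lambda>x. ennreal (g x))) {-pi..3*pi}"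
  proof (rule emeasure_mono)
    show "(\<Union>i\<in>C. cball i (\<eta> i)) \<subseteq> {- pi..3 * pi}"
    proof safe
      fix i x assume i: "i \<in> C" and x: "x \<in> cball i (\<eta> i)"
      have "\<eta> i \<le> pi" "i \<in> {0..2*pi}" using i C E \<eta>[of i] by auto
      with x show "x \<in> {- pi..3 * pi}" by (auto simp: cball_eq_atLeastAtMost)
    qed
  qed auto
  also have "\<dots> = ennreal (integral {-pi..3*pi} g)"
    using borel_measurable_continuous_onI[OF g] nn[of "-pi" "3*pi"]
    by (subst emeasure_density) (auto simp: mult.commute)
  \<comment> \<open>Periodicity enters through the antiderivative: \<open>G (t + 2*pi) - G t\<close>
    has derivative zero, and its values at \<open>-pi\<close>, \<open>0\<close> and
    \<open>pi\<close> are compared.\<close>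
  also have "integral {-pi..3*pi} g = 2 * integral {0..2*pi} g"
  proof -
    obtain G where G: "\<And>x. x \<in> {-20<..<20} \<Longrightarrow> (G has_real_derivative g x) (at x)"
      using continuous_antiderivative_interval[OF g] by blast
    have pi4: "pi < 4" by (rule pi_less_4)
    have I: "integral {s..t} g = G t - G s" if "-20 < s" "s \<le> t" "t < 20" for s t
      by (rule integral_antiderivative[where a = "-20" and b = 20, OF G]) (use that in auto)
    have sh: "G (t + 2*pi) - G t = G (2*pi) - G 0" if "t \<in> {-4..4}" for t
    proof -
      have "\<exists>c. \<forall>x\<in>{-5..5}. G (x + 2*pi) - G x = c"
      proof (rule has_field_derivative_zero_constant)
        fix x :: real assume x: "x \<in> {-5..5}"
        have l: "((\<lambda>x. x + 2*pi) has_real_derivative 1) (at x)"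
          by (auto intro!: derivative_eq_intros)
        have "(G has_real_derivative g (x + 2*pi)) (at (x + 2*pi))"
          using x pi4 pi_gt_zero unfolding atLeastAtMost_iff
          by (intro G) (unfold greaterThanLessThan_iff, linarith)
        from DERIV_chain2[where f = G and g = "\<lambda>x. x + 2*pi" and x = x, OF this l]
        have "((\<lambda>x. G (x + 2*pi)) has_real_derivative g x) (at x)"
          by (simp add: per)
        then have "((\<lambda>x. G (x + 2*pi) - G x) has_real_derivative 0) (at x)"
          using DERIV_diff[OF _ G[of x], of "\<lambda>x. G (x + 2*pi)" "g x"] x by simp
        then show "((\<lambda>x. G (x + 2*pi) - G x) has_real_derivative 0) (at x within {-5..5})"
          by (rule has_field_derivative_at_within)
      qed auto
      then obtain c where c: "\<And>x. x \<in> {-5..5} \<Longrightarrow> G (x + 2*pi) - G x = c" by blast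
      show ?thesis using c[of t] c[of 0] that by simp
    qed
    show ?thesis
      using I[of "-pi" "3*pi"] I[of 0 "2*pi"] sh[of "-pi"] sh[of pi] pi4 pi_gt_zero
      by (simp add: less_imp_le)
  qed
  also have "ennreal (5 / A) * ennreal (2 * integral {0..2*pi} g) = ennreal (10 / A * integral {0..2*pi} g)"
    using A by (subst ennreal_mult'[symmetric]) auto
  finally show ?thesis by (simp add: mult_left_mono)
qed

section \<open>Weak type estimate for the radial maximal function\<close>

lemma emeasure_circle_measure:
  assumes [measurable]: "S \<in> sets borel"
  shows "emeasure circle_measure S = emeasure lborel ({0..<2*pi} \<inter> cis -` S) / ennreal (2*pi)"
proof -
  have "cis -` S \<in> sets borel" using measurable_sets_borel[OF measurable_cis assms] .
  then show ?thesis unfolding circle_measure_def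
    by (simp add: emeasure_distr emeasure_uniform_measure)
qed

lemma L1_norm_le_L2_norm:
  assumes "square_integrable u"
  shows "(LINT \<xi>|circle_measure. norm (u \<xi>)) \<le> L2_norm u"
proof -
  have "square_integrable (\<lambda>_. 1)" by (intro square_integrable_continuous) auto
  from L2_Cauchy_Schwarz(3)[OF assms this] show ?thesis
    by (simp add: L2_norm_def measure_circle_UNIV)
qed

lemma H2_norm2_nonneg: "F \<in> H2 \<Longrightarrow> 0 \<le> H2_norm2 F"
  by (simp add: H2_norm2_def H2_iff suminf_nonneg)

text \<open>A level set of the radial maximal function. Truncation at some \<open>\<rho> < 1\<close>
  makes the values at smaller radii Poisson averages of a function that is continuous on the circle
  of radius \<open>\<rho>\<close>; the case \<open>\<rho> = 1\<close> is reached by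
  exhaustion.\<close>

definition exceed_set :: "(complex \<Rightarrow> complex) \<Rightarrow> real \<Rightarrow> real \<Rightarrow> complex set" where
  "exceed_set F A \<rho> = {\<xi>. norm \<xi> = 1 \<and> (\<exists>s\<in>{0<..<\<rho>}. A < norm (F (complex_of_real s * \<xi>)))}"

text \<open>The strict inequality makes the condition at each single radius open, so even the
  uncountable union over all radii is open before it is intersected with the circle.\<close>

lemma exceed_set_borel:
  assumes "F \<in> analytic_disk" "\<rho> \<le> 1"
  shows "exceed_set F A \<rho> \<in> sets borel"
proof -
  let ?U = "\<lambda>s. {\<xi> \<in> ball 0 (1 / s). A < norm (F (complex_of_real s * \<xi>))}"
  have "open (?U s)" if s: "0 < s" "s < \<rho>" for s
  proof -
    have "continuous_on (ball 0 (1 / s)) (\<lambda>\<xi>. norm (F (complex_of_real s * \<xi>)))"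
      by (intro continuous_intros continuous_on_compose2[OF analytic_disk_continuous[OF assms(1)]])
         (use s in \<open>auto simp: norm_mult field_simps\<close>)
    then have "open (ball 0 (1 / s) \<inter> (\<lambda>\<xi>. norm (F (complex_of_real s * \<xi>))) -` {A<..})"
      by (rule continuous_open_preimage) auto
    also have "ball 0 (1 / s) \<inter> (\<lambda>\<xi>. norm (F (complex_of_real s * \<xi>))) -` {A<..} = ?U s" by auto
    finally show ?thesis .
  qed
  then have "open (\<Union>s\<in>{0<..<\<rho>}. ?U s)" by auto
  then have "sphere 0 1 \<inter> (\<Union>s\<in>{0<..<\<rho>}. ?U s) \<in> sets borel" by auto
  also have "sphere 0 1 \<inter> (\<Union>s\<in>{0<..<\<rho>}. ?U s) = exceed_set F A \<rho>"
    using assms(2) by (force simp: exceed_set_def field_simps)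
  finally show ?thesis .
qed

text \<open>If every centred average of \<open>|F|\<close> over the circle of radius
  \<open>\<rho>\<close> were at most \<open>A\<close>, then so would be
  \<open>|F (s * \<xi>)|\<close>, a Poisson average with parameter \<open>s / \<rho>\<close>. Each
  exceeding point thus has a bad interval, and the resulting mean of \<open>|F|\<close> is bounded
  by the quadratic mean.\<close>

lemma exceed_set_measure_le:
  assumes F: "F \<in> H2" and A: "0 < A" and \<rho>: "0 < \<rho>" "\<rho> < 1"
  shows "emeasure circle_measure (exceed_set F A \<rho>) \<le> ennreal (10 / A * sqrt (H2_norm2 F))"
proof -
  note Fa = H2_analytic[OF F]
  define g where "g = (\<lambda>t. norm (F (complex_of_real \<rho> * cis t)))"
  have g: "continuous_on UNIV g"
    unfolding g_def by (intro continuous_intros continuous_on_compose2[OF analytic_disk_continuous[OF Fa]])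
      (use \<rho> in \<open>auto simp: norm_mult\<close>)
  have E: "{0..<2*pi} \<inter> cis -` exceed_set F A \<rho> \<in> sets borel"
    using measurable_sets_borel[OF measurable_cis exceed_set_borel[OF Fa, of \<rho> A]] \<rho> by auto
  have "emeasure lborel ({0..<2*pi} \<inter> cis -` exceed_set F A \<rho>) \<le> ennreal (10 / A * integral {0..2*pi} g)"
  proof (rule interval_maximal_weak_type[OF g _ _ A])
    fix \<theta> assume \<theta>: "\<theta> \<in> {0..<2*pi} \<inter> cis -` exceed_set F A \<rho>"
    then obtain s where s: "0 < s" "s < \<rho>" "A < norm (F (complex_of_real s * cis \<theta>))"
      by (auto simp: exceed_set_def)
    show "\<exists>\<eta>. 0 < \<eta> \<and> \<eta> \<le> pi \<and> integral {\<theta> - \<eta>..\<theta> + \<eta>} g > 2 * \<eta> * A"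
    proof (rule ccontr)
      assume "\<not> ?thesis"
      then have avg: "integral {\<theta> - \<eta>..\<theta> + \<eta>} g \<le> 2 * \<eta> * A" if "0 < \<eta>" "\<eta> \<le> pi" for \<eta>
        using that by (meson not_le)
      define r where "r = s / \<rho>"
      have r: "0 \<le> r" "r < 1" and sr: "s = \<rho> * r" using s \<rho> by (auto simp: r_def)
      let ?f = "\<lambda>t. complex_of_real (Poisson_kernel r t) * F (of_real \<rho> * cis (\<theta> + t))"
      have cont: "continuous_on {0..2*pi} ?f"
        by (intro continuous_intros Poisson_kernel_continuous r continuous_on_compose2[OF analytic_disk_continuous[OF Fa]])
           (use \<rho> in \<open>auto simp: norm_mult\<close>)
      have "norm (integral {0..2*pi} ?f) \<le> integral {0..2*pi} (\<lambda>t. norm (?f t))"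
        by (intro integral_norm_bound_integral integrable_continuous_interval cont continuous_intros) auto
      also have "(\<lambda>t. norm (?f t)) = (\<lambda>t. Poisson_kernel r t * g (\<theta> + t))"
        using Poisson_kernel_nonneg[OF r] by (auto simp: norm_mult g_def)
      also have "integral {0..2*pi} \<dots> \<le> 2 * pi * A"
        by (rule Poisson_average_le[OF g _ r _ avg]) (use \<theta> in \<open>auto simp: g_def simp flip: cis_mult\<close>)
      finally have "norm (integral {0..2*pi} ?f /\<^sub>R (2*pi)) \<le> A"
        by (simp add: field_simps)
      moreover have "F (complex_of_real s * cis \<theta>) = integral {0..2*pi} ?f /\<^sub>R (2*pi)"
        unfolding sr Poisson_kernel_def by (rule Poisson_dilate[OF Fa]) (use \<rho> r in auto)
      ultimately show False using s(3) by simp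
    qed
  qed (use E in \<open>auto simp: g_def simp flip: cis_mult\<close>)
  also have "integral {0..2*pi} g = 2 * pi * (LINT \<xi>|circle_measure. norm (F (complex_of_real \<rho> * \<xi>)))"
    using analytic_disk_measurable[OF Fa] dilate_continuous[OF Fa, of "of_real \<rho>"] \<rho>
    by (subst circle_integral_continuous) (auto simp: g_def intro!: continuous_intros)
  finally have "emeasure lborel ({0..<2*pi} \<inter> cis -` exceed_set F A \<rho>) / ennreal (2*pi)
     \<le> ennreal (10 / A * (2 * pi * (LINT \<xi>|circle_measure. norm (F (complex_of_real \<rho> * \<xi>))))) / ennreal (2*pi)"
    by (rule divide_right_mono_ennreal)
  also have "\<dots> = ennreal (10 / A * (LINT \<xi>|circle_measure. norm (F (complex_of_real \<rho> * \<xi>))))"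
    using A by (subst divide_ennreal) (auto simp: mult_nonneg_nonneg)
  also have "\<dots> \<le> ennreal (10 / A * sqrt (H2_norm2 F))"
  proof (intro ennreal_leI mult_left_mono)
    have "square_integrable (\<lambda>\<xi>. F (complex_of_real \<rho> * \<xi>))"
      using analytic_disk_measurable[OF Fa] \<rho>
      by (intro square_integrable_continuous dilate_continuous Fa) auto
    then have "(LINT \<xi>|circle_measure. norm (F (complex_of_real \<rho> * \<xi>))) \<le> L2_norm (\<lambda>\<xi>. F (complex_of_real \<rho> * \<xi>))"
      by (rule L1_norm_le_L2_norm)
    also have "\<dots> \<le> sqrt (H2_norm2 F)"
      unfolding L2_norm_def by (rule real_sqrt_le_mono[OF H2_dilate_le[OF F]]) (use \<rho> in auto)
    finally show "(LINT \<xi>|circle_measure. norm (F (complex_of_real \<rho> * \<xi>))) \<le> sqrt (H2_norm2 F)" .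
  qed (use A in auto)
  finally show ?thesis
    using \<rho> by (subst emeasure_circle_measure) (auto intro!: exceed_set_borel Fa)
qed

text \<open>The bound is independent of the truncation radius and passes to the increasing union
  along \<open>1 - 1 / (n + 2)\<close>.\<close>

lemma H2_maximal_weak_type:
  assumes F: "F \<in> H2" and A: "0 < A"
  shows "emeasure circle_measure (exceed_set F A 1) \<le> ennreal (10 / A * sqrt (H2_norm2 F))"
proof -
  let ?\<rho> = "\<lambda>n. 1 - 1 / real (n + 2)"
  have lim: "?\<rho> \<longlonglongrightarrow> 1"
    using tendsto_diff[OF tendsto_const LIMSEQ_ignore_initial_segment[OF lim_inverse_n', of 2], of 1] by simp
  have "exceed_set F A 1 = (\<Union>n. exceed_set F A (?\<rho> n))"
  proof (intro equalityI subsetI)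
    fix \<xi> assume "\<xi> \<in> exceed_set F A 1"
    then obtain s where s: "norm \<xi> = 1" "0 < s" "s < 1" "A < norm (F (complex_of_real s * \<xi>))"
      by (auto simp: exceed_set_def)
    have "eventually (\<lambda>n. s < ?\<rho> n) sequentially" using order_tendstoD(1)[OF lim s(3)] .
    then obtain n where "s < ?\<rho> n" by (auto simp: eventually_sequentially)
    with s have "\<xi> \<in> exceed_set F A (?\<rho> n)" by (auto simp: exceed_set_def intro!: bexI[of _ s])
    then show "\<xi> \<in> (\<Union>n. exceed_set F A (?\<rho> n))" by (rule UN_I[OF UNIV_I])
  next
    fix \<xi> assume "\<xi> \<in> (\<Union>n. exceed_set F A (?\<rho> n))"
    then obtain n s where s: "norm \<xi> = 1" "0 < s" "s < ?\<rho> n" "A < norm (F (complex_of_real s * \<xi>))"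
      by (auto simp: exceed_set_def)
    moreover have "?\<rho> n \<le> 1" by simp
    ultimately have "s < 1" by linarith
    with s show "\<xi> \<in> exceed_set F A 1" by (auto simp: exceed_set_def intro!: bexI[of _ s])
  qed
  also have "emeasure circle_measure \<dots> = (SUP n. emeasure circle_measure (exceed_set F A (?\<rho> n)))"
  proof (rule SUP_emeasure_incseq[symmetric])
    show "range (\<lambda>n. exceed_set F A (?\<rho> n)) \<subseteq> sets circle_measure"
      using H2_analytic[OF F] by (auto intro!: exceed_set_borel)
    have "exceed_set F A (?\<rho> m) \<subseteq> exceed_set F A (?\<rho> n)" if "m \<le> n" for m n
    proof -
      have "?\<rho> m \<le> ?\<rho> n" using that by (simp add: field_simps)
      then have "{0<..<?\<rho> m} \<subseteq> {0<..<?\<rho> n}" by (intro greaterThanLessThan_subseteq_greaterThanLessThan[THEN iffD2]) auto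
      then show ?thesis unfolding exceed_set_def by blast
    qed
    then show "incseq (\<lambda>n. exceed_set F A (?\<rho> n))" unfolding incseq_def by blast
  qed
  also have "\<dots> \<le> ennreal (10 / A * sqrt (H2_norm2 F))"
    by (intro SUP_least exceed_set_measure_le F A) (auto simp: field_simps)
  finally show ?thesis .
qed

section \<open>Radial limits\<close>

lemma disk_series_H2:
  assumes "summable (\<lambda>n. (norm (c n))\<^sup>2)" shows "disk_series c \<in> H2"
  using assms Bseq_square_summable[OF assms]
  by (simp add: H2_iff disk_series_analytic taylor_disk_series)

lemma H2_summable: "F \<in> H2 \<Longrightarrow> summable (\<lambda>n. (norm (taylor F n))\<^sup>2)"
  by (simp add: H2_iff)

text \<open>Given as a series because \<open>F\<close> minus a polynomial does not in general vanish
  outside the disk and would leave \<open>H2\<close>.\<close>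

definition tail_part :: "(complex \<Rightarrow> complex) \<Rightarrow> nat \<Rightarrow> complex \<Rightarrow> complex" where
  "tail_part F N = disk_series (\<lambda>n. if n < N then 0 else taylor F n)"

lemma tail_part_summable:
  assumes "F \<in> H2" shows "summable (\<lambda>n. (norm (if n < N then 0 else taylor F n))\<^sup>2)"
  by (rule summable_comparison_test'[OF H2_summable[OF assms]]) auto

lemma tail_part_H2: "F \<in> H2 \<Longrightarrow> tail_part F N \<in> H2"
  unfolding tail_part_def by (intro disk_series_H2 tail_part_summable)

lemma tail_part_eq:
  assumes F: "F \<in> H2" and z: "norm z < 1"
  shows "tail_part F N z = F z - (\<Sum>n<N. taylor F n * z ^ n)"
proof -
  have "(\<lambda>n. (if n < N then 0 else taylor F n) * z ^ n) sums tail_part F N z"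
    unfolding tail_part_def by (intro disk_series_sums Bseq_square_summable tail_part_summable F z)
  moreover have "(\<lambda>n. (if n \<in> {..<N} then taylor F n * z ^ n else 0)) sums (\<Sum>n<N. taylor F n * z ^ n)"
    by (rule sums_If_finite_set) auto
  ultimately have "(\<lambda>n. (if n < N then 0 else taylor F n) * z ^ n + (if n \<in> {..<N} then taylor F n * z ^ n else 0))
      sums (tail_part F N z + (\<Sum>n<N. taylor F n * z ^ n))"
    by (rule sums_add)
  also have "(\<lambda>n. (if n < N then 0 else taylor F n) * z ^ n + (if n \<in> {..<N} then taylor F n * z ^ n else 0))
      = (\<lambda>n. taylor F n * z ^ n)" by auto
  finally show ?thesis
    using sums_unique2[OF analytic_disk_taylor_sums[OF H2_analytic[OF F] z]] by auto
qed

lemma tail_part_norm2_tendsto: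
  assumes F: "F \<in> H2" shows "(\<lambda>N. H2_norm2 (tail_part F N)) \<longlonglongrightarrow> 0"
proof -
  have "H2_norm2 (tail_part F N) = (\<Sum>n. (norm (taylor F (n + N)))\<^sup>2)" for N
  proof -
    have "H2_norm2 (tail_part F N) = (\<Sum>n. (norm (if n < N then 0 else taylor F n))\<^sup>2)"
      unfolding H2_norm2_def tail_part_def
      by (simp add: taylor_disk_series Bseq_square_summable[OF tail_part_summable[OF F]])
    also have "\<dots> = (\<Sum>n. (norm (if n + N < N then 0 else taylor F (n + N)))\<^sup>2)
        + (\<Sum>n<N. (norm (if n < N then 0 else taylor F n))\<^sup>2)"
      by (rule suminf_split_initial_segment[OF tail_part_summable[OF F]])
    finally show ?thesis by simp
  qed
  moreover have "(\<lambda>N. (\<Sum>n. (norm (taylor F (n + N)))\<^sup>2)) \<longlonglongrightarrow> 0"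
    using suminf_exist_split2[OF H2_summable[OF F]] by simp
  ultimately show ?thesis by simp
qed

text \<open>A Cauchy condition with a countable parameter \<open>m\<close> and a non-strict bound:
  on the circle it is a countable union of closed conditions, from which the set of convergence is
  seen to be Borel. With \<open>m + 2\<close> the radii stay positive.\<close>

definition radial_osc :: "(complex \<Rightarrow> complex) \<Rightarrow> complex \<Rightarrow> real \<Rightarrow> bool" where
  "radial_osc F \<xi> e \<longleftrightarrow> (\<exists>m. \<forall>r s. 1 - 1 / real (m + 2) < r \<and> r < 1 \<and> 1 - 1 / real (m + 2) < s \<and> s < 1
     \<longrightarrow> dist (F (complex_of_real r * \<xi>)) (F (complex_of_real s * \<xi>)) \<le> e)"

lemma radial_osc_iff_limit:
  "(\<forall>k. radial_osc F \<xi> (1 / real (Suc k))) \<longleftrightarrow> (\<exists>l. ((\<lambda>r. F (complex_of_real r * \<xi>)) \<longlongrightarrow> l) (at_left 1))"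
    (is "?L = (\<exists>l. (?f \<longlongrightarrow> l) _)")
proof
  assume L: ?L
  \<comment> \<open>\<open>n + 3\<close> and not \<open>n + 2\<close>: from index \<open>m\<close>
    on the radii must lie strictly beyond \<open>1 - 1 / (m + 2)\<close>.\<close>
  let ?\<rho> = "\<lambda>n. 1 - 1 / real (n + 3)"
  have \<rho>: "?\<rho> n > 1 - 1 / real (m + 2)" "?\<rho> n < 1" if "m \<le> n" for m n
    using that by (auto simp: field_simps)
  have "Cauchy (\<lambda>n. ?f (?\<rho> n))"
  proof (rule metric_CauchyI)
    fix e :: real assume "0 < e"
    then obtain k where k: "1 / real (Suc k) < e" using nat_approx_posE by blast
    obtain m where "\<And>r s. 1 - 1 / real (m + 2) < r \<Longrightarrow> r < 1 \<Longrightarrow> 1 - 1 / real (m + 2) < s \<Longrightarrow> s < 1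
     \<Longrightarrow> dist (?f r) (?f s) \<le> 1 / real (Suc k)" using L unfolding radial_osc_def by metis
    then show "\<exists>M. \<forall>i\<ge>M. \<forall>j\<ge>M. dist (?f (?\<rho> i)) (?f (?\<rho> j)) < e"
      using \<rho> k by (intro exI[of _ m]) (meson le_less_trans)
  qed
  then obtain l where l: "(\<lambda>n. ?f (?\<rho> n)) \<longlonglongrightarrow> l" by (auto simp: Cauchy_convergent_iff convergent_def)
  have "(?f \<longlongrightarrow> l) (at_left 1)"
  proof (rule tendstoI)
    fix e :: real assume "0 < e"
    then obtain k where k: "1 / real (Suc k) < e" using nat_approx_posE by blast
    obtain m where m: "\<And>r s. 1 - 1 / real (m + 2) < r \<Longrightarrow> r < 1 \<Longrightarrow> 1 - 1 / real (m + 2) < s \<Longrightarrow> s < 1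
     \<Longrightarrow> dist (?f r) (?f s) \<le> 1 / real (Suc k)" using L unfolding radial_osc_def by metis
    have "dist (?f r) l \<le> 1 / real (Suc k)" if r: "1 - 1 / real (m + 2) < r" "r < 1" for r
    proof (rule tendsto_upperbound)
      show "(\<lambda>n. dist (?f r) (?f (?\<rho> n))) \<longlonglongrightarrow> dist (?f r) l" by (intro tendsto_intros l)
      show "\<forall>\<^sub>F n in sequentially. dist (?f r) (?f (?\<rho> n)) \<le> 1 / real (Suc k)"
        using m[OF r \<rho>] by (auto simp: eventually_sequentially)
    qed auto
    then have *: "dist (?f r) l < e" if "r \<in> {1 - 1 / real (m + 2)<..<1}" for r
      using that k by (meson greaterThanLessThan_iff le_less_trans)
    have "eventually (\<lambda>r. r \<in> {1 - 1 / real (m + 2)<..<1}) (at_left 1)"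
      by (rule eventually_at_left_real) auto
    then show "\<forall>\<^sub>F r in at_left 1. dist (?f r) l < e"
      by (rule eventually_mono) (rule *)
  qed
  then show "\<exists>l. (?f \<longlongrightarrow> l) (at_left 1)" ..
next
  assume "\<exists>l. (?f \<longlongrightarrow> l) (at_left 1)"
  then obtain l where l: "(?f \<longlongrightarrow> l) (at_left 1)" ..
  show ?L
  proof
    fix k
    have "eventually (\<lambda>r. dist (?f r) l < 1 / real (Suc k) / 2) (at_left 1)"
      using l by (rule tendstoD) auto
    then obtain b where b: "b < 1" "\<And>r. b < r \<Longrightarrow> r < 1 \<Longrightarrow> dist (?f r) l < 1 / real (Suc k) / 2"
      unfolding eventually_at_left_field by blast
    obtain m where m: "1 / real (Suc m) < 1 - b" using nat_approx_posE[of "1 - b"] b by auto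
    have "1 / real (m + 2) \<le> 1 / real (Suc m)" by (simp add: field_simps)
    with m have "b < 1 - 1 / real (m + 2)" by linarith
    then have "dist (?f r) (?f s) \<le> 1 / real (Suc k)"
      if "1 - 1 / real (m + 2) < r" "r < 1" "1 - 1 / real (m + 2) < s" "s < 1" for r s
      using b(2)[of r] b(2)[of s] that dist_triangle2[of "?f r" "?f s" l] by linarith
    then show "radial_osc F \<xi> (1 / real (Suc k))" unfolding radial_osc_def by blast
  qed
qed

definition radial_limit_exists :: "(complex \<Rightarrow> complex) \<Rightarrow> complex \<Rightarrow> bool" where
  "radial_limit_exists F \<xi> \<longleftrightarrow> (\<exists>l. ((\<lambda>r. F (complex_of_real r * \<xi>)) \<longlongrightarrow> l) (at_left 1))"

lemma radial_limit_bdry: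
  "radial_limit_exists F \<xi> \<Longrightarrow> ((\<lambda>r. F (complex_of_real r * \<xi>)) \<longlongrightarrow> bdry F \<xi>) (at_left 1)"
  unfolding radial_limit_exists_def bdry_def using tendsto_Lim[OF trivial_limit_at_left_real] by auto

lemma bdry_eqI:
  "((\<lambda>r. F (complex_of_real r * \<xi>)) \<longlongrightarrow> l) (at_left 1) \<Longrightarrow> bdry F \<xi> = l"
  unfolding bdry_def by (rule tendsto_Lim) auto

text \<open>\<open>F\<close> is split into a Taylor polynomial and a tail. Off the exceed set of the
  tail, each of the two tail values costs \<open>e\<close>; near radius \<open>1\<close> each of the
  two polynomial values is within \<open>e\<close> of its limit. The exceptional points lie in all
  the exceed sets, whose measures tend to zero with the norm of the tail.\<close>

lemma radial_osc_AE:
  assumes F: "F \<in> H2" and e: "0 < e"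
  shows "AE \<xi> in circle_measure. radial_osc F \<xi> (4 * e)"
proof -
  let ?E = "\<lambda>N. exceed_set (tail_part F N) e 1"
  have osc: "radial_osc F \<xi> (4 * e)" if \<xi>: "norm \<xi> = 1" and nE: "\<xi> \<notin> ?E N" for \<xi> N
  proof -
    let ?p = "\<lambda>r. \<Sum>n<N. taylor F n * (complex_of_real r * \<xi>) ^ n"
    have p: "(?p \<longlongrightarrow> ?p 1) (at_left 1)" by (intro tendsto_intros)
    have "eventually (\<lambda>r. dist (?p r) (?p 1) < e) (at_left 1)" using p e by (rule tendstoD)
    then obtain b where b: "b < 1" "\<And>r. b < r \<Longrightarrow> r < 1 \<Longrightarrow> dist (?p r) (?p 1) < e"
      unfolding eventually_at_left_field by blast
    obtain m where m: "1 / real (Suc m) < 1 - b" using nat_approx_posE[of "1 - b"] b by auto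
    have "1 / real (m + 2) \<le> 1 / real (Suc m)" by (simp add: field_simps)
    with m have mb: "b < 1 - 1 / real (m + 2)" by linarith
    have tail: "norm (F (complex_of_real r * \<xi>) - ?p r) \<le> e" if "1 - 1 / real (m + 2) < r" "r < 1" for r
    proof -
      have "0 \<le> 1 - 1 / real (m + 2)" by (simp add: field_simps)
      then have r: "0 < r" "r < 1" using that by linarith+
      then have "norm (tail_part F N (complex_of_real r * \<xi>)) \<le> e"
        using nE \<xi> by (force simp: exceed_set_def)
      then show ?thesis using r \<xi> by (simp add: tail_part_eq[OF F] norm_mult)
    qed
    have "dist (F (complex_of_real r * \<xi>)) (F (complex_of_real s * \<xi>)) \<le> 4 * e"
      if rs: "1 - 1 / real (m + 2) < r" "r < 1" "1 - 1 / real (m + 2) < s" "s < 1" for r s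
    proof -
      have "dist (F (complex_of_real r * \<xi>)) (?p r) \<le> e" "dist (F (complex_of_real s * \<xi>)) (?p s) \<le> e"
        "dist (?p r) (?p 1) < e" "dist (?p s) (?p 1) < e"
        using tail rs b(2) mb by (auto simp: dist_norm)
      then show ?thesis
        using dist_triangle[of "F (complex_of_real r * \<xi>)" "?p 1" "?p r"] dist_triangle[of "F (complex_of_real s * \<xi>)" "?p 1" "?p s"]
          dist_triangle2[of "F (complex_of_real r * \<xi>)" "F (complex_of_real s * \<xi>)" "?p 1"] by linarith
    qed
    then show ?thesis unfolding radial_osc_def by blast
  qed
  have meas: "?E N \<in> sets borel" for N
    by (intro exceed_set_borel H2_analytic tail_part_H2 F) auto
  have "(\<Inter>N. ?E N) \<in> null_sets circle_measure"
  proof (rule null_setsI)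
    have "(\<lambda>N. ennreal (10 / e * sqrt (H2_norm2 (tail_part F N)))) \<longlonglongrightarrow> ennreal (10 / e * sqrt 0)"
      by (intro tendsto_intros tail_part_norm2_tendsto F)
    then have lim: "(\<lambda>N. ennreal (10 / e * sqrt (H2_norm2 (tail_part F N)))) \<longlonglongrightarrow> 0" by simp
    have "emeasure circle_measure (\<Inter>N. ?E N) \<le> ennreal (10 / e * sqrt (H2_norm2 (tail_part F N)))" for N
      using emeasure_mono[of "\<Inter>N. ?E N" "?E N" circle_measure] meas
        H2_maximal_weak_type[OF tail_part_H2[OF F, of N] e] by (auto intro: order_trans)
    then have "emeasure circle_measure (\<Inter>N. ?E N) \<le> 0"
      by (intro tendsto_lowerbound[OF lim]) auto
    then show "emeasure circle_measure (\<Inter>N. ?E N) = 0" by simp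
  qed (use meas in auto)
  then have "AE \<xi> in circle_measure. \<xi> \<notin> (\<Inter>N. ?E N)" by (rule AE_not_in)
  with AE_circle_norm show ?thesis by eventually_elim (use osc in blast)
qed

theorem Fatou_radial_limits:
  assumes "F \<in> H2"
  shows "AE \<xi> in circle_measure. radial_limit_exists F \<xi>"
proof -
  have "AE \<xi> in circle_measure. \<forall>k. radial_osc F \<xi> (1 / real (Suc k))"
    unfolding AE_all_countable
  proof
    fix k
    show "AE \<xi> in circle_measure. radial_osc F \<xi> (1 / real (Suc k))"
    proof -
      have "4 * (1 / real (Suc k) / 4) = 1 / real (Suc k)" by (simp del: of_nat_Suc)
      with radial_osc_AE[OF assms, of "1 / real (Suc k) / 4"] show ?thesis by (simp del: of_nat_Suc)
    qed
  qed
  then show ?thesis unfolding radial_osc_iff_limit radial_limit_exists_def .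
qed

section \<open>Boundary functions as Borel functions on the plane\<close>

lemma radial_limit_interior_exterior:
  assumes "F \<in> analytic_disk" "norm \<xi> \<noteq> 1"
  shows "((\<lambda>r. F (complex_of_real r * \<xi>)) \<longlongrightarrow> F \<xi>) (at_left 1)"
proof (cases "norm \<xi> < 1")
  case True
  then have "isCont F \<xi>"
    using analytic_disk_continuous[OF assms(1)] by (auto simp: continuous_on_eq_continuous_at)
  moreover have "((\<lambda>r. complex_of_real r * \<xi>) \<longlongrightarrow> of_real 1 * \<xi>) (at_left 1)" by (intro tendsto_intros)
  ultimately show ?thesis using isCont_tendsto_compose by fastforce
next
  case False
  with assms(2) have \<xi>: "1 < norm \<xi>" by simp
  have "eventually (\<lambda>r. r \<in> {1 / norm \<xi><..<1}) (at_left 1)"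
    by (rule eventually_at_left_real, subst divide_less_eq_1_pos) (use \<xi> in linarith)+
  then have "eventually (\<lambda>r. F (complex_of_real r * \<xi>) = F \<xi>) (at_left 1)"
  proof eventually_elim
    case (elim r)
    then have r: "1 / norm \<xi> < r" by simp
    then have "1 < r * norm \<xi>" using \<xi> by (subst (asm) pos_divide_less_eq) auto
    moreover have "0 < r" by (rule less_trans[OF _ r]) (use \<xi> in auto)
    ultimately have "1 \<le> norm (complex_of_real r * \<xi>)" by (simp add: norm_mult)
    then show ?case using analytic_disk_outside[OF assms(1)] \<xi> by simp
  qed
  then show ?thesis by (rule tendsto_eventually)
qed

lemma radial_limit_exists_borel:
  assumes F: "F \<in> analytic_disk"
  shows "{\<xi>. norm \<xi> = 1 \<and> radial_limit_exists F \<xi>} \<in> sets borel"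
proof -
  let ?D = "\<lambda>k m. {\<xi> \<in> sphere 0 1. \<forall>r s. 1 - 1 / real (m + 2) < r \<and> r < 1 \<and> 1 - 1 / real (m + 2) < s \<and> s < 1
     \<longrightarrow> dist (F (complex_of_real r * \<xi>)) (F (complex_of_real s * \<xi>)) \<le> 1 / real (Suc k)}"
  have c: "closed (?D k m)" for k m
  proof -
    have "closed {\<xi> \<in> sphere 0 1. dist (F (complex_of_real r * \<xi>)) (F (complex_of_real s * \<xi>)) \<le> 1 / real (Suc k)}"
      if rs: "1 - 1 / real (m + 2) < r" "r < 1" "1 - 1 / real (m + 2) < s" "s < 1" for r s
    proof -
      have "0 \<le> 1 - 1 / real (m + 2)" by (simp add: field_simps)
      then have "0 \<le> r" "0 \<le> s" using rs by linarith+
      then have "norm (complex_of_real r) < 1" "norm (complex_of_real s) < 1" using rs by auto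
      then show ?thesis
        by (intro continuous_on_closed_Collect_le) (auto intro!: continuous_intros dilate_continuous F continuous_on_dist)
    qed
    then have "closed (sphere 0 1 \<inter> (\<Inter>(r, s)\<in>{(r, s). 1 - 1 / real (m + 2) < r \<and> r < 1 \<and> 1 - 1 / real (m + 2) < s \<and> s < 1}.
       {\<xi> \<in> sphere 0 1. dist (F (complex_of_real r * \<xi>)) (F (complex_of_real s * \<xi>)) \<le> 1 / real (Suc k)}))"
      by (intro closed_Int closed_INT) auto
    also have "\<dots> = ?D k m" by auto
    finally show ?thesis .
  qed
  have "{\<xi>. norm \<xi> = 1 \<and> radial_limit_exists F \<xi>} = (\<Inter>k. \<Union>m. ?D k m)"
    unfolding radial_limit_exists_def radial_osc_iff_limit[symmetric] radial_osc_def by auto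
  also have "\<dots> \<in> sets borel"
    by (intro sets.countable_INT' sets.countable_UN' image_subsetI borel_closed c) auto
  finally show ?thesis .
qed

text \<open>\<open>bdry F\<close> is a function on the whole plane: off the circle it is
  \<open>F\<close> itself, and on the circle it is a radial limit or the value that
  \<open>Lim\<close> takes when there is no limit. One sequence of Borel functions converges to it
  at every point.\<close>

lemma bdry_measurable:
  assumes F: "F \<in> analytic_disk"
  shows "bdry F \<in> borel_measurable borel"
proof -
  let ?\<rho> = "\<lambda>n. 1 - 1 / real (n + 2)"
  define L where "L = {\<xi>. norm \<xi> = 1 \<and> radial_limit_exists F \<xi>}"
  \<comment> \<open>Where no limit exists, the predicate described in \<open>Lim\<close> is
    constantly false, so the value is the same at all such points.\<close>
  define c :: complex where "c = (THE l. False)"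
  let ?f = "\<lambda>n \<xi>. if \<xi> \<in> L then F (complex_of_real (?\<rho> n) * \<xi>) else if \<xi> \<in> sphere 0 1 then c else F \<xi>"
  have Fm: "F \<in> borel_measurable borel" by (rule analytic_disk_measurable[OF F])
  have Lm: "L \<inter> space borel \<in> sets borel"
    unfolding L_def using radial_limit_exists_borel[OF F] by (simp only: space_borel Int_UNIV_right)
  have Sm: "sphere (0::complex) 1 \<inter> space borel \<in> sets borel" by simp
  have fm: "?f n \<in> borel_measurable borel" for n
    by (rule measurable_If_set[OF dilate_measurable[OF Fm] measurable_If_set[OF measurable_const Fm Sm] Lm]) simp
  have "?\<rho> \<longlonglongrightarrow> 1"
    using tendsto_diff[OF tendsto_const LIMSEQ_ignore_initial_segment[OF lim_inverse_n', of 2], of 1] by simp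
  then have lim: "filterlim ?\<rho> (at_left 1) sequentially"
    unfolding filterlim_at by (auto intro!: always_eventually)
  have "(\<lambda>n. ?f n \<xi>) \<longlonglongrightarrow> bdry F \<xi>" for \<xi>
  proof -
    consider "\<xi> \<in> L" | "\<xi> \<notin> L" "norm \<xi> = 1" | "\<xi> \<notin> L" "norm \<xi> \<noteq> 1" by (auto simp: L_def)
    then show "(\<lambda>n. ?f n \<xi>) \<longlonglongrightarrow> bdry F \<xi>"
    proof cases
      case 1
      then have "radial_limit_exists F \<xi>" by (simp add: L_def)
      from filterlim_compose[OF radial_limit_bdry[OF this] lim] 1 show ?thesis by simp
    next
      case 2
      then have "\<not> ((\<lambda>r. F (complex_of_real r * \<xi>)) \<longlongrightarrow> l) (at_left 1)" for l
        by (auto simp: L_def radial_limit_exists_def)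
      then have "bdry F \<xi> = c" by (simp add: bdry_def Topological_Spaces.Lim_def c_def)
      then show ?thesis using 2 by simp
    next
      case 3
      then show ?thesis using bdry_eqI[OF radial_limit_interior_exterior[OF F]] by simp
    qed
  qed
  then show ?thesis by (rule borel_measurable_LIMSEQ_metric[where f = ?f, OF fm])
qed

section \<open>Inner products and coanalytic Toeplitz operators\<close>

lemma AE_radial_limit:
  assumes "F \<in> H2"
  shows "AE \<xi> in circle_measure. norm \<xi> = 1 \<and> ((\<lambda>r. F (complex_of_real r * \<xi>)) \<longlongrightarrow> bdry F \<xi>) (at_left 1)"
  using Fatou_radial_limits[OF assms] AE_circle_norm
proof eventually_elim
  case (elim \<xi>)
  then show ?case using radial_limit_bdry by simp
qed

lemma bdry_H2_measurable [measurable_dest]: "F \<in> H2 \<Longrightarrow> bdry F \<in> borel_measurable borel"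
  by (intro bdry_measurable H2_analytic)

lemma radii_at_left: "filterlim (\<lambda>n. 1 - 1 / real (n + 2)) (at_left 1) sequentially"
proof -
  have "(\<lambda>n. 1 - 1 / real (n + 2)) \<longlonglongrightarrow> 1"
    using tendsto_diff[OF tendsto_const LIMSEQ_ignore_initial_segment[OF lim_inverse_n', of 2], of 1] by simp
  then show ?thesis unfolding filterlim_at by (auto intro!: always_eventually)
qed

text \<open>Fatou's lemma along radii tending to \<open>1\<close>; the means at those radii are at
  most \<open>H2_norm2 F\<close>.\<close>

lemma bdry_nn_integral_le:
  assumes F: "F \<in> H2"
  shows "(\<integral>\<^sup>+ \<xi>. ennreal ((norm (bdry F \<xi>))\<^sup>2) \<partial>circle_measure) \<le> ennreal (H2_norm2 F)"
proof -
  let ?\<rho> = "\<lambda>n. 1 - 1 / real (n + 2)"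
  let ?u = "\<lambda>n \<xi>. ennreal ((norm (F (complex_of_real (?\<rho> n) * \<xi>)))\<^sup>2)"
  have Fm: "F \<in> borel_measurable borel" by (rule analytic_disk_measurable[OF H2_analytic[OF F]])
  have um: "?u n \<in> borel_measurable circle_measure" for n
    using dilate_measurable[OF Fm, of "of_real (?\<rho> n)"] by simp
  have \<rho>: "0 \<le> ?\<rho> n" "?\<rho> n < 1" for n by (auto simp: field_simps)
  have "(\<integral>\<^sup>+ \<xi>. ennreal ((norm (bdry F \<xi>))\<^sup>2) \<partial>circle_measure) = (\<integral>\<^sup>+ \<xi>. liminf (\<lambda>n. ?u n \<xi>) \<partial>circle_measure)"
  proof (rule nn_integral_cong_AE)
    show "AE \<xi> in circle_measure. ennreal ((norm (bdry F \<xi>))\<^sup>2) = liminf (\<lambda>n. ?u n \<xi>)"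
      using AE_radial_limit[OF F]
    proof eventually_elim
      case (elim \<xi>)
      then have "(\<lambda>n. F (complex_of_real (?\<rho> n) * \<xi>)) \<longlonglongrightarrow> bdry F \<xi>"
        using filterlim_compose[OF _ radii_at_left] by blast
      then have "(\<lambda>n. ?u n \<xi>) \<longlonglongrightarrow> ennreal ((norm (bdry F \<xi>))\<^sup>2)"
        by (intro tendsto_ennrealI tendsto_intros)
      then show ?case by (rule lim_imp_Liminf[OF trivial_limit_sequentially, symmetric])
    qed
  qed
  also have "\<dots> \<le> liminf (\<lambda>n. \<integral>\<^sup>+ \<xi>. ?u n \<xi> \<partial>circle_measure)"
    by (rule nn_integral_liminf[OF um])
  also have "\<dots> \<le> ennreal (H2_norm2 F)"
  proof -
    have "(\<integral>\<^sup>+ \<xi>. ?u n \<xi> \<partial>circle_measure) \<le> ennreal (H2_norm2 F)" for n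
    proof -
      have "square_integrable (\<lambda>\<xi>. F (complex_of_real (?\<rho> n) * \<xi>))"
      proof (intro square_integrable_continuous dilate_measurable Fm dilate_continuous H2_analytic F)
        show "norm (complex_of_real (?\<rho> n)) < 1"
          unfolding norm_of_real using \<rho>[of n] by (simp only: abs_of_nonneg)
      qed
      then have "(\<integral>\<^sup>+ \<xi>. ?u n \<xi> \<partial>circle_measure) = ennreal (LINT \<xi>|circle_measure. (norm (F (complex_of_real (?\<rho> n) * \<xi>)))\<^sup>2)"
        by (intro nn_integral_eq_integral) (auto simp: square_integrable_def)
      also have "\<dots> \<le> ennreal (H2_norm2 F)"
        by (intro ennreal_leI H2_dilate_le F \<rho>)
      finally show ?thesis .
    qed
    then have "eventually (\<lambda>n. (\<integral>\<^sup>+ \<xi>. ?u n \<xi> \<partial>circle_measure) \<le> ennreal (H2_norm2 F)) sequentially"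
      by (rule always_eventually[OF allI])
    then show ?thesis by (rule Liminf_le[OF trivial_limit_sequentially])
  qed
  finally show ?thesis .
qed

lemma bdry_square_integrable: assumes "F \<in> H2" shows "square_integrable (bdry F)"
proof -
  have m: "bdry F \<in> borel_measurable borel" by (rule bdry_H2_measurable[OF assms])
  have "integrable circle_measure (\<lambda>\<xi>. (norm (bdry F \<xi>))\<^sup>2)"
  proof (rule integrableI_bounded)
    show "(\<lambda>\<xi>. (norm (bdry F \<xi>))\<^sup>2) \<in> borel_measurable circle_measure" using m by simp
    show "(\<integral>\<^sup>+ \<xi>. ennreal (norm ((norm (bdry F \<xi>))\<^sup>2)) \<partial>circle_measure) < \<infinity>"
      using le_less_trans[OF bdry_nn_integral_le[OF assms] ennreal_less_top] by simp
  qed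
  with m show ?thesis by (simp add: square_integrable_def)
qed

lemma L2_norm_bdry_le: assumes F: "F \<in> H2" shows "L2_norm (bdry F) \<le> sqrt (H2_norm2 F)"
proof -
  have "ennreal (LINT \<xi>|circle_measure. (norm (bdry F \<xi>))\<^sup>2) = (\<integral>\<^sup>+ \<xi>. ennreal ((norm (bdry F \<xi>))\<^sup>2) \<partial>circle_measure)"
    using bdry_square_integrable[OF F] by (intro nn_integral_eq_integral[symmetric]) (auto simp: square_integrable_def)
  also note bdry_nn_integral_le[OF F]
  finally show ?thesis
    unfolding L2_norm_def using H2_norm2_nonneg[OF F] by (simp add: ennreal_le_iff)
qed

lemma bdry_tail_part:
  assumes F: "F \<in> H2"
  shows "AE \<xi> in circle_measure. bdry F \<xi> - (\<Sum>n<N. taylor F n * \<xi> ^ n) = bdry (tail_part F N) \<xi>"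
  using AE_radial_limit[OF F]
proof eventually_elim
  case (elim \<xi>)
  have "((\<lambda>r. \<Sum>n<N. taylor F n * (complex_of_real r * \<xi>) ^ n) \<longlongrightarrow> (\<Sum>n<N. taylor F n * (complex_of_real 1 * \<xi>) ^ n)) (at_left 1)"
    by (intro tendsto_intros)
  with elim have "((\<lambda>r. F (complex_of_real r * \<xi>) - (\<Sum>n<N. taylor F n * (complex_of_real r * \<xi>) ^ n))
     \<longlongrightarrow> bdry F \<xi> - (\<Sum>n<N. taylor F n * \<xi> ^ n)) (at_left 1)"
    by (intro tendsto_diff) auto
  moreover have "eventually (\<lambda>r. F (complex_of_real r * \<xi>) - (\<Sum>n<N. taylor F n * (complex_of_real r * \<xi>) ^ n)
     = tail_part F N (complex_of_real r * \<xi>)) (at_left 1)"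
    using eventually_at_left_real[of 0 "1::real", OF zero_less_one]
    by eventually_elim (use elim in \<open>auto simp: tail_part_eq[OF F] norm_mult\<close>)
  ultimately have "((\<lambda>r. tail_part F N (complex_of_real r * \<xi>)) \<longlongrightarrow> bdry F \<xi> - (\<Sum>n<N. taylor F n * \<xi> ^ n)) (at_left 1)"
    by (rule Lim_transform_eventually)
  then show ?case by (rule bdry_eqI[symmetric])
qed

section \<open>Fourier coefficients and the orthogonal projection\<close>

lemma square_integrable_poly: "square_integrable (\<lambda>\<xi>. \<Sum>n<N. c n * \<xi> ^ n)"
  by (intro square_integrable_continuous borel_measurable_continuous_onI continuous_intros)

lemma square_integrable_monom: "square_integrable (\<lambda>\<xi>. \<xi> ^ n)"
  by (intro square_integrable_continuous borel_measurable_continuous_onI continuous_intros)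

text \<open>The bridge from radial limits to the Hilbert space: the error is the boundary function
  of \<open>tail_part F N\<close>, whose norm is controlled by the tail of the coefficient
  sum.\<close>

lemma bdry_L2_partial_sums:
  assumes F: "F \<in> H2"
  shows "(\<lambda>N. L2_norm (\<lambda>\<xi>. bdry F \<xi> - (\<Sum>n<N. taylor F n * \<xi> ^ n))) \<longlonglongrightarrow> 0"
proof (rule tendsto_sandwich[of "\<lambda>_. 0"])
  have "L2_norm (\<lambda>\<xi>. bdry F \<xi> - (\<Sum>n<N. taylor F n * \<xi> ^ n)) \<le> sqrt (H2_norm2 (tail_part F N))" for N
  proof -
    have "L2_norm (\<lambda>\<xi>. bdry F \<xi> - (\<Sum>n<N. taylor F n * \<xi> ^ n)) = L2_norm (bdry (tail_part F N))"
      using square_integrable_poly[THEN square_integrable_measurable] bdry_H2_measurable[OF F] bdry_H2_measurable[OF tail_part_H2[OF F]]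
      by (intro L2_norm_cong_AE bdry_tail_part F) auto
    with L2_norm_bdry_le[OF tail_part_H2[OF F]] show ?thesis by simp
  qed
  then show "\<forall>\<^sub>F N in sequentially. L2_norm (\<lambda>\<xi>. bdry F \<xi> - (\<Sum>n<N. taylor F n * \<xi> ^ n)) \<le> sqrt (H2_norm2 (tail_part F N))"
    by simp
  show "(\<lambda>N. sqrt (H2_norm2 (tail_part F N))) \<longlonglongrightarrow> 0"
    using tendsto_real_sqrt[OF tail_part_norm2_tendsto[OF F]] by simp
qed (auto simp: L2_norm_def)

text \<open>Only the indices \<open>n >= 0\<close> occur, because a projection onto
  \<open>H2\<close> sees no others.\<close>

definition fourier :: "(complex \<Rightarrow> complex) \<Rightarrow> nat \<Rightarrow> complex" where
  "fourier u n = L2_inner u (\<lambda>\<xi>. \<xi> ^ n)"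

lemma L2_inner_poly_right:
  assumes u: "square_integrable u"
  shows "L2_inner u (\<lambda>\<xi>. \<Sum>n<N. d n * \<xi> ^ n) = (\<Sum>n<N. fourier u n * cnj (d n))"
proof -
  have i: "integrable circle_measure (\<lambda>\<xi>. u \<xi> * cnj (\<xi> ^ n))" for n
    by (rule L2_Cauchy_Schwarz(1)[OF u square_integrable_monom])
  have "L2_inner u (\<lambda>\<xi>. \<Sum>n<N. d n * \<xi> ^ n) = (LINT \<xi>|circle_measure. (\<Sum>n<N. cnj (d n) * (u \<xi> * cnj (\<xi> ^ n))))"
    unfolding L2_inner_def by (intro Bochner_Integration.integral_cong) (simp_all add: sum_distrib_left algebra_simps)
  also have "\<dots> = (\<Sum>n<N. cnj (d n) * (LINT \<xi>|circle_measure. u \<xi> * cnj (\<xi> ^ n)))"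
    using i by (subst Bochner_Integration.integral_sum) auto
  finally show ?thesis by (simp add: fourier_def L2_inner_def mult.commute)
qed

lemma fourier_poly: "fourier (\<lambda>\<xi>. \<Sum>n<N. d n * \<xi> ^ n) m = (if m < N then d m else 0)"
proof -
  have "fourier (\<lambda>\<xi>. \<xi> ^ m) n = (if m = n then 1 else 0)" for m n
    by (simp add: fourier_def L2_inner_def circle_orthonormal del: complex_cnj_power)
  then have "L2_inner (\<lambda>\<xi>. \<xi> ^ m) (\<lambda>\<xi>. \<Sum>n<N. d n * \<xi> ^ n) = (if m < N then cnj (d m) else 0)"
    unfolding L2_inner_poly_right[OF square_integrable_monom] by (simp add: if_distrib[where f = "\<lambda>x. x * _"] cong: if_cong)
  then show ?thesis unfolding fourier_def by (subst L2_inner_cnj_commute) auto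
qed

lemma fourier_bdry:
  assumes F: "F \<in> H2" shows "fourier (bdry F) m = taylor F m"
proof -
  have "(\<lambda>N. fourier (\<lambda>\<xi>. \<Sum>n<N. taylor F n * \<xi> ^ n) m) \<longlonglongrightarrow> fourier (bdry F) m"
    unfolding fourier_def
    by (intro L2_inner_tendsto_left square_integrable_poly bdry_square_integrable square_integrable_monom bdry_L2_partial_sums F)
  moreover have "(\<lambda>N. fourier (\<lambda>\<xi>. \<Sum>n<N. taylor F n * \<xi> ^ n) m) \<longlonglongrightarrow> taylor F m"
    unfolding fourier_poly
    by (rule tendsto_eventually) (auto simp: eventually_sequentially intro!: exI[of _ "Suc m"])
  ultimately show ?thesis by (rule LIMSEQ_unique)
qed

lemma L2_inner_bdry_right_sums:
  assumes u: "square_integrable u" and K: "K \<in> H2"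
  shows "(\<lambda>n. fourier u n * cnj (taylor K n)) sums L2_inner u (bdry K)"
  unfolding sums_def L2_inner_poly_right[OF u, symmetric]
  by (intro L2_inner_tendsto_right square_integrable_poly bdry_square_integrable u bdry_L2_partial_sums K)

lemma H2_inner_sums:
  assumes "F \<in> H2" "G \<in> H2"
  shows "(\<lambda>n. taylor F n * cnj (taylor G n)) sums L2_inner (bdry F) (bdry G)"
  using L2_inner_bdry_right_sums[OF bdry_square_integrable[OF assms(1)] assms(2)]
  by (simp add: fourier_bdry assms)

lemma L2_norm_nonneg: "0 \<le> L2_norm u"
  by (simp add: L2_norm_def)

lemma sums_cnj_delta: "(\<lambda>m. c m * cnj (if m = n then 1 else 0)) sums (c n :: complex)"
proof -
  have "(\<lambda>m. c m * cnj (if m = n then 1 else 0)) = (\<lambda>m. if m = n then c m else 0)" by auto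
  then show ?thesis using sums_single[of n c] by simp
qed

text \<open>A partial sum \<open>S\<close> satisfies \<open><u, S> = |S|^2\<close>, so
  Cauchy-Schwarz gives \<open>|S| <= |u|\<close> after division by \<open>|S|\<close>; the case
  \<open>|S| = 0\<close> is separate.\<close>

lemma Bessel_fourier:
  assumes u: "square_integrable u"
  shows "summable (\<lambda>n. (norm (fourier u n))\<^sup>2)"
proof (rule summableI_nonneg_bounded)
  fix N
  let ?S = "\<lambda>\<xi>. \<Sum>n<N. fourier u n * \<xi> ^ n"
  let ?t = "\<Sum>n<N. (norm (fourier u n))\<^sup>2"
  have t0: "0 \<le> ?t" by (intro sum_nonneg) auto
  have c: "complex_of_real ?t = (\<Sum>n<N. fourier u n * cnj (fourier u n))"
    unfolding of_real_sum complex_norm_square ..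
  have 1: "L2_inner u ?S = complex_of_real ?t" by (simp only: L2_inner_poly_right[OF u] c)
  have "L2_inner ?S ?S = complex_of_real ?t"
    unfolding L2_inner_poly_right[OF square_integrable_poly] fourier_poly c by simp
  moreover have "L2_inner ?S ?S = complex_of_real ((L2_norm ?S)\<^sup>2)"
  proof -
    have "0 \<le> (LINT \<xi>|circle_measure. (norm (?S \<xi>))\<^sup>2)" by simp
    then show ?thesis
      unfolding L2_inner_def L2_norm_def complex_norm_square[symmetric]
      by (subst real_sqrt_pow2) (assumption, rule integral_complex_of_real)
  qed
  ultimately have 2: "(L2_norm ?S)\<^sup>2 = ?t" by (simp only: of_real_eq_iff)
  have "norm (complex_of_real ?t) = ?t" using t0 by (simp only: norm_of_real abs_of_nonneg)
  then have "?t \<le> L2_norm u * L2_norm ?S"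
    using L2_Cauchy_Schwarz(2)[OF u square_integrable_poly, of "fourier u" N] unfolding 1 by (simp only:)
  then have "L2_norm ?S * L2_norm ?S \<le> L2_norm u * L2_norm ?S" using 2 by (simp add: power2_eq_square)
  then have "L2_norm ?S \<le> L2_norm u"
  proof (cases "L2_norm ?S = 0")
    case True
    then show ?thesis by (simp add: L2_norm_nonneg)
  next
    case False
    then have "0 < L2_norm ?S" using L2_norm_nonneg[of ?S] by linarith
    with \<open>L2_norm ?S * L2_norm ?S \<le> _\<close> show ?thesis by (rule mult_right_le_imp_le)
  qed
  then show "?t \<le> (L2_norm u)\<^sup>2"
    unfolding 2[symmetric] by (intro power_mono L2_norm_nonneg)
qed auto

text \<open>Powers of \<open>z\<close> in the form required by \<open>H2\<close>; pairing with them
  reads off single coefficients.\<close>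

lemma H2_monom: "disk_series (\<lambda>m. if m = n then 1 else 0) \<in> H2" (is "disk_series ?c \<in> H2")
  and taylor_monom: "taylor (disk_series (\<lambda>m. if m = n then 1 else 0)) m = (if m = n then 1 else 0)"
proof -
  have s: "summable (\<lambda>m. (norm (?c m))\<^sup>2)"
    by (rule summable_finite[of "{n}"]) auto
  then show "disk_series ?c \<in> H2" by (rule disk_series_H2)
  show "taylor (disk_series ?c) m = ?c m" by (rule taylor_disk_series[OF Bseq_square_summable[OF s]])
qed

text \<open>Makes the description in \<open>P_plus\<close> usable. Existence: the power series of
  the Fourier coefficients is a candidate by Bessel and Parseval. Uniqueness: pairing with powers of
  \<open>z\<close> determines every Taylor coefficient of a candidate.\<close>

lemma P_plus_iff:
  assumes u: "square_integrable u"
  shows "F = P_plus u \<longleftrightarrow> F \<in> H2 \<and> (\<forall>k\<in>H2. L2_inner u (bdry k) = L2_inner (bdry F) (bdry k))"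
proof -
  have D: "L2_inner (\<lambda>\<xi>. u \<xi> - bdry F \<xi>) (bdry k) = 0 \<longleftrightarrow> L2_inner u (bdry k) = L2_inner (bdry F) (bdry k)"
    if "F \<in> H2" "k \<in> H2" for F k
    using L2_inner_diff_left[OF u bdry_square_integrable[OF that(1)] bdry_square_integrable[OF that(2)]] by simp
  define Q where "Q F \<longleftrightarrow> F \<in> H2 \<and> (\<forall>k\<in>H2. L2_inner u (bdry k) = L2_inner (bdry F) (bdry k))" for F
  have P: "P_plus u = (THE F. Q F)"
    unfolding P_plus_def Q_def by (intro arg_cong[where f = The] ext) (auto simp: D)
  have coef: "taylor F n = fourier u n" if "Q F" for F n
  proof -
    let ?e = "disk_series (\<lambda>m. if m = n then 1 else 0)"
    have F: "F \<in> H2" and eq: "L2_inner u (bdry ?e) = L2_inner (bdry F) (bdry ?e)"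
      using that H2_monom[of n] unfolding Q_def by blast+
    have "fourier u n = L2_inner u (bdry ?e)"
      using L2_inner_bdry_right_sums[OF u H2_monom[of n]] unfolding taylor_monom
      by (rule sums_unique2[OF sums_cnj_delta])
    moreover have "taylor F n = L2_inner (bdry F) (bdry ?e)"
      using H2_inner_sums[OF F H2_monom[of n]] unfolding taylor_monom
      by (rule sums_unique2[OF sums_cnj_delta])
    ultimately show ?thesis using eq by simp
  qed
  have uniq: "F = G" if "Q F" "Q G" for F G
    using that coef by (intro analytic_disk_eqI) (auto simp: Q_def H2_analytic)
  have ex: "Q (disk_series (fourier u))"
  proof -
    have H: "disk_series (fourier u) \<in> H2" by (intro disk_series_H2 Bessel_fourier u)
    have "L2_inner u (bdry k) = L2_inner (bdry (disk_series (fourier u))) (bdry k)" if k: "k \<in> H2" for k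
      using H2_inner_sums[OF H k] L2_inner_bdry_right_sums[OF u k]
      by (simp add: taylor_disk_series[OF Bseq_square_summable[OF Bessel_fourier[OF u]]] sums_unique2)
    with H show ?thesis by (simp add: Q_def)
  qed
  have "\<exists>!F. Q F" by (rule ex1I[where P = Q, OF ex]) (rule uniq[OF _ ex])
  then have "Q (P_plus u)" unfolding P by (rule theI')
  with uniq show ?thesis unfolding Q_def[symmetric] by blast
qed

section \<open>Multiplication by bounded functions and the weak form of Toeplitz operators\<close>

lemma analytic_disk_mult:
  "F \<in> analytic_disk \<Longrightarrow> G \<in> analytic_disk \<Longrightarrow> (\<lambda>z. F z * G z) \<in> analytic_disk"
  unfolding analytic_disk_def by (simp add: holomorphic_on_mult)

lemma Hinf_analytic: "\<phi> \<in> Hinf \<Longrightarrow> \<phi> \<in> analytic_disk"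
  by (simp add: Hinf_def)

lemma Hinf_bound:
  assumes "\<phi> \<in> Hinf"
  obtains C where "0 < C" "\<And>z. norm (\<phi> z) \<le> C"
proof -
  obtain C where C: "\<And>z. norm z < 1 \<Longrightarrow> norm (\<phi> z) \<le> C"
    using assms unfolding Hinf_def bounded_iff by fastforce
  show ?thesis
  proof (rule that[of "max 1 C"])
    fix z show "norm (\<phi> z) \<le> max 1 C"
      using C[of z] analytic_disk_outside[OF Hinf_analytic[OF assms], of z] by (cases "norm z < 1") auto
  qed auto
qed

lemma H2_mult_Hinf:
  assumes \<phi>: "\<phi> \<in> Hinf" and F: "F \<in> H2"
  shows "(\<lambda>z. \<phi> z * F z) \<in> H2"
proof -
  obtain C where C: "0 < C" "\<And>z. norm (\<phi> z) \<le> C" using Hinf_bound[OF \<phi>] by blast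
  have a: "(\<lambda>z. \<phi> z * F z) \<in> analytic_disk"
    by (intro analytic_disk_mult Hinf_analytic \<phi> H2_analytic F)
  have sq: "integrable circle_measure (\<lambda>\<xi>. (norm (G (complex_of_real r * \<xi>)))\<^sup>2)"
    if "G \<in> analytic_disk" "0 \<le> r" "r < 1" for G r
  proof -
    have "square_integrable (\<lambda>\<xi>. G (complex_of_real r * \<xi>))"
      using that by (intro square_integrable_continuous dilate_measurable analytic_disk_measurable dilate_continuous) auto
    then show ?thesis by (simp add: square_integrable_def)
  qed
  have "(LINT \<xi>|circle_measure. (norm (\<phi> (complex_of_real r * \<xi>) * F (complex_of_real r * \<xi>)))\<^sup>2) \<le> C\<^sup>2 * H2_norm2 F"
    if r: "0 \<le> r" "r < 1" for r
  proof -
    have "(LINT \<xi>|circle_measure. (norm (\<phi> (complex_of_real r * \<xi>) * F (complex_of_real r * \<xi>)))\<^sup>2)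
      \<le> (LINT \<xi>|circle_measure. C\<^sup>2 * (norm (F (complex_of_real r * \<xi>)))\<^sup>2)"
      using sq[OF a r] sq[OF H2_analytic[OF F] r] C
      by (intro integral_mono) (auto simp: norm_mult power_mult_distrib intro!: mult_right_mono power_mono)
    also have "\<dots> \<le> C\<^sup>2 * H2_norm2 F"
      using H2_dilate_le[OF F r] by (auto intro!: mult_left_mono)
    finally show ?thesis .
  qed
  with a show ?thesis by (auto simp: H2_def intro!: bdd_aboveI)
qed

lemma Hinf_subset_H2: assumes "\<phi> \<in> Hinf" shows "\<phi> \<in> H2"
proof -
  have "(\<lambda>z. \<phi> z * disk_series (\<lambda>m. if m = 0 then 1 else 0) z) \<in> H2"
    by (rule H2_mult_Hinf[OF assms H2_monom])
  also have "(\<lambda>z. \<phi> z * disk_series (\<lambda>m. if m = 0 then 1 else 0) z) = \<phi>"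
  proof
    fix z
    have "(\<lambda>n. (if n = 0 then 1 else 0) * z ^ n) sums (1 :: complex)"
      using sums_single[of 0 "\<lambda>n. z ^ n"] by (simp add: if_distrib[where f = "\<lambda>x. x * _"] cong: if_cong)
    then show "\<phi> z * disk_series (\<lambda>m. if m = 0 then 1 else 0) z = \<phi> z"
      using analytic_disk_outside[OF Hinf_analytic[OF assms], of z]
      by (auto simp: disk_series_def sums_iff)
  qed
  finally show ?thesis .
qed

lemma bdry_mult:
  assumes "F \<in> H2" "G \<in> H2"
  shows "AE \<xi> in circle_measure. bdry (\<lambda>z. F z * G z) \<xi> = bdry F \<xi> * bdry G \<xi>"
  using AE_radial_limit[OF assms(1)] AE_radial_limit[OF assms(2)]
proof eventually_elim
  case (elim \<xi>)
  then show ?case by (intro bdry_eqI tendsto_mult) simp_all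
qed

lemma bdry_norm_le:
  assumes "F \<in> H2" "\<And>z. norm (F z) \<le> C"
  shows "AE \<xi> in circle_measure. norm (bdry F \<xi>) \<le> C"
  using AE_radial_limit[OF assms(1)]
proof eventually_elim
  case (elim \<xi>)
  then have "((\<lambda>r. norm (F (complex_of_real r * \<xi>))) \<longlongrightarrow> norm (bdry F \<xi>)) (at_left 1)"
    by (intro tendsto_norm) auto
  then show ?case by (rule tendsto_upperbound) (use assms(2) in auto)
qed

text \<open>The conjugated symbol moves to the other side of the inner product as multiplication by
  \<open>\<phi>\<close>, which maps \<open>H2\<close> into itself. All later arguments about
  Toeplitz operators use this weak form.\<close>

lemma coanalytic_Toeplitz_iff:
  assumes \<phi>: "\<phi> \<in> Hinf" and g: "g \<in> H2"
  shows "F = coanalytic_Toeplitz \<phi> g \<longleftrightarrow>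
    F \<in> H2 \<and> (\<forall>k\<in>H2. L2_inner (bdry g) (bdry (\<lambda>z. \<phi> z * k z)) = L2_inner (bdry F) (bdry k))"
proof -
  obtain C where C: "0 < C" "\<And>z. norm (\<phi> z) \<le> C" using Hinf_bound[OF \<phi>] by blast
  note \<phi>2 = Hinf_subset_H2[OF \<phi>]
  have m: "bdry \<phi> \<in> borel_measurable borel" "bdry g \<in> borel_measurable borel"
    using bdry_H2_measurable \<phi>2 g by auto
  have u: "square_integrable (\<lambda>\<xi>. cnj (bdry \<phi> \<xi>) * bdry g \<xi>)"
    by (rule square_integrable_mult_bounded[OF bdry_square_integrable[OF g], where C = C])
       (use m bdry_norm_le[OF \<phi>2 C(2)] in auto)
  have "L2_inner (\<lambda>\<xi>. cnj (bdry \<phi> \<xi>) * bdry g \<xi>) (bdry k) = L2_inner (bdry g) (bdry (\<lambda>z. \<phi> z * k z))"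
    if k: "k \<in> H2" for k
  proof -
    have "L2_inner (\<lambda>\<xi>. cnj (bdry \<phi> \<xi>) * bdry g \<xi>) (bdry k) = L2_inner (bdry g) (\<lambda>\<xi>. bdry \<phi> \<xi> * bdry k \<xi>)"
      unfolding L2_inner_def by (simp add: mult_ac)
    also have "\<dots> = L2_inner (bdry g) (bdry (\<lambda>z. \<phi> z * k z))"
      using m bdry_H2_measurable[OF k] bdry_H2_measurable[OF H2_mult_Hinf[OF \<phi> k]] bdry_mult[OF \<phi>2 k]
      by (intro L2_inner_cong_AE) (auto elim!: eventually_mono)
    finally show ?thesis .
  qed
  then show ?thesis unfolding coanalytic_Toeplitz_def P_plus_iff[OF u] by simp
qed

section \<open>Cauchy kernels and Blaschke products\<close>

lemma kernel_denom_nonzero: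
  fixes w z :: complex
  assumes "norm w < 1" "norm z \<le> 1" shows "1 - cnj w * z \<noteq> 0"
proof
  assume "1 - cnj w * z = 0"
  then have "norm (cnj w * z) = 1" by simp
  moreover have "norm (cnj w * z) \<le> norm w * 1"
    unfolding norm_mult complex_mod_cnj using assms by (intro mult_left_mono) auto
  ultimately show False using assms by simp
qed

lemma cauchy_kernel_measurable: "cauchy_kernel w \<in> borel_measurable borel"
  unfolding cauchy_kernel_def by measurable

lemma cauchy_kernel_square_integrable:
  assumes "norm w < 1" shows "square_integrable (cauchy_kernel w)"
proof (rule square_integrable_continuous[OF cauchy_kernel_measurable])
  show "continuous_on (sphere 0 1) (cauchy_kernel w)"
    unfolding cauchy_kernel_def using kernel_denom_nonzero[OF assms]
    by (intro continuous_intros) auto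
qed

lemma cauchy_kernel_sums:
  assumes "norm w < 1" "norm z \<le> 1"
  shows "(\<lambda>n. (of_real (sqrt (1 - (norm w)\<^sup>2)) * cnj w ^ n) * z ^ n) sums cauchy_kernel w z"
proof -
  have "norm (cnj w * z) \<le> norm w * 1"
    unfolding norm_mult complex_mod_cnj using assms by (intro mult_left_mono) auto
  then have "norm (cnj w * z) < 1" using assms by simp
  from sums_mult[OF geometric_sums[OF this], of "of_real (sqrt (1 - (norm w)\<^sup>2))"]
  show ?thesis by (simp add: cauchy_kernel_def power_mult_distrib mult.assoc)
qed

lemma fourier_cauchy_kernel:
  assumes w: "norm w < 1"
  shows "fourier (cauchy_kernel w) n = of_real (sqrt (1 - (norm w)\<^sup>2)) * cnj w ^ n"
proof -
  let ?c = "\<lambda>m. of_real (sqrt (1 - (norm w)\<^sup>2)) * cnj w ^ m"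
  have "(\<lambda>m. ?c m * cnj (if m = n then 1 else 0)) sums L2_inner (cauchy_kernel w) (\<lambda>\<xi>. \<xi> ^ n)"
  proof (rule L2_inner_abs_series)
    show "summable (\<lambda>m. norm (?c m))"
      unfolding norm_mult norm_power by (intro summable_mult summable_geometric) (use w in simp)
    show "summable (\<lambda>m. norm (if m = n then 1 else 0 :: complex))"
      by (rule summable_finite[of "{n}"]) auto
    show "(\<lambda>m. ?c m * \<xi> ^ m) sums cauchy_kernel w \<xi>" if "norm \<xi> = 1" for \<xi>
      using cauchy_kernel_sums[OF w, of \<xi>] that by simp
    show "(\<lambda>m. (if m = n then 1 else 0) * \<xi> ^ m) sums (\<xi> ^ n)" for \<xi> :: complex
    proof -
      have "(\<lambda>m. (if m = n then 1 else 0) * \<xi> ^ m) = (\<lambda>m. if m = n then \<xi> ^ m else 0)" by auto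
      then show ?thesis using sums_single[of n "\<lambda>m. \<xi> ^ m"] by simp
    qed
    show "(\<lambda>\<xi>. \<xi> ^ n) \<in> borel_measurable (borel :: complex measure)" by measurable
  qed (rule cauchy_kernel_measurable)
  then show ?thesis unfolding fourier_def by (rule sums_unique2[OF _ sums_cnj_delta])
qed

text \<open>The reproducing property. \<open>cauchy_kernel w\<close> does not vanish outside the
  disk, so it is no member of \<open>H2\<close> in this encoding and is treated as a
  square-integrable function with known Fourier coefficients.\<close>

lemma cauchy_kernel_inner:
  assumes w: "norm w < 1" and k: "k \<in> H2"
  shows "L2_inner (cauchy_kernel w) (bdry k) = of_real (sqrt (1 - (norm w)\<^sup>2)) * cnj (k w)"
proof -
  let ?s = "complex_of_real (sqrt (1 - (norm w)\<^sup>2))"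
  have "(\<lambda>n. (?s * cnj w ^ n) * cnj (taylor k n)) sums L2_inner (cauchy_kernel w) (bdry k)"
    using L2_inner_bdry_right_sums[OF cauchy_kernel_square_integrable[OF w] k]
    by (simp only: fourier_cauchy_kernel[OF w])
  moreover have "(\<lambda>n. cnj (taylor k n * w ^ n)) sums cnj (k w)"
    using analytic_disk_taylor_sums[OF H2_analytic[OF k] w] by (simp only: sums_cnj)
  from sums_mult[OF this, of ?s] have "(\<lambda>n. (?s * cnj w ^ n) * cnj (taylor k n)) sums (?s * cnj (k w))"
    by (simp add: mult_ac)
  ultimately show ?thesis by (rule sums_unique2)
qed

text \<open>Meant for partial sums \<open>S\<close> of kernels, for which \<open>F - S\<close>
  leaves \<open>analytic_disk\<close> and \<open>bdry_measurable\<close> does not apply. Where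
  \<open>S\<close> is continuous, \<open>F - S\<close> has a radial limit exactly when
  \<open>F\<close> has one; finitely many poles do not affect measurability.\<close>

lemma bdry_diff_measurable:
  assumes F: "F \<in> analytic_disk" and S: "S \<in> borel_measurable borel"
    and P: "finite P" and cont: "\<And>\<xi>. \<xi> \<notin> P \<Longrightarrow> isCont S \<xi>"
  shows "bdry (\<lambda>z. F z - S z) \<in> borel_measurable borel"
proof -
  define c :: complex where "c = (THE l. False)"
  define L where "L = {\<xi>. radial_limit_exists F \<xi>}"
  have "L = {\<xi>. norm \<xi> = 1 \<and> radial_limit_exists F \<xi>} \<union> - sphere 0 1"
    using radial_limit_interior_exterior[OF F] unfolding L_def radial_limit_exists_def by force
  moreover have "{\<xi>. norm \<xi> = 1 \<and> radial_limit_exists F \<xi>} \<union> - sphere 0 1 \<in> sets borel"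
    by (intro sets.Un radial_limit_exists_borel F) simp
  ultimately have L: "L \<inter> space borel \<in> sets borel"
    by (simp only: space_borel Int_UNIV_right)
  let ?h = "\<lambda>\<xi>. if \<xi> \<in> L then bdry F \<xi> - S \<xi> else c"
  have h: "?h \<in> borel_measurable borel"
    by (intro measurable_If_set borel_measurable_diff bdry_measurable F S measurable_const L) simp
  show ?thesis
  proof (rule measurable_discrete_difference[OF h])
    show "countable P" using P by (rule countable_finite)
    fix \<xi> assume "\<xi> \<notin> P"
    from cont[OF this] have "((\<lambda>r. S (complex_of_real r * \<xi>)) \<longlongrightarrow> S \<xi>) (at_left 1)"
    proof (rule isCont_tendsto_compose)
      have "((\<lambda>r. complex_of_real r * \<xi>) \<longlongrightarrow> of_real 1 * \<xi>) (at_left 1)" by (intro tendsto_intros)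
      then show "((\<lambda>r. complex_of_real r * \<xi>) \<longlongrightarrow> \<xi>) (at_left 1)" by simp
    qed
    note S\<xi> = this
    show "?h \<xi> = bdry (\<lambda>z. F z - S z) \<xi>"
    proof (cases "\<xi> \<in> L")
      case True
      then have "radial_limit_exists F \<xi>" by (simp add: L_def)
      from tendsto_diff[OF radial_limit_bdry[OF this] S\<xi>] True show ?thesis
        by (simp add: bdry_eqI)
    next
      case False
      have "\<not> ((\<lambda>r. F (complex_of_real r * \<xi>) - S (complex_of_real r * \<xi>)) \<longlongrightarrow> l) (at_left 1)" for l
      proof
        assume "((\<lambda>r. F (complex_of_real r * \<xi>) - S (complex_of_real r * \<xi>)) \<longlongrightarrow> l) (at_left 1)"
        from tendsto_add[OF this S\<xi>] False show False
          by (simp add: L_def radial_limit_exists_def)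
      qed
      with False show ?thesis
        by (simp add: bdry_def Topological_Spaces.Lim_def c_def)
    qed
  qed auto
qed

text \<open>The inner product is continuous in the norm, and each partial sum pairs with
  \<open>k\<close> by the reproducing property. Later arguments isolate a coefficient by choosing
  \<open>k\<close> zero at all other points \<open>l m\<close>.\<close>

lemma H2_sums_inner:
  assumes l: "\<And>n. norm (l n) < 1" and f: "H2_sums (\<lambda>n z. a n * cauchy_kernel (l n) z) f" and k: "k \<in> H2"
  shows "(\<lambda>n. a n * of_real (sqrt (1 - (norm (l n))\<^sup>2)) * cnj (k (l n))) sums L2_inner (bdry f) (bdry k)"
proof -
  have fH: "f \<in> H2" and lim: "(\<lambda>N. L2_norm (bdry (\<lambda>z. f z - (\<Sum>n<N. a n * cauchy_kernel (l n) z)))) \<longlonglongrightarrow> 0"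
    using f by (simp_all add: H2_sums_def)
  define S where "S N z = (\<Sum>n<N. a n * cauchy_kernel (l n) z)" for N z
  have Sm: "S N \<in> borel_measurable borel" for N
    unfolding S_def by (intro borel_measurable_sum borel_measurable_times borel_measurable_const cauchy_kernel_measurable)
  have Scont: "isCont (S N) \<xi>" if "\<And>n. n < N \<Longrightarrow> 1 - cnj (l n) * \<xi> \<noteq> 0" for N \<xi>
    unfolding S_def cauchy_kernel_def using that by (intro continuous_intros) auto
  have Ssq: "square_integrable (S N)" for N
  proof (rule square_integrable_continuous[OF Sm])
    show "continuous_on (sphere 0 1) (S N)"
      by (intro continuous_at_imp_continuous_on ballI Scont kernel_denom_nonzero l) auto
  qed
  have "L2_norm (bdry (\<lambda>z. f z - S N z)) = L2_norm (\<lambda>\<xi>. bdry f \<xi> - S N \<xi>)" for N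
  proof (rule L2_norm_cong_AE)
    show "AE \<xi> in circle_measure. bdry (\<lambda>z. f z - S N z) \<xi> = bdry f \<xi> - S N \<xi>"
      using AE_radial_limit[OF fH]
    proof eventually_elim
      case (elim \<xi>)
      have "isCont (S N) \<xi>" using elim by (intro Scont kernel_denom_nonzero l) auto
      moreover have "((\<lambda>r. complex_of_real r * \<xi>) \<longlongrightarrow> of_real 1 * \<xi>) (at_left 1)" by (intro tendsto_intros)
      ultimately have "((\<lambda>r. S N (complex_of_real r * \<xi>)) \<longlongrightarrow> S N \<xi>) (at_left 1)"
        by (intro isCont_tendsto_compose[of \<xi> "S N"]) simp_all
      with elim show ?case by (intro bdry_eqI tendsto_diff) auto
    qed
    show "bdry (\<lambda>z. f z - S N z) \<in> borel_measurable borel"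
    proof (rule bdry_diff_measurable[OF H2_analytic[OF fH] Sm])
      \<comment> \<open>These are the poles of the kernels. For \<open>l n = 0\<close> there is no
        pole, and division by zero merely adds the point \<open>0\<close>.\<close>
      show "finite ((\<lambda>n. 1 / cnj (l n)) ` {..<N})" by simp
      fix \<xi> assume \<xi>: "\<xi> \<notin> (\<lambda>n. 1 / cnj (l n)) ` {..<N}"
      show "isCont (S N) \<xi>"
      proof (rule Scont)
        fix n assume "n < N"
        with \<xi> have "\<xi> \<noteq> 1 / cnj (l n)" by auto
        then show "1 - cnj (l n) * \<xi> \<noteq> 0"
          by (cases "l n = 0") (auto simp: field_simps)
      qed
    qed
    show "(\<lambda>\<xi>. bdry f \<xi> - S N \<xi>) \<in> borel_measurable borel"
      by (intro borel_measurable_diff bdry_H2_measurable fH Sm)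
  qed
  with lim have "(\<lambda>N. L2_norm (\<lambda>\<xi>. bdry f \<xi> - S N \<xi>)) \<longlonglongrightarrow> 0" unfolding S_def by simp
  then have "(\<lambda>N. L2_inner (S N) (bdry k)) \<longlonglongrightarrow> L2_inner (bdry f) (bdry k)"
    by (intro L2_inner_tendsto_left Ssq bdry_square_integrable fH k)
  moreover have "L2_inner (S N) (bdry k) = (\<Sum>n<N. a n * of_real (sqrt (1 - (norm (l n))\<^sup>2)) * cnj (k (l n)))" for N
  proof -
    have i: "integrable circle_measure (\<lambda>\<xi>. cauchy_kernel (l n) \<xi> * cnj (bdry k \<xi>))" for n
      by (intro L2_Cauchy_Schwarz cauchy_kernel_square_integrable l bdry_square_integrable k)
    have "L2_inner (S N) (bdry k) = (LINT \<xi>|circle_measure. (\<Sum>n<N. a n * (cauchy_kernel (l n) \<xi> * cnj (bdry k \<xi>))))"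
      unfolding L2_inner_def S_def by (intro Bochner_Integration.integral_cong) (simp_all add: sum_distrib_right mult.assoc)
    also have "\<dots> = (\<Sum>n<N. a n * L2_inner (cauchy_kernel (l n)) (bdry k))"
      unfolding L2_inner_def using i by (subst Bochner_Integration.integral_sum) auto
    finally show ?thesis by (simp add: cauchy_kernel_inner l k mult.assoc)
  qed
  ultimately show ?thesis by (simp add: sums_def)
qed

text \<open>\<open>b n\<close> is \<open>B\<close> without its \<open>n\<close>-th factor, and
  \<open>\<delta>\<close> is the infimum in \<open>interpolating\<close>. Since the zeros are
  positive, the unimodular normalization in \<open>Blaschke_factor\<close> is \<open>1\<close>;
  since \<open>1 - \<Lambda> k\<close> is summable, the remaining products converge uniformly on
  smaller disks.\<close>

lemma Blaschke_split:
  assumes B: "interpolating_Blaschke_product (\<lambda>n. complex_of_real (\<Lambda> n)) B" and \<Lambda>: "range \<Lambda> \<subseteq> {0<..<1}"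
  obtains \<delta> :: real and b :: "nat \<Rightarrow> complex \<Rightarrow> complex" where "0 < \<delta>"
    "\<And>n. b n holomorphic_on ball 0 1" "\<And>n z. norm z < 1 \<Longrightarrow> norm (b n z) \<le> 1"
    "\<And>n z. norm z < 1 \<Longrightarrow> B z = (of_real (\<Lambda> n) - z) / (1 - of_real (\<Lambda> n) * z) * b n z"
    "\<And>n. \<delta> \<le> norm (b n (of_real (\<Lambda> n)))" "\<And>m n. m \<noteq> n \<Longrightarrow> b n (of_real (\<Lambda> m)) = 0"
proof -
  have L: "0 < \<Lambda> n" "\<Lambda> n < 1" for n using subsetD[OF \<Lambda> rangeI[of \<Lambda> n]] by auto
  let ?l = "\<lambda>n. complex_of_real (\<Lambda> n)"
  let ?F = "\<lambda>k z. (?l k - z) / (1 - ?l k * z)"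
  from B obtain \<gamma> where \<gamma>: "norm \<gamma> = 1" "\<And>z. norm z < 1 \<Longrightarrow> B z = \<gamma> * (\<Prod>n. Blaschke_factor (?l n) z)"
    and sm: "summable (\<lambda>n. 1 - \<Lambda> n)" and int: "interpolating ?l"
    unfolding interpolating_Blaschke_product_def Blaschke_product_def using L by (auto simp: abs_of_pos)
  have BF: "Blaschke_factor (?l k) z = ?F k z" for k z
    using L[of k] by (simp add: Blaschke_factor_def)
  have nz: "1 - ?l k * z \<noteq> 0" if "norm z < 1" for k z
    using kernel_denom_nonzero[of "?l k" z] that L[of k] by simp
  have F1: "norm (?F k z) \<le> 1" if "norm z < 1" for k z
    using Moebius_function_norm_lt_1[of "?l k" z 0] that L[of k]
    by (simp add: Moebius_function_simple norm_divide norm_minus_commute)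
  \<comment> \<open>The \<open>n\<close>-th factor is replaced by \<open>1\<close> instead of being
    dropped, so that all products run over initial segments.\<close>
  let ?G = "\<lambda>n k z. if k = n then 1 else ?F k z"
  have Gm1: "norm (?G n k z - 1) \<le> (1 - \<Lambda> k) * (2 / (1 - r))" if "norm z \<le> r" "r < 1" for n k z r
  proof (cases "k = n")
    case True
    then show ?thesis using that L[of k] by simp
  next
    case False
    have z: "norm z < 1" using that by simp
    \<comment> \<open>The numerator contains the factor \<open>1 - \<Lambda> k\<close>, which is
      where the Blaschke condition enters.\<close>
    have "?F k z - 1 = - ((1 - ?l k) * (1 + z)) / (1 - ?l k * z)"
      using nz[OF z, of k] by (simp add: field_simps)
    then have "norm (?F k z - 1) = norm (1 - ?l k) * norm (1 + z) / norm (1 - ?l k * z)"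
      by (simp add: norm_mult norm_divide)
    also have "norm (1 - ?l k) = 1 - \<Lambda> k"
      using L[of k] by (metis abs_of_pos diff_gt_0_iff_gt norm_of_real of_real_1 of_real_diff)
    also have "(1 - \<Lambda> k) * norm (1 + z) / norm (1 - ?l k * z) \<le> (1 - \<Lambda> k) * 2 / (1 - r)"
    proof (intro frac_le mult_left_mono)
      show "norm (1 + z) \<le> 2" using norm_triangle_ineq[of 1 z] z by simp
      have "norm (?l k * z) \<le> 1 * r" unfolding norm_mult using L[of k] that by (intro mult_mono) auto
      then show "1 - r \<le> norm (1 - ?l k * z)" using norm_triangle_ineq2[of 1 "?l k * z"] by simp
    qed (use L[of k] that in auto)
    finally show ?thesis using False by simp
  qed
  have smr: "summable (\<lambda>k. (1 - \<Lambda> k) * C)" for C by (intro summable_mult2 sm)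
  have Ghol: "?G n k holomorphic_on ball 0 1" for n k
  proof (cases "k = n")
    case False
    have "?F k holomorphic_on ball 0 1" by (intro holomorphic_intros) (use nz in auto)
    with False show ?thesis by simp
  qed auto
  define p where "p n z = lim (\<lambda>N. \<Prod>k<N. ?G n k z)" for n z
  have ulim: "uniform_limit (cball 0 r) (\<lambda>N z. \<Prod>k<N. ?G n k z) (p n) sequentially" if r: "r < 1" for n r
  proof -
    have "uniformly_convergent_on (cball 0 r) (\<lambda>N z. \<Prod>k<N. ?G n k z)"
    proof (rule uniformly_convergent_on_prod')
      show "continuous_on (cball 0 r) (?G n k)" for k
        by (rule continuous_on_subset[OF holomorphic_on_imp_continuous_on[OF Ghol]]) (use r in auto)
      show "uniformly_convergent_on (cball 0 r) (\<lambda>N z. \<Sum>k<N. norm (?G n k z - 1))"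
        by (rule Weierstrass_m_test'[OF _ smr[of "2 / (1 - r)"]]) (use Gm1 r in simp)
    qed simp
    then show ?thesis unfolding uniformly_convergent_uniform_limit_iff p_def .
  qed
  have plim: "(\<lambda>N. \<Prod>k<N. ?G n k z) \<longlonglongrightarrow> p n z" if "norm z < 1" for n z
    by (rule tendsto_uniform_limitI[OF ulim[OF that]]) simp
  have phol: "p n holomorphic_on ball 0 1" for n
  proof (rule holomorphic_uniform_sequence)
    show "(\<lambda>z. \<Prod>k<N. ?G n k z) holomorphic_on ball 0 1" for N
      by (intro holomorphic_on_prod Ghol)
    fix x :: complex assume x: "x \<in> ball 0 1"
    define d where "d = (1 - norm x) / 2"
    have d: "0 < d" using x by (simp add: d_def)
    have sub: "cball x d \<subseteq> cball 0 (norm x + d)"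
    proof
      fix y assume "y \<in> cball x d"
      then show "y \<in> cball 0 (norm x + d)"
        using norm_triangle_sub[of y x] by (simp add: dist_norm norm_minus_commute)
    qed
    have "norm x + d < 1" using x by (simp add: d_def field_simps)
    with sub d show "\<exists>d>0. cball x d \<subseteq> ball 0 1 \<and> uniform_limit (cball x d) (\<lambda>N z. \<Prod>k<N. ?G n k z) (p n) sequentially"
      by (intro exI[of _ d] conjI uniform_limit_on_subset[OF ulim]) auto
  qed simp
  have p1: "norm (p n z) \<le> 1" if z: "norm z < 1" for n z
  proof (rule tendsto_upperbound[OF tendsto_norm[OF plim[OF z]]])
    have "norm (\<Prod>k<N. ?G n k z) \<le> 1" for N
      unfolding prod_norm[symmetric] by (rule prod_le_1) (use F1[OF z] in auto)
    then show "\<forall>\<^sub>F N in sequentially. norm (\<Prod>k<N. ?G n k z) \<le> 1" by simp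
  qed simp
  have Bp: "B z = ?F n z * (\<gamma> * p n z)" if z: "norm z < 1" for n z
  proof -
    have "summable (\<lambda>k. norm (?F k z - 1))"
    proof (rule summable_comparison_test'[OF smr[of "2 / (1 - norm z)"]])
      show "norm (norm (?F k z - 1)) \<le> (1 - \<Lambda> k) * (2 / (1 - norm z))" for k
        using Gm1[of z "norm z" k "Suc k"] z by simp
    qed
    then have "convergent_prod (\<lambda>k. ?F k z)"
      by (intro abs_convergent_prod_imp_convergent_prod summable_imp_abs_convergent_prod)
    from convergent_prod_LIMSEQ[OF this]
    have "(\<lambda>N. \<Prod>k\<le>N. ?F k z) \<longlonglongrightarrow> (\<Prod>k. ?F k z)" .
    moreover have "(\<lambda>N. \<Prod>k\<le>N. ?F k z) \<longlonglongrightarrow> ?F n z * p n z"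
    proof (rule Lim_transform_eventually)
      \<comment> \<open>The infinite product is the limit of products up to \<open>N\<close>
        inclusive, hence the shift by one.\<close>
      have "(\<lambda>N. \<Prod>k<Suc N. ?G n k z) \<longlonglongrightarrow> p n z" using LIMSEQ_Suc[OF plim[OF z]] .
      then show "(\<lambda>N. ?F n z * (\<Prod>k<Suc N. ?G n k z)) \<longlonglongrightarrow> ?F n z * p n z" by (intro tendsto_intros)
      show "\<forall>\<^sub>F N in sequentially. ?F n z * (\<Prod>k<Suc N. ?G n k z) = (\<Prod>k\<le>N. ?F k z)"
      proof (rule eventually_sequentiallyI[of n])
        fix N assume "n \<le> N"
        then have "(\<Prod>k\<le>N. ?F k z) = ?F n z * (\<Prod>k\<in>{..N} - {n}. ?F k z)" by (intro prod.remove) auto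
        also have "(\<Prod>k\<in>{..N} - {n}. ?F k z) = (\<Prod>k\<in>{..N} - {n}. ?G n k z)" by (intro prod.cong) auto
        also have "\<dots> = (\<Prod>k\<le>N. ?G n k z)" using \<open>n \<le> N\<close> by (subst (2) prod.remove[of _ n]) auto
        finally show "?F n z * (\<Prod>k<Suc N. ?G n k z) = (\<Prod>k\<le>N. ?F k z)" by (simp only: lessThan_Suc_atMost)
      qed
    qed
    ultimately have "(\<Prod>k. ?F k z) = ?F n z * p n z" by (rule LIMSEQ_unique)
    with \<gamma>(2)[OF z] show ?thesis by (simp add: BF)
  qed
  define I where "I n = lim (\<lambda>N. \<Prod>k\<in>{..<N} - {n}. norm ((?l k - ?l n) / (1 - cnj (?l k) * ?l n)))" for n
  have Ip: "I n = norm (p n (?l n))" for n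
  proof -
    have "(\<Prod>k\<in>{..<N} - {n}. norm ((?l k - ?l n) / (1 - cnj (?l k) * ?l n))) = norm (\<Prod>k<N. ?G n k (?l n))" for N
    proof -
      have "(\<Prod>k<N. norm (?G n k (?l n))) = (\<Prod>k\<in>{..<N} - {n}. norm (?G n k (?l n)))"
        by (cases "n < N") (auto simp: prod.remove[of _ n])
      also have "\<dots> = (\<Prod>k\<in>{..<N} - {n}. norm ((?l k - ?l n) / (1 - cnj (?l k) * ?l n)))"
        by (intro prod.cong) auto
      finally show ?thesis by (simp only: prod_norm)
    qed
    then show ?thesis
      unfolding I_def using tendsto_norm[OF plim[of "?l n" n]] L[of n] by (simp add: limI)
  qed
  define \<delta> where "\<delta> = (INF n. I n)"
  have d0: "0 < \<delta>" using int by (simp add: interpolating_def \<delta>_def I_def)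
  have dle: "\<delta> \<le> norm (p n (?l n))" for n
  proof -
    have "bdd_below (range I)" by (rule bdd_belowI[of _ 0]) (auto simp: Ip)
    then have "\<delta> \<le> I n" unfolding \<delta>_def by (intro cINF_lower) auto
    then show ?thesis by (simp add: Ip)
  qed
  show ?thesis
  proof (rule that[OF d0, of "\<lambda>n z. \<gamma> * p n z"])
    show "(\<lambda>z. \<gamma> * p n z) holomorphic_on ball 0 1" for n by (intro holomorphic_intros phol)
    show "norm (\<gamma> * p n z) \<le> 1" if "norm z < 1" for n z using p1[OF that] \<gamma>(1) by (simp add: norm_mult)
    show "B z = ?F n z * (\<gamma> * p n z)" if "norm z < 1" for n z by (rule Bp[OF that])
    show "\<delta> \<le> norm (\<gamma> * p n (?l n))" for n using dle \<gamma>(1) by (simp add: norm_mult)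
    \<comment> \<open>\<open>B\<close> vanishes at \<open>\<Lambda> m\<close> through its
      \<open>m\<close>-th factor, whereas the \<open>n\<close>-th factor does not vanish there, as
      the zeros are distinct.\<close>
    show "\<gamma> * p n (?l m) = 0" if mn: "m \<noteq> n" for m n
    proof -
      have lm: "norm (?l m) < 1" using L[of m] by simp
      have "?l m \<noteq> ?l n" using int mn by (auto simp: interpolating_def inj_def)
      then have "?F n (?l m) \<noteq> 0" using nz[OF lm, of n] by simp
      moreover have "B (?l m) = 0" using Bp[OF lm, of m] by simp
      ultimately show ?thesis using Bp[OF lm, of n] by (metis mult_eq_0_iff)
    qed
  qed
qed

section \<open>Bounded test functions and coefficients of functions in the Toeplitz range\<close>

lemma HinfI:
  assumes "\<phi> holomorphic_on ball 0 1" "\<And>z. norm z < 1 \<Longrightarrow> norm (\<phi> z) \<le> C"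
  shows "(\<lambda>z. if norm z < 1 then \<phi> z else 0) \<in> Hinf"
proof -
  have "(\<lambda>z. if norm z < 1 then \<phi> z else 0) holomorphic_on ball 0 1"
    by (rule holomorphic_transform[OF assms(1)]) simp
  moreover have "bounded ((\<lambda>z. if norm z < 1 then \<phi> z else 0) ` ball 0 1)"
    unfolding bounded_iff using assms(2) by (intro exI[of _ C]) auto
  ultimately show ?thesis by (simp add: Hinf_def analytic_disk_def)
qed

text \<open>Once the singularity is removed, the quotient is bounded near \<open>w\<close> by
  compactness, and at distance more than \<open>d\<close> from \<open>w\<close> it is at most
  \<open>2 * C / d\<close>.\<close>

lemma difference_quotient_Hinf:
  assumes \<phi>: "\<phi> \<in> Hinf" and w: "norm w < 1"
  obtains q where "q \<in> Hinf" "\<And>z. norm z < 1 \<Longrightarrow> \<phi> z - \<phi> w = q z * (z - w)"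
proof -
  define p where "p = (\<lambda>z. if z = w then deriv \<phi> w else (\<phi> z - \<phi> w) / (z - w))"
  have hol: "p holomorphic_on ball 0 1"
    unfolding p_def by (rule pole_lemma_open[OF analytic_disk_holomorphic[OF Hinf_analytic[OF \<phi>]]]) simp
  obtain C where C: "0 < C" "\<And>z. norm (\<phi> z) \<le> C" using Hinf_bound[OF \<phi>] by blast
  define d where "d = (1 - norm w) / 2"
  have d: "0 < d" using w by (simp add: d_def)
  have sub: "cball w d \<subseteq> ball 0 1"
  proof
    fix y assume "y \<in> cball w d"
    then have "norm y \<le> norm w + d"
      using norm_triangle_sub[of y w] by (simp add: dist_norm norm_minus_commute)
    then show "y \<in> ball 0 1" using w by (simp add: d_def field_simps)
  qed
  have "compact (p ` cball w d)"
    by (intro compact_continuous_image continuous_on_subset[OF holomorphic_on_imp_continuous_on[OF hol]] sub) simp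
  then have "bounded (p ` cball w d)" by (rule compact_imp_bounded)
  then obtain M where M: "\<And>z. z \<in> cball w d \<Longrightarrow> norm (p z) \<le> M"
    unfolding bounded_iff ball_simps by blast
  have "norm (p z) \<le> max M (2 * C / d)" if "norm z < 1" for z
  proof (cases "z \<in> cball w d")
    case False
    then have zw: "d < norm (z - w)" by (simp add: dist_norm norm_minus_commute)
    have "norm (\<phi> z - \<phi> w) \<le> 2 * C"
      using norm_triangle_ineq4[of "\<phi> z" "\<phi> w"] C(2)[of z] C(2)[of w] by linarith
    moreover have "norm (p z) = norm (\<phi> z - \<phi> w) / norm (z - w)"
      using zw d by (auto simp: p_def norm_divide)
    ultimately have "norm (p z) \<le> 2 * C / d" using zw d C by (auto intro!: frac_le)
    then show ?thesis by simp
  qed (use M in \<open>auto simp: le_max_iff_disj\<close>)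
  from HinfI[OF hol this] have "(\<lambda>z. if norm z < 1 then p z else 0) \<in> Hinf" .
  then show ?thesis by (rule that) (auto simp: p_def)
qed

text \<open>Write \<open>s n = sqrt (1 - (\<Lambda> n)^2)\<close>. The test function has norm at
  most \<open>1 / s n\<close>, its value at \<open>\<Lambda> n\<close> has modulus
  \<open>|b n (\<Lambda> n)| / (s n)^2\<close>, and the normalized kernel contributes one more
  \<open>s n\<close>. All powers cancel, which leaves the constant
  \<open>L2_norm (bdry g) / \<delta>\<close>, independent of \<open>n\<close>.\<close>

lemma Toeplitz_range_coefficient_bound:
  assumes B: "interpolating_Blaschke_product (\<lambda>n. complex_of_real (\<Lambda> n)) B" and \<Lambda>: "range \<Lambda> \<subseteq> {0<..<1}"
    and f: "H2_sums (\<lambda>n z. a n * cauchy_kernel (complex_of_real (\<Lambda> n)) z) f"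
    and \<phi>: "\<phi> \<in> Hinf" and fT: "f \<in> coanalytic_Toeplitz \<phi> ` model_space B"
  shows "\<exists>C. \<forall>n. norm (a n) \<le> C * norm (\<phi> (complex_of_real (\<Lambda> n)))"
proof -
  let ?l = "\<lambda>n. complex_of_real (\<Lambda> n)"
  let ?s = "\<lambda>n. sqrt (1 - (\<Lambda> n)\<^sup>2)"
  have L: "0 < \<Lambda> n" "\<Lambda> n < 1" for n using subsetD[OF \<Lambda> rangeI[of \<Lambda> n]] by auto
  have l: "norm (?l n) < 1" and ln: "norm (?l n) = \<Lambda> n" for n using L[of n] by auto
  have s: "0 < ?s n" "?s n * ?s n = 1 - (\<Lambda> n)\<^sup>2" for n
    using L[of n] power_strict_mono[of "\<Lambda> n" 1 2] by auto
  from Blaschke_split[OF B \<Lambda>] obtain \<delta> :: real and b where \<delta>: "0 < \<delta>"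
    and bhol: "\<And>n. b n holomorphic_on ball 0 1" and b1: "\<And>n z. norm z < 1 \<Longrightarrow> norm (b n z) \<le> 1"
    and Bb: "\<And>n z. norm z < 1 \<Longrightarrow> B z = (?l n - z) / (1 - ?l n * z) * b n z"
    and b\<delta>: "\<And>n. \<delta> \<le> norm (b n (?l n))" and b0: "\<And>m n. m \<noteq> n \<Longrightarrow> b n (?l m) = 0" by metis
  from fT obtain g where gK: "g \<in> model_space B" and fg: "f = coanalytic_Toeplitz \<phi> g" by blast
  then have gH: "g \<in> H2" and gB: "\<And>h. h \<in> H2 \<Longrightarrow> L2_inner (bdry g) (bdry (\<lambda>z. B z * h z)) = 0"
    by (auto simp: model_space_def)
  have fH: "f \<in> H2" and T: "\<And>k. k \<in> H2 \<Longrightarrow> L2_inner (bdry g) (bdry (\<lambda>z. \<phi> z * k z)) = L2_inner (bdry f) (bdry k)"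
    using coanalytic_Toeplitz_iff[OF \<phi> gH, of f] fg by auto
  have "norm (a n) \<le> L2_norm (bdry g) / \<delta> * norm (\<phi> (?l n))" for n
  proof -
    \<comment> \<open>This is \<open>B / (\<Lambda> n - z)\<close> with the zero of \<open>B\<close>
      already cancelled. It vanishes at every other \<open>\<Lambda> m\<close>, which singles out
      \<open>a n\<close>.\<close>
    define \<psi> where "\<psi> = (\<lambda>z. if norm z < 1 then b n z / (1 - ?l n * z) else 0)"
    have nz: "1 - ?l n * z \<noteq> 0" if "norm z \<le> 1" for z
      using kernel_denom_nonzero[OF l[of n], of z] that by simp
    have lb: "1 - \<Lambda> n \<le> norm (1 - ?l n * z)" if "norm z < 1" for z
    proof -
      have "norm (?l n * z) \<le> \<Lambda> n * 1"
        unfolding norm_mult ln using that L[of n] by (intro mult_left_mono) auto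
      then show ?thesis using norm_triangle_ineq2[of 1 "?l n * z"] by simp
    qed
    have \<psi>: "\<psi> \<in> Hinf" unfolding \<psi>_def
    proof (rule HinfI[where C = "1 / (1 - \<Lambda> n)"])
      show "(\<lambda>z. b n z / (1 - ?l n * z)) holomorphic_on ball 0 1"
        by (intro holomorphic_intros bhol) (use nz in auto)
      show "norm (b n z / (1 - ?l n * z)) \<le> 1 / (1 - \<Lambda> n)" if "norm z < 1" for z
        unfolding norm_divide using b1[OF that] lb[OF that] L[of n] by (intro frac_le) auto
    qed
    have \<psi>H: "\<psi> \<in> H2" by (rule Hinf_subset_H2[OF \<psi>])
    have fpsi: "L2_inner (bdry f) (bdry \<psi>) = a n * of_real (?s n) * cnj (\<psi> (?l n))"
    proof -
      have 1: "(\<lambda>m. a m * of_real (?s m) * cnj (\<psi> (?l m))) sums L2_inner (bdry f) (bdry \<psi>)"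
        using H2_sums_inner[OF l f \<psi>H] by (simp only: ln)
      have 2: "a m * of_real (?s m) * cnj (\<psi> (?l m)) = 0" if "m \<noteq> n" for m
        using b0[OF that] by (simp add: \<psi>_def)
      have "(\<lambda>m. a m * of_real (?s m) * cnj (\<psi> (?l m))) sums (a n * of_real (?s n) * cnj (\<psi> (?l n)))"
        using sums_finite[of "{n}" "\<lambda>m. a m * of_real (?s m) * cnj (\<psi> (?l m))"] 2 by simp
      with 1 show ?thesis by (rule sums_unique2)
    qed
    obtain q where q: "q \<in> Hinf" "\<And>z. norm z < 1 \<Longrightarrow> \<phi> z - \<phi> (?l n) = q z * (z - ?l n)"
      using difference_quotient_Hinf[OF \<phi> l] by metis
    have qH: "(\<lambda>z. - q z) \<in> H2"
    proof -
      have "(\<lambda>z. - q z) \<in> Hinf" using q(1) by (auto simp: Hinf_def analytic_disk_def bounded_iff intro!: holomorphic_intros)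
      then show ?thesis by (rule Hinf_subset_H2)
    qed
    \<comment> \<open>\<open>B\<close> is arbitrary outside the disk, but \<open>q\<close> and
      \<open>\<psi>\<close> are zero there, so the identity holds for all \<open>z\<close>.\<close>
    have Bq: "B z * - q z = \<phi> z * \<psi> z - \<phi> (?l n) * \<psi> z" for z
    proof (cases "norm z < 1")
      case True
      have "B z * - q z = (q z * (z - ?l n)) * (b n z / (1 - ?l n * z))"
        unfolding Bb[OF True, of n] by (simp add: algebra_simps diff_divide_distrib)
      also have "\<dots> = (\<phi> z - \<phi> (?l n)) * \<psi> z" using True by (simp add: q(2)[OF True, symmetric] \<psi>_def)
      finally show ?thesis by (simp add: algebra_simps)
    next
      case False
      then have "q z = 0" using analytic_disk_outside[OF Hinf_analytic[OF q(1)], of z] by simp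
      with False show ?thesis by (simp add: \<psi>_def)
    qed
    have "L2_inner (bdry f) (bdry \<psi>) = cnj (\<phi> (?l n)) * L2_inner (bdry g) (bdry \<psi>)"
    proof -
      note \<phi>\<psi>H = H2_mult_Hinf[OF \<phi> \<psi>H]
      have m: "bdry g \<in> borel_measurable borel" "bdry \<psi> \<in> borel_measurable borel"
        "bdry (\<lambda>z. \<phi> z * \<psi> z) \<in> borel_measurable borel"
        using bdry_H2_measurable gH \<psi>H \<phi>\<psi>H by auto
      have i: "integrable circle_measure (\<lambda>\<xi>. bdry g \<xi> * cnj (bdry (\<lambda>z. \<phi> z * \<psi> z) \<xi>))"
        "integrable circle_measure (\<lambda>\<xi>. bdry g \<xi> * cnj (bdry \<psi> \<xi>))"
        by (intro L2_Cauchy_Schwarz bdry_square_integrable gH \<psi>H \<phi>\<psi>H)+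
      have AE: "AE \<xi> in circle_measure. bdry (\<lambda>z. B z * - q z) \<xi> = bdry (\<lambda>z. \<phi> z * \<psi> z) \<xi> - \<phi> (?l n) * bdry \<psi> \<xi>"
        using AE_radial_limit[OF \<phi>\<psi>H] AE_radial_limit[OF \<psi>H]
      proof eventually_elim
        case (elim \<xi>)
        show ?case unfolding Bq using elim by (intro bdry_eqI tendsto_diff tendsto_mult tendsto_const) auto
      qed
      have mm: "bdry (\<lambda>z. B z * - q z) \<in> borel_measurable borel"
      proof (rule bdry_measurable)
        have "(\<lambda>z. \<phi> z * \<psi> z) holomorphic_on ball 0 1" "\<psi> holomorphic_on ball 0 1"
          using H2_analytic \<phi>\<psi>H \<psi>H analytic_disk_holomorphic by blast+
        then show "(\<lambda>z. B z * - q z) \<in> analytic_disk"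
          unfolding Bq by (auto simp: analytic_disk_def \<psi>_def intro!: holomorphic_intros)
      qed
      have "0 = L2_inner (bdry g) (bdry (\<lambda>z. B z * - q z))" by (rule gB[OF qH, symmetric])
      also have "\<dots> = L2_inner (bdry g) (\<lambda>\<xi>. bdry (\<lambda>z. \<phi> z * \<psi> z) \<xi> - \<phi> (?l n) * bdry \<psi> \<xi>)"
        by (rule L2_inner_cong_AE[OF _ AE]) (use m mm in auto)
      also have "\<dots> = (LINT \<xi>|circle_measure. bdry g \<xi> * cnj (bdry (\<lambda>z. \<phi> z * \<psi> z) \<xi>) - cnj (\<phi> (?l n)) * (bdry g \<xi> * cnj (bdry \<psi> \<xi>)))"
        unfolding L2_inner_def by (intro Bochner_Integration.integral_cong) (auto simp: algebra_simps)
      also have "\<dots> = L2_inner (bdry g) (bdry (\<lambda>z. \<phi> z * \<psi> z)) - cnj (\<phi> (?l n)) * L2_inner (bdry g) (bdry \<psi>)"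
        unfolding L2_inner_def using i by simp
      finally show ?thesis using T[OF \<psi>H] by simp
    qed
    moreover have "norm (L2_inner (bdry g) (bdry \<psi>)) \<le> L2_norm (bdry g) * (1 / ?s n)"
    proof -
      \<comment> \<open>\<open>|\<psi>|\<close> is at most the modulus of the unnormalized kernel,
        whose squared norm is the geometric series in \<open>(\<Lambda> n)^2\<close>.\<close>
      have "L2_norm (bdry \<psi>) \<le> 1 / ?s n"
      proof -
        let ?k = "\<lambda>\<xi>. 1 / (1 - ?l n * \<xi>)"
        have km: "?k \<in> borel_measurable borel" by measurable
        have ks: "square_integrable ?k"
          by (rule square_integrable_continuous[OF km]) (intro continuous_intros, use nz in auto)
        have g: "(\<lambda>m. ?l n ^ m * \<xi> ^ m) sums ?k \<xi>" if "norm \<xi> = 1" for \<xi>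
          using geometric_sums[of "?l n * \<xi>"] that l[of n] by (simp add: norm_mult power_mult_distrib)
        have sm: "summable (\<lambda>m. norm (?l n ^ m))"
          unfolding norm_power by (intro summable_geometric) (use l[of n] in simp)
        have "(\<lambda>m. ?l n ^ m * cnj (?l n ^ m)) sums L2_inner ?k ?k"
          by (rule L2_inner_abs_series[OF sm sm km km g g])
        moreover have "(\<lambda>m. ?l n ^ m * cnj (?l n ^ m)) sums (1 / (1 - of_real ((\<Lambda> n)\<^sup>2)))"
        proof -
          have "norm (of_real ((\<Lambda> n)\<^sup>2) :: complex) < 1"
            using L[of n] power_strict_mono[of "\<Lambda> n" 1 2] by (simp del: of_real_power)
          from geometric_sums[OF this] show ?thesis
            by (simp add: power_mult_distrib power2_eq_square)
        qed
        ultimately have "L2_inner ?k ?k = 1 / (1 - of_real ((\<Lambda> n)\<^sup>2))" by (rule sums_unique2)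
        moreover have "L2_inner ?k ?k = of_real (LINT \<xi>|circle_measure. (norm (?k \<xi>))\<^sup>2)"
          unfolding L2_inner_def complex_norm_square[symmetric] by (rule integral_complex_of_real)
        ultimately have "complex_of_real (LINT \<xi>|circle_measure. (norm (?k \<xi>))\<^sup>2) = of_real (1 / (1 - (\<Lambda> n)\<^sup>2))"
          by simp
        then have kI: "(LINT \<xi>|circle_measure. (norm (?k \<xi>))\<^sup>2) = 1 / (1 - (\<Lambda> n)\<^sup>2)"
          by (simp only: of_real_eq_iff)
        have "(LINT \<xi>|circle_measure. (norm (bdry \<psi> \<xi>))\<^sup>2) \<le> (LINT \<xi>|circle_measure. (norm (?k \<xi>))\<^sup>2)"
        proof (rule integral_mono_AE)
          show "AE \<xi> in circle_measure. (norm (bdry \<psi> \<xi>))\<^sup>2 \<le> (norm (?k \<xi>))\<^sup>2"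
            using AE_radial_limit[OF \<psi>H]
          proof eventually_elim
            case (elim \<xi>)
            have k: "((\<lambda>r. norm (1 / (1 - ?l n * (of_real r * \<xi>)))) \<longlongrightarrow> norm (1 / (1 - ?l n * (of_real 1 * \<xi>)))) (at_left 1)"
              using nz[of \<xi>] elim by (intro tendsto_intros) auto
            have p: "((\<lambda>r. norm (\<psi> (of_real r * \<xi>))) \<longlongrightarrow> norm (bdry \<psi> \<xi>)) (at_left 1)"
              using elim by (intro tendsto_norm) auto
            have "norm (bdry \<psi> \<xi>) \<le> norm (1 / (1 - ?l n * (of_real 1 * \<xi>)))"
            proof (rule tendsto_le[OF _ k p])
              show "\<forall>\<^sub>F r in at_left 1. norm (\<psi> (of_real r * \<xi>)) \<le> norm (1 / (1 - ?l n * (of_real r * \<xi>)))"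
                using eventually_at_left_real[of 0 "1::real", OF zero_less_one]
              proof eventually_elim
                case (elim r)
                then show ?case using b1[of "of_real r * \<xi>" n]
                  by (auto simp: \<psi>_def norm_divide intro!: divide_right_mono)
              qed
            qed simp
            then show ?case by (intro power_mono) auto
          qed
        qed (use ks bdry_square_integrable[OF \<psi>H] in \<open>auto simp: square_integrable_def\<close>)
        then have "L2_norm (bdry \<psi>) \<le> sqrt (1 / (1 - (\<Lambda> n)\<^sup>2))"
          unfolding L2_norm_def kI by (rule real_sqrt_le_mono)
        then show ?thesis by (simp add: real_sqrt_divide)
      qed
      then have "L2_norm (bdry g) * L2_norm (bdry \<psi>) \<le> L2_norm (bdry g) * (1 / ?s n)"
        by (intro mult_left_mono L2_norm_nonneg)
      with L2_Cauchy_Schwarz(2)[OF bdry_square_integrable[OF gH] bdry_square_integrable[OF \<psi>H]] show ?thesis by linarith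
    qed
    ultimately have "norm (L2_inner (bdry f) (bdry \<psi>)) \<le> norm (\<phi> (?l n)) * (L2_norm (bdry g) * (1 / ?s n))"
      by (simp only: norm_mult complex_mod_cnj) (rule mult_left_mono, auto)
    moreover have "norm (L2_inner (bdry f) (bdry \<psi>)) = norm (a n) * ?s n * norm (\<psi> (?l n))"
      unfolding fpsi norm_mult complex_mod_cnj norm_of_real using s(1)[of n] by simp
    ultimately have e1: "norm (a n) * ?s n * norm (\<psi> (?l n)) \<le> norm (\<phi> (?l n)) * (L2_norm (bdry g) * (1 / ?s n))"
      by simp
    have e2: "norm (\<psi> (?l n)) = norm (b n (?l n)) / (?s n * ?s n)"
    proof -
      have "1 - ?l n * ?l n = of_real (?s n * ?s n)" unfolding s(2) by (simp add: power2_eq_square)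
      then have "norm (1 - ?l n * ?l n) = ?s n * ?s n" using s(1)[of n] by (simp only: norm_of_real abs_of_pos mult_pos_pos)
      then show ?thesis using l[of n] by (simp add: \<psi>_def norm_divide)
    qed
    have cancel: "x * y \<le> u * v" if "x * t * (y / (t * t)) \<le> u * (v * (1 / t))" "0 < t" for x y u v t :: real
    proof -
      have "x * y / t \<le> u * v / t" using that by simp
      then show ?thesis using that(2) by (simp add: divide_le_cancel)
    qed
    have "norm (a n) * norm (b n (?l n)) \<le> norm (\<phi> (?l n)) * L2_norm (bdry g)"
      by (rule cancel[OF e1[unfolded e2] s(1)])
    moreover have "norm (a n) * \<delta> \<le> norm (a n) * norm (b n (?l n))" by (intro mult_left_mono b\<delta>) auto
    ultimately have "norm (a n) * \<delta> \<le> L2_norm (bdry g) * norm (\<phi> (?l n))" by (simp add: mult.commute)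
    then show ?thesis using \<delta> by (simp add: field_simps)
  qed
  then show ?thesis by blast
qed

section \<open>Exponential decay of coefficients\<close>

text \<open>\<open>g\<close> is built from its Taylor coefficients: \<open>c N\<close> is the sum
  over \<open>n\<close> of the \<open>N\<close>-th coefficients of the kernels. The two summability
  hypotheses dominate the double series, so that summation over \<open>n\<close> and pairing with
  \<open>k\<close> may be interchanged.\<close>

lemma kernel_series_exists:
  fixes l :: "nat \<Rightarrow> real"
  assumes l: "\<And>n. 0 < l n" "\<And>n. l n < 1"
    and sm: "\<And>N. summable (\<lambda>n. norm (b n) * sqrt (1 - (l n)\<^sup>2) * l n ^ N)"
    and smm: "summable (\<lambda>N. \<Sum>n. norm (b n) * sqrt (1 - (l n)\<^sup>2) * l n ^ N)"
  obtains g where "g \<in> H2"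
    "\<And>k. k \<in> H2 \<Longrightarrow> (\<lambda>n. b n * of_real (sqrt (1 - (l n)\<^sup>2)) * cnj (k (of_real (l n)))) sums L2_inner (bdry g) (bdry k)"
proof -
  let ?s = "\<lambda>n. sqrt (1 - (l n)\<^sup>2)"
  have s: "0 \<le> ?s n" for n using l[of n] by (simp add: abs_square_le_1)
  let ?C = "\<lambda>N. \<Sum>n. norm (b n) * ?s n * l n ^ N"
  let ?t = "\<lambda>N n. b n * of_real (?s n) * of_real (l n) ^ N"
  have nt: "norm (?t N n) = norm (b n) * ?s n * l n ^ N" for N n
    using s[of n] l[of n] by (simp add: norm_mult norm_power)
  have smt: "summable (\<lambda>n. norm (?t N n))" for N unfolding nt by (rule sm)
  define c where "c N = (\<Sum>n. ?t N n)" for N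
  have part: "norm (\<Sum>n<M. ?t N n) \<le> ?C N" for M N
  proof -
    have "norm (\<Sum>n<M. ?t N n) \<le> (\<Sum>n<M. norm (?t N n))" by (rule norm_sum)
    also have "\<dots> \<le> (\<Sum>n. norm (?t N n))" by (rule sum_le_suminf[OF smt]) auto
    finally show ?thesis unfolding nt .
  qed
  have clim: "(\<lambda>M. \<Sum>n<M. ?t N n) \<longlonglongrightarrow> c N" for N
    unfolding c_def by (rule summable_LIMSEQ[OF summable_norm_cancel[OF smt]])
  have cC: "norm (c N) \<le> ?C N" for N
    by (rule tendsto_upperbound[OF tendsto_norm[OF clim]]) (use part in auto)
  have C0: "0 \<le> ?C N" for N using cC[of N] norm_ge_zero order_trans by blast
  obtain M where M: "\<And>N. ?C N \<le> M"
    using convergent_imp_Bseq[OF convergentI[OF summable_LIMSEQ_zero[OF smm]]] C0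
    unfolding Bseq_def real_norm_def by (metis abs_of_nonneg)
  have csq: "summable (\<lambda>N. (norm (c N))\<^sup>2)"
  proof (rule summable_comparison_test'[OF summable_mult[OF smm, of M]])
    fix N
    have "norm (c N) * norm (c N) \<le> M * ?C N"
      using cC[of N] M[of N] C0[of N] by (intro mult_mono) auto
    then show "norm ((norm (c N))\<^sup>2) \<le> M * ?C N" by (simp add: power2_eq_square)
  qed
  have gH: "disk_series c \<in> H2" by (rule disk_series_H2[OF csq])
  have tg: "taylor (disk_series c) N = c N" for N by (rule taylor_disk_series[OF Bseq_square_summable[OF csq]])
  show ?thesis
  proof (rule that[OF gH])
    fix k assume k: "k \<in> H2"
    obtain K where K: "\<And>N. norm (taylor k N) \<le> K"
      using Bseq_square_summable[OF H2_summable[OF k]] unfolding Bseq_def by blast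
    let ?a = "\<lambda>N M. (\<Sum>n<M. ?t N n) * cnj (taylor k N)"
    \<comment> \<open>Tannery's theorem in the number \<open>M\<close> of kernels; the terms are
      dominated by \<open>?C N * K\<close> because the Taylor coefficients of \<open>k\<close> are
      bounded.\<close>
    have "(\<lambda>M. suminf (\<lambda>N. ?a N M)) \<longlonglongrightarrow> (\<Sum>N. c N * cnj (taylor k N))"
    proof (rule tannerys_theorem[THEN conjunct2, THEN conjunct2])
      show "(\<lambda>M. ?a N M) \<longlonglongrightarrow> c N * cnj (taylor k N)" for N by (intro tendsto_intros clim)
      have "norm (?a N M) \<le> ?C N * K" for N M
        unfolding norm_mult complex_mod_cnj by (intro mult_mono part K C0) simp
      then show "\<forall>\<^sub>F (N, M) in at_top \<times>\<^sub>F sequentially. norm (?a N M) \<le> ?C N * K"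
        by (intro always_eventually) auto
      show "summable (\<lambda>N. ?C N * K)" by (rule summable_mult2[OF smm])
    qed simp
    also have "(\<lambda>M. suminf (\<lambda>N. ?a N M)) = (\<lambda>M. \<Sum>n<M. b n * of_real (?s n) * cnj (k (of_real (l n))))"
    proof
      fix M
      have "(\<lambda>N. \<Sum>n<M. ?t N n * cnj (taylor k N)) sums (\<Sum>n<M. b n * of_real (?s n) * cnj (k (of_real (l n))))"
      proof (rule sums_sum)
        fix n
        have "(\<lambda>N. cnj (taylor k N * of_real (l n) ^ N)) sums cnj (k (of_real (l n)))"
          unfolding sums_cnj by (rule analytic_disk_taylor_sums[OF H2_analytic[OF k]]) (use l[of n] in simp)
        from sums_mult[OF this, of "b n * of_real (?s n)"]
        show "(\<lambda>N. ?t N n * cnj (taylor k N)) sums (b n * of_real (?s n) * cnj (k (of_real (l n))))"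
          by (simp add: mult_ac)
      qed
      then show "suminf (\<lambda>N. ?a N M) = (\<Sum>n<M. b n * of_real (?s n) * cnj (k (of_real (l n))))"
        by (simp add: sums_iff sum_distrib_right)
    qed
    also have "(\<Sum>N. c N * cnj (taylor k N)) = L2_inner (bdry (disk_series c)) (bdry k)"
      using H2_inner_sums[OF gH k] by (simp add: tg sums_iff)
    finally show "(\<lambda>n. b n * of_real (?s n) * cnj (k (of_real (l n)))) sums L2_inner (bdry (disk_series c)) (bdry k)"
      by (simp add: sums_def)
  qed
qed

section \<open>Elementary estimates with exponentials\<close>

lemma bound_from_eventually:
  fixes x e :: "nat \<Rightarrow> real"
  assumes "eventually (\<lambda>n. x n \<le> C * e n) sequentially" "\<And>n. 0 < e n"
  obtains C' where "0 < C'" "\<And>n. x n \<le> C' * e n"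
proof -
  obtain N where N: "\<And>n. n \<ge> N \<Longrightarrow> x n \<le> C * e n" using assms(1) by (auto simp: eventually_sequentially)
  define C' where "C' = \<bar>C\<bar> + (\<Sum>n<N. \<bar>x n\<bar> / e n) + 1"
  have S: "0 \<le> (\<Sum>n<N. \<bar>x n\<bar> / e n)" using assms(2) by (intro sum_nonneg) (auto simp: less_imp_le)
  have "x n \<le> C' * e n" for n
  proof (cases "n < N")
    case True
    have "\<bar>x n\<bar> / e n \<le> (\<Sum>n<N. \<bar>x n\<bar> / e n)"
      using True assms(2) by (intro member_le_sum) (auto simp: less_imp_le)
    then have "\<bar>x n\<bar> / e n \<le> C'" by (simp add: C'_def)
    then have "\<bar>x n\<bar> \<le> C' * e n" using assms(2)[of n] by (simp add: pos_divide_le_eq)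
    then show ?thesis by simp
  next
    case False
    have "C * e n \<le> C' * e n" using S assms(2)[of n] by (intro mult_right_mono) (auto simp: C'_def)
    with N[of n] False show ?thesis by simp
  qed
  moreover have "0 < C'" using S by (simp add: C'_def)
  ultimately show ?thesis using that by blast
qed

text \<open>Trades an exponential for a factor \<open>y\<close>, which for
  \<open>y = 1 - \<Lambda> n\<close> is summable by the Blaschke condition.\<close>

lemma exp_neg_inverse_le:
  fixes c y :: real assumes "0 < c" "0 < y"
  shows "exp (- c / y) \<le> y / c"
proof -
  have "c / y \<le> exp (c / y)" using exp_ge_add_one_self[of "c / y"] by linarith
  then have "inverse (exp (c / y)) \<le> inverse (c / y)" using assms by (intro le_imp_inverse_le) auto
  then show ?thesis by (simp add: exp_minus)
qed

lemma exp_neg_sqrt_summable: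
  assumes c: "0 < c" shows "summable (\<lambda>N. exp (- c * sqrt (real N)))"
proof (rule summable_comparison_test_ev)
  \<comment> \<open>\<open>256 = 4 ^ 4\<close>: the fourth power in
    \<open>exp x >= (x / 4) ^ 4\<close> turns \<open>sqrt N\<close> into
    \<open>N ^ 2\<close>.\<close>
  show "summable (\<lambda>N. (256 / c ^ 4) * inverse (real N ^ 2))"
    by (intro summable_mult inverse_power_summable) simp
  show "\<forall>\<^sub>F N in sequentially. norm (exp (- c * sqrt (real N))) \<le> (256 / c ^ 4) * inverse (real N ^ 2)"
    using eventually_gt_at_top[of 0]
  proof eventually_elim
    case (elim N)
    let ?x = "c * sqrt (real N)"
    have x: "0 < ?x" using c elim by simp
    have "(?x / 4) ^ 4 \<le> (1 + ?x / real 4) ^ 4" using x by (intro power_mono) auto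
    also have "\<dots> \<le> exp ?x" by (rule exp_ge_one_plus_x_over_n_power_n) (use x in auto)
    finally have "inverse (exp ?x) \<le> inverse ((?x / 4) ^ 4)"
      by (rule le_imp_inverse_le) (rule zero_less_power, rule divide_pos_pos[OF x], simp)
    moreover have "(sqrt (real N)) ^ 4 = real N ^ 2"
      using power_mult[of "sqrt (real N)" 2 2] by simp
    then have "inverse ((?x / 4) ^ 4) = (256 / c ^ 4) * inverse (real N ^ 2)"
      using c elim by (simp add: power_divide power_mult_distrib field_simps)
    ultimately show ?case by (simp add: exp_minus)
  qed
qed

text \<open>With \<open>y = 1 - l n\<close>, half of the exponent \<open>c / y\<close> is spent on a
  factor \<open>y\<close> that makes the sum over \<open>n\<close> finite. The other half joins
  \<open>l n ^ N <= exp (- N * y)\<close>, and the inequality of arithmetic and geometric means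
  gives \<open>(c / 2) / y + N * y >= sqrt (2 * c) * sqrt N\<close>.\<close>

lemma exponential_decay_sums:
  fixes l :: "nat \<Rightarrow> real"
  assumes l: "\<And>n. 0 < l n" "\<And>n. l n < 1" and sm: "summable (\<lambda>n. 1 - l n)"
    and b: "\<And>n. norm (b n) \<le> C * exp (- c / (1 - l n))" and c: "0 < c"
  shows "\<exists>K. \<forall>N. summable (\<lambda>n. norm (b n) * sqrt (1 - (l n)\<^sup>2) * l n ^ N) \<and>
    (\<Sum>n. norm (b n) * sqrt (1 - (l n)\<^sup>2) * l n ^ N) \<le> K * exp (- sqrt (2 * c) * sqrt (real N))"
proof -
  have C: "0 \<le> C" using order_trans[OF norm_ge_zero b[of 0]] by (simp add: zero_le_mult_iff)
  have key: "norm (b n) * sqrt (1 - (l n)\<^sup>2) * l n ^ N \<le> (C * 2 / c * exp (- sqrt (2 * c) * sqrt (real N))) * (1 - l n)" for n N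
  proof -
    define y where "y = 1 - l n"
    have y: "0 < y" "y < 1" using l[of n] by (auto simp: y_def)
    have s: "sqrt (1 - (l n)\<^sup>2) \<le> 1" "0 \<le> sqrt (1 - (l n)\<^sup>2)" using l[of n] by (auto simp: abs_square_le_1)
    have "l n \<le> exp (- y)" using exp_ge_add_one_self[of "- y"] by (simp add: y_def)
    then have "l n ^ N \<le> exp (- y) ^ N" using l[of n] by (intro power_mono) auto
    also have "\<dots> = exp (- (real N * y))" by (simp add: exp_of_nat_mult[symmetric])
    finally have lN: "l n ^ N \<le> exp (- (real N * y))" .
    have "norm (b n) * sqrt (1 - (l n)\<^sup>2) * l n ^ N \<le> (C * exp (- c / y)) * 1 * exp (- (real N * y))"
      using b[of n] s lN l[of n] C unfolding y_def[symmetric] by (intro mult_mono) auto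
    also have "\<dots> = C * exp (- (c / 2) / y) * exp (- ((c / 2) / y + real N * y))"
      by (simp add: mult.assoc flip: exp_add)
    also have "\<dots> \<le> C * (y / (c / 2)) * exp (- sqrt (2 * c) * sqrt (real N))"
    proof (intro mult_mono mult_left_mono)
      show "exp (- (c / 2) / y) \<le> y / (c / 2)" by (rule exp_neg_inverse_le) (use c y in auto)
      have "sqrt (2 * c) * sqrt (real N) \<le> (c / 2) / y + real N * y"
      proof -
        have "sqrt (((c / 2) / y) * (real N * y)) \<le> ((c / 2) / y + real N * y) / 2"
          by (rule arith_geo_mean_sqrt) (use c y in auto)
        moreover have "((c / 2) / y) * (real N * y) = (2 * c) * real N / 4" using y by simp
        ultimately have "sqrt ((2 * c) * real N / 4) \<le> ((c / 2) / y + real N * y) / 2" by (simp only:)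
        moreover have "sqrt ((2 * c) * real N / 4) = sqrt (2 * c) * sqrt (real N) / 2"
          unfolding real_sqrt_divide real_sqrt_mult[of "2 * c" "real N"] by simp
        ultimately show ?thesis by simp
      qed
      then show "exp (- ((c / 2) / y + real N * y)) \<le> exp (- sqrt (2 * c) * sqrt (real N))" by simp
    qed (use C c y in auto)
    also have "\<dots> = (C * 2 / c * exp (- sqrt (2 * c) * sqrt (real N))) * y" by simp
    finally show ?thesis by (simp only: y_def)
  qed
  have nn: "0 \<le> norm (b n) * sqrt (1 - (l n)\<^sup>2) * l n ^ N" for n N
    using l[of n] by (intro mult_nonneg_nonneg) (auto simp: abs_square_le_1)
  have sb: "summable (\<lambda>n. D * (1 - l n))" for D :: real by (rule summable_mult[OF sm])
  have S: "summable (\<lambda>n. norm (b n) * sqrt (1 - (l n)\<^sup>2) * l n ^ N)" for N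
    by (rule summable_comparison_test'[OF sb]) (use key nn in \<open>simp only: real_norm_def abs_of_nonneg\<close>)
  have "(\<Sum>n. norm (b n) * sqrt (1 - (l n)\<^sup>2) * l n ^ N) \<le> (C * 2 / c * (\<Sum>n. 1 - l n)) * exp (- sqrt (2 * c) * sqrt (real N))" for N
  proof -
    have "(\<Sum>n. norm (b n) * sqrt (1 - (l n)\<^sup>2) * l n ^ N) \<le> (\<Sum>n. (C * 2 / c * exp (- sqrt (2 * c) * sqrt (real N))) * (1 - l n))"
      by (rule suminf_le[OF key S sb])
    also have "\<dots> = (C * 2 / c * exp (- sqrt (2 * c) * sqrt (real N))) * (\<Sum>n. 1 - l n)"
      by (rule suminf_mult[OF sm])
    finally show ?thesis by (simp add: mult_ac)
  qed
  with S show ?thesis by blast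
qed

text \<open>Pairing \<open>f\<close> with \<open>z ^ N\<close> identifies the sums in condition (iv)
  as Taylor coefficients of \<open>f\<close>.\<close>

lemma kernel_series_taylor:
  fixes l :: "nat \<Rightarrow> real"
  assumes l: "\<And>n. 0 < l n" "\<And>n. l n < 1"
    and f: "H2_sums (\<lambda>n z. a n * cauchy_kernel (complex_of_real (l n)) z) f"
  shows "(\<lambda>n. a n * of_real (sqrt (1 - (l n)\<^sup>2)) * of_real (l n) ^ N) sums taylor f N"
proof -
  have fH: "f \<in> H2" using f by (simp add: H2_sums_def)
  let ?e = "disk_series (\<lambda>m. if m = N then 1 else 0)"
  have nl: "norm (complex_of_real (l n)) < 1" for n using l[of n] by simp
  have e: "?e (of_real (l n)) = of_real (l n) ^ N" for n
  proof -
    have "(\<lambda>m. taylor ?e m * of_real (l n) ^ m) sums ?e (of_real (l n))"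
      by (rule analytic_disk_taylor_sums[OF H2_analytic[OF H2_monom] nl])
    moreover have "(\<lambda>m. taylor ?e m * of_real (l n) ^ m) sums (\<Sum>m\<in>{N}. taylor ?e m * of_real (l n) ^ m)"
      by (rule sums_finite) (simp_all add: taylor_monom)
    ultimately show ?thesis by (simp add: taylor_monom sums_iff)
  qed
  have "(\<lambda>n. a n * of_real (sqrt (1 - (norm (complex_of_real (l n)))\<^sup>2)) * cnj (?e (of_real (l n)))) sums L2_inner (bdry f) (bdry ?e)"
    by (rule H2_sums_inner[OF nl f H2_monom])
  moreover have "L2_inner (bdry f) (bdry ?e) = taylor f N"
    using H2_inner_sums[OF fH H2_monom[of N]] unfolding taylor_monom by (rule sums_unique2[OF _ sums_cnj_delta])
  ultimately show ?thesis by (simp add: e)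
qed

text \<open>The radius in Cauchy's estimate is taken with \<open>1 - r\<close> of order \<open>\<epsilon> / sqrt N\<close>.\<close>

lemma taylor_growth:
  fixes G :: "complex \<Rightarrow> complex" and \<epsilon> :: real
  assumes hol: "G holomorphic_on ball 0 1" and \<epsilon>: "0 < \<epsilon>"
    and G: "\<And>z. norm z < 1 \<Longrightarrow> norm (G z) \<le> exp (\<epsilon>\<^sup>2 / (1 - norm z))"
  shows "norm (taylor G N) \<le> exp (4 * \<epsilon>\<^sup>2) * exp (2 * \<epsilon> * sqrt (real N))"
proof -
  \<comment> \<open>The term \<open>2 * \<epsilon>\<close> keeps \<open>x <= 1 / 2\<close>, as the
    lower bound for \<open>ln (1 - x)\<close> requires, and covers \<open>N = 0\<close>. In the
    exponent, \<open>\<epsilon>^2 / x\<close> equals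
    \<open>\<epsilon> * sqrt N + 2 * \<epsilon>^2\<close>, and \<open>- N * ln r\<close> is at most
    the same amount.\<close>
  define x where "x = \<epsilon> / (sqrt (real N) + 2 * \<epsilon>)"
  define r where "r = 1 - x"
  have d: "0 < sqrt (real N) + 2 * \<epsilon>" using \<epsilon> by (simp add: add_nonneg_pos)
  have x0: "0 < x" using \<epsilon> d by (simp add: x_def)
  have x2: "x \<le> 1 / 2" using d \<epsilon> by (simp add: x_def pos_divide_le_eq)
  have r: "0 < r" "r < 1" using x0 x2 by (auto simp: r_def)
  have "norm ((deriv ^^ N) G 0) \<le> fact N * exp (\<epsilon>\<^sup>2 / (1 - r)) / r ^ N"
  proof (rule Cauchy_inequality)
    have sub: "cball 0 r \<subseteq> ball (0::complex) 1" using r by auto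
    show "continuous_on (cball 0 r) G"
      by (rule continuous_on_subset[OF holomorphic_on_imp_continuous_on[OF hol] sub])
    show "G holomorphic_on ball 0 r" by (rule holomorphic_on_subset[OF hol]) (use r in auto)
    show "norm (G z) \<le> exp (\<epsilon>\<^sup>2 / (1 - r))" if "norm (0 - z) = r" for z
      using G[of z] that r by simp
  qed (use r in auto)
  then have "norm (taylor G N) \<le> exp (\<epsilon>\<^sup>2 / x) / r ^ N"
    by (simp add: taylor_def norm_divide r_def field_simps)
  also have "\<dots> = exp (\<epsilon>\<^sup>2 / x - real N * ln r)"
    using r by (simp add: exp_diff exp_of_nat_mult)
  also have "\<dots> \<le> exp (4 * \<epsilon>\<^sup>2 + 2 * \<epsilon> * sqrt (real N))"
  proof -
    have "- x - 2 * x\<^sup>2 \<le> ln r" unfolding r_def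
      by (rule ln_one_minus_pos_lower_bound) (use x0 x2 in auto)
    then have "- (real N * ln r) \<le> real N * x + 2 * (real N * x\<^sup>2)"
      using mult_left_mono[of "- ln r" "x + 2 * x\<^sup>2" "real N"] by (simp add: algebra_simps)
    moreover have Nx: "sqrt (real N) * x \<le> \<epsilon>"
    proof -
      have "sqrt (real N) * \<epsilon> \<le> \<epsilon> * (sqrt (real N) + 2 * \<epsilon>)" using \<epsilon> by (simp add: algebra_simps)
      then show ?thesis using d by (simp add: x_def pos_divide_le_eq)
    qed
    have "real N * x \<le> \<epsilon> * sqrt (real N)"
    proof -
      have "real N * x = sqrt (real N) * (sqrt (real N) * x)" by (simp flip: mult.assoc)
      also have "\<dots> \<le> sqrt (real N) * \<epsilon>" by (rule mult_left_mono[OF Nx]) simp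
      finally show ?thesis by (simp add: mult.commute)
    qed
    moreover have "real N * x\<^sup>2 \<le> \<epsilon>\<^sup>2"
    proof -
      have "(sqrt (real N) * x)\<^sup>2 \<le> \<epsilon>\<^sup>2" using Nx x0 by (intro power_mono) auto
      then show ?thesis by (simp add: power_mult_distrib)
    qed
    moreover have "\<epsilon>\<^sup>2 / x = \<epsilon> * sqrt (real N) + 2 * \<epsilon>\<^sup>2"
      using \<epsilon> d by (simp add: x_def power2_eq_square field_simps)
    ultimately show ?thesis by simp
  qed
  finally show ?thesis by (simp add: exp_add)
qed

text \<open>\<open>exp (\<epsilon>^2 / (1 - z))\<close> is unbounded on the disk. The dilation by
  \<open>\<rho> < 1\<close> makes the test function bounded, while the estimate of its Taylor
  coefficients, hence of the pairing with \<open>f\<close>, is uniform in \<open>\<rho>\<close>. The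
  factor \<open>b n\<close> removes all terms but the \<open>n\<close>-th.\<close>

lemma coefficient_decay_from_taylor_decay:
  assumes B: "interpolating_Blaschke_product (\<lambda>n. complex_of_real (\<Lambda> n)) B" and \<Lambda>: "range \<Lambda> \<subseteq> {0<..<1}"
    and f: "H2_sums (\<lambda>n z. a n * cauchy_kernel (complex_of_real (\<Lambda> n)) z) f"
    and c: "0 < c" and tf: "\<And>N. norm (taylor f N) \<le> K * exp (- c * sqrt (real N))"
  shows "\<exists>C c. 0 < c \<and> (\<forall>n. (norm (a n))\<^sup>2 \<le> C * exp (- c / (1 - \<Lambda> n)))"
proof -
  let ?l = "\<lambda>n. complex_of_real (\<Lambda> n)"
  let ?s = "\<lambda>n. sqrt (1 - (\<Lambda> n)\<^sup>2)"
  have L: "0 < \<Lambda> n" "\<Lambda> n < 1" for n using subsetD[OF \<Lambda> rangeI[of \<Lambda> n]] by auto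
  have l: "norm (?l n) < 1" and ln: "norm (?l n) = \<Lambda> n" for n using L[of n] by auto
  have fH: "f \<in> H2" using f by (simp add: H2_sums_def)
  from Blaschke_split[OF B \<Lambda>] obtain \<delta> :: real and b where \<delta>: "0 < \<delta>"
    and bhol: "\<And>n. b n holomorphic_on ball 0 1" and b1: "\<And>n z. norm z < 1 \<Longrightarrow> norm (b n z) \<le> 1"
    and b\<delta>: "\<And>n. \<delta> \<le> norm (b n (?l n))" and b0: "\<And>m n. m \<noteq> n \<Longrightarrow> b n (?l m) = 0" by metis
  \<comment> \<open>The coefficients of the test function grow at most like
    \<open>exp (2 * \<epsilon> * sqrt N)\<close>; this choice leaves half of the decay of
    \<open>f\<close> for the sum over \<open>N\<close>.\<close>
  define \<epsilon> where "\<epsilon> = c / 4"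
  have \<epsilon>: "0 < \<epsilon>" using c by (simp add: \<epsilon>_def)
  define M where "M = (\<Sum>N. K * exp (4 * \<epsilon>\<^sup>2) * exp (- (c / 2) * sqrt (real N)))"
  have K: "0 \<le> K" using order_trans[OF norm_ge_zero tf[of 0]] by simp
  have sM: "summable (\<lambda>N. K * exp (4 * \<epsilon>\<^sup>2) * exp (- (c / 2) * sqrt (real N)))"
    by (intro summable_mult exp_neg_sqrt_summable) (use c in simp)
  have main: "norm (a n) * ?s n * (\<delta> * exp (\<epsilon>\<^sup>2 / (1 - \<rho> * \<Lambda> n))) \<le> M" if \<rho>: "0 < \<rho>" "\<rho> < 1" for \<rho> n
  proof -
    let ?E = "\<lambda>z. b n z * exp (of_real (\<epsilon>\<^sup>2) / (1 - of_real \<rho> * z))"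
    define G where "G = (\<lambda>z. if norm z < 1 then ?E z else 0)"
    have low: "1 - \<rho> * norm z \<le> norm (1 - of_real \<rho> * z)" for z :: complex
      using norm_triangle_ineq2[of 1 "of_real \<rho> * z"] \<rho> by (simp add: norm_mult)
    have pos: "0 < 1 - \<rho> * norm z" if "norm z < 1" for z :: complex
      using mult_strict_mono[of \<rho> 1 "norm z" 1] that \<rho> by simp
    have Ehol: "?E holomorphic_on ball 0 1"
    proof (intro holomorphic_intros bhol)
      fix z :: complex assume "z \<in> ball 0 1"
      then show "1 - of_real \<rho> * z \<noteq> 0" using low[of z] pos[of z] by auto
    qed
    have nE: "norm (?E z) \<le> exp (\<epsilon>\<^sup>2 / (1 - \<rho> * norm z))" if z: "norm z < 1" for z
    proof -
      have "Re (of_real (\<epsilon>\<^sup>2) / (1 - of_real \<rho> * z)) \<le> norm (of_real (\<epsilon>\<^sup>2) / (1 - of_real \<rho> * z))"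
        by (rule complex_Re_le_cmod)
      also have "\<dots> = \<epsilon>\<^sup>2 / norm (1 - of_real \<rho> * z)"
        unfolding norm_divide norm_of_real by simp
      also have "\<dots> \<le> \<epsilon>\<^sup>2 / (1 - \<rho> * norm z)" using low[of z] pos[OF z] by (intro frac_le) auto
      finally have "norm (exp (of_real (\<epsilon>\<^sup>2) / (1 - of_real \<rho> * z))) \<le> exp (\<epsilon>\<^sup>2 / (1 - \<rho> * norm z))"
        by (simp only: norm_exp_eq_Re exp_le_cancel_iff)
      then have "norm (b n z) * norm (exp (of_real (\<epsilon>\<^sup>2) / (1 - of_real \<rho> * z))) \<le> 1 * exp (\<epsilon>\<^sup>2 / (1 - \<rho> * norm z))"
        using b1[OF z] by (intro mult_mono) auto
      then show ?thesis by (simp only: norm_mult mult_1)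
    qed
    have GHinf: "G \<in> Hinf" unfolding G_def
    proof (rule HinfI[OF Ehol])
      fix z :: complex assume z: "norm z < 1"
      have "\<epsilon>\<^sup>2 / (1 - \<rho> * norm z) \<le> \<epsilon>\<^sup>2 / (1 - \<rho>)"
        using \<rho> z mult_left_mono[of "norm z" 1 \<rho>] by (intro frac_le) auto
      then have "exp (\<epsilon>\<^sup>2 / (1 - \<rho> * norm z)) \<le> exp (\<epsilon>\<^sup>2 / (1 - \<rho>))" by simp
      with nE[OF z] show "norm (?E z) \<le> exp (\<epsilon>\<^sup>2 / (1 - \<rho>))" by (rule order_trans)
    qed
    note GH = Hinf_subset_H2[OF GHinf]
    have tG: "norm (taylor G N) \<le> exp (4 * \<epsilon>\<^sup>2) * exp (2 * \<epsilon> * sqrt (real N))" for N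
    proof (rule taylor_growth[OF analytic_disk_holomorphic[OF Hinf_analytic[OF GHinf]] \<epsilon>])
      fix z :: complex assume z: "norm z < 1"
      have "1 - norm z \<le> 1 - \<rho> * norm z" using \<rho> mult_right_mono[of \<rho> 1 "norm z"] by simp
      then have "\<epsilon>\<^sup>2 / (1 - \<rho> * norm z) \<le> \<epsilon>\<^sup>2 / (1 - norm z)" using z by (intro frac_le) auto
      then have "exp (\<epsilon>\<^sup>2 / (1 - \<rho> * norm z)) \<le> exp (\<epsilon>\<^sup>2 / (1 - norm z))" by simp
      with nE[OF z] have "norm (?E z) \<le> exp (\<epsilon>\<^sup>2 / (1 - norm z))" by (rule order_trans)
      then show "norm (G z) \<le> exp (\<epsilon>\<^sup>2 / (1 - norm z))" using z by (simp only: G_def if_True)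
    qed
    have tb: "norm (taylor f N * cnj (taylor G N)) \<le> K * exp (4 * \<epsilon>\<^sup>2) * exp (- (c / 2) * sqrt (real N))" for N
    proof -
      have "norm (taylor f N * cnj (taylor G N)) \<le> (K * exp (- c * sqrt (real N))) * (exp (4 * \<epsilon>\<^sup>2) * exp (2 * \<epsilon> * sqrt (real N)))"
        unfolding norm_mult complex_mod_cnj using tf[of N] tG[of N] K by (intro mult_mono) auto
      also have "\<dots> = K * exp (4 * \<epsilon>\<^sup>2) * (exp (- c * sqrt (real N)) * exp (2 * \<epsilon> * sqrt (real N)))" by (simp only: mult_ac)
      also have "exp (- c * sqrt (real N)) * exp (2 * \<epsilon> * sqrt (real N)) = exp (- (c / 2) * sqrt (real N))"
        unfolding exp_add[symmetric] \<epsilon>_def by (simp add: field_simps)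
      finally show ?thesis .
    qed
    have sT: "summable (\<lambda>N. norm (taylor f N * cnj (taylor G N)))"
      by (rule summable_comparison_test'[OF sM]) (use tb in simp)
    have "norm (L2_inner (bdry f) (bdry G)) \<le> M"
    proof -
      have "L2_inner (bdry f) (bdry G) = (\<Sum>N. taylor f N * cnj (taylor G N))"
        by (rule sums_unique[OF H2_inner_sums[OF fH GH]])
      also have "norm \<dots> \<le> (\<Sum>N. norm (taylor f N * cnj (taylor G N)))" by (rule summable_norm[OF sT])
      also have "\<dots> \<le> M" unfolding M_def by (rule suminf_le[OF tb sT sM])
      finally show ?thesis .
    qed
    moreover have "L2_inner (bdry f) (bdry G) = a n * of_real (?s n) * cnj (G (?l n))"
    proof -
      have 1: "(\<lambda>m. a m * of_real (?s m) * cnj (G (?l m))) sums L2_inner (bdry f) (bdry G)"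
        using H2_sums_inner[OF l f GH] by (simp only: ln)
      have 2: "a m * of_real (?s m) * cnj (G (?l m)) = 0" if "m \<noteq> n" for m
        using b0[OF that] by (simp add: G_def)
      have "(\<lambda>m. a m * of_real (?s m) * cnj (G (?l m))) sums (a n * of_real (?s n) * cnj (G (?l n)))"
        using sums_finite[of "{n}" "\<lambda>m. a m * of_real (?s m) * cnj (G (?l m))"] 2 by simp
      with 1 show ?thesis by (rule sums_unique2)
    qed
    moreover have "0 \<le> ?s n" using L[of n] by (simp add: abs_square_le_1)
    ultimately have "norm (a n) * ?s n * norm (G (?l n)) \<le> M"
      by (simp only: norm_mult complex_mod_cnj norm_of_real abs_of_nonneg)
    moreover have "\<delta> * exp (\<epsilon>\<^sup>2 / (1 - \<rho> * \<Lambda> n)) \<le> norm (G (?l n))"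
    proof -
      have "of_real (\<epsilon>\<^sup>2) / (1 - of_real \<rho> * ?l n) = complex_of_real (\<epsilon>\<^sup>2 / (1 - \<rho> * \<Lambda> n))" by simp
      then have "G (?l n) = b n (?l n) * of_real (exp (\<epsilon>\<^sup>2 / (1 - \<rho> * \<Lambda> n)))"
        using l[of n] by (simp only: G_def exp_of_real if_True)
      then have "norm (G (?l n)) = norm (b n (?l n)) * exp (\<epsilon>\<^sup>2 / (1 - \<rho> * \<Lambda> n))"
        by (simp only: norm_mult norm_of_real abs_exp_cancel)
      with b\<delta>[of n] show ?thesis by (simp add: mult_right_mono)
    qed
    then have "norm (a n) * ?s n * (\<delta> * exp (\<epsilon>\<^sup>2 / (1 - \<rho> * \<Lambda> n))) \<le> norm (a n) * ?s n * norm (G (?l n))"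
      using \<open>0 \<le> ?s n\<close> by (intro mult_left_mono) auto
    ultimately show ?thesis by linarith
  qed
  have lim: "norm (a n) * ?s n * (\<delta> * exp (\<epsilon>\<^sup>2 / (1 - \<Lambda> n))) \<le> M" for n
  proof (rule tendsto_upperbound)
    have "((\<lambda>\<rho>. norm (a n) * ?s n * (\<delta> * exp (\<epsilon>\<^sup>2 / (1 - \<rho> * \<Lambda> n)))) \<longlongrightarrow> norm (a n) * ?s n * (\<delta> * exp (\<epsilon>\<^sup>2 / (1 - 1 * \<Lambda> n)))) (at_left 1)"
      using L[of n] by (intro tendsto_intros) auto
    then show "((\<lambda>\<rho>. norm (a n) * ?s n * (\<delta> * exp (\<epsilon>\<^sup>2 / (1 - \<rho> * \<Lambda> n)))) \<longlongrightarrow> norm (a n) * ?s n * (\<delta> * exp (\<epsilon>\<^sup>2 / (1 - \<Lambda> n)))) (at_left 1)"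
      by simp
    show "\<forall>\<^sub>F \<rho> in at_left 1. norm (a n) * ?s n * (\<delta> * exp (\<epsilon>\<^sup>2 / (1 - \<rho> * \<Lambda> n))) \<le> M"
      using eventually_at_left_real[of 0 "1::real", OF zero_less_one]
      by eventually_elim (rule main, auto)
  qed simp
  \<comment> \<open>With \<open>X = exp (\<epsilon>^2 / y)\<close>, squaring the limit bound and
    using \<open>(s n)^2 >= y\<close> bounds \<open>|a n|^2 * y * X^2\<close>. One of the two
    factors \<open>X\<close> is given up through \<open>y * X >= \<epsilon>^2\<close> in order to
    remove \<open>y\<close>.\<close>
  have "(norm (a n))\<^sup>2 \<le> (M / \<delta>)\<^sup>2 / \<epsilon>\<^sup>2 * exp (- \<epsilon>\<^sup>2 / (1 - \<Lambda> n))" for n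
  proof -
    define y where "y = 1 - \<Lambda> n"
    define X where "X = exp (\<epsilon>\<^sup>2 / y)"
    have y: "0 < y" using L[of n] by (simp add: y_def)
    have X: "0 < X" by (simp add: X_def)
    have s2: "(?s n)\<^sup>2 = 1 - (\<Lambda> n)\<^sup>2" using L[of n] by (simp add: abs_square_le_1)
    have "y \<le> 1 - (\<Lambda> n)\<^sup>2" using L[of n] mult_left_mono[of "\<Lambda> n" 1 "\<Lambda> n"] by (simp add: y_def power2_eq_square)
    with s2 have sy: "y \<le> (?s n)\<^sup>2" by simp
    have "norm (a n) * ?s n * X \<le> M / \<delta>"
      using lim[of n] \<delta> by (simp add: X_def y_def field_simps)
    then have "(norm (a n) * ?s n * X)\<^sup>2 \<le> (M / \<delta>)\<^sup>2"
      using X L[of n] by (intro power_mono mult_nonneg_nonneg) (auto simp: abs_square_le_1)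
    moreover have "(norm (a n))\<^sup>2 * y * X\<^sup>2 \<le> (norm (a n) * ?s n * X)\<^sup>2"
      unfolding power_mult_distrib using sy by (intro mult_right_mono mult_left_mono) auto
    ultimately have 1: "(norm (a n))\<^sup>2 * y * X\<^sup>2 \<le> (M / \<delta>)\<^sup>2" by linarith
    have "inverse X \<le> y / \<epsilon>\<^sup>2"
      using exp_neg_inverse_le[of "\<epsilon>\<^sup>2" y] \<epsilon> y by (simp add: X_def exp_minus)
    then have "\<epsilon>\<^sup>2 \<le> y * X" using X \<epsilon> by (simp add: field_simps)
    then have "(norm (a n))\<^sup>2 * X * \<epsilon>\<^sup>2 \<le> (norm (a n))\<^sup>2 * X * (y * X)" using X by (intro mult_left_mono) auto
    also have "\<dots> = (norm (a n))\<^sup>2 * y * X\<^sup>2" by (simp add: power2_eq_square)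
    finally have "(norm (a n))\<^sup>2 * X * \<epsilon>\<^sup>2 \<le> (M / \<delta>)\<^sup>2" using 1 by linarith
    then have "(norm (a n))\<^sup>2 * (X * \<epsilon>\<^sup>2) \<le> (M / \<delta>)\<^sup>2" by (simp only: mult.assoc)
    moreover have "0 < X * \<epsilon>\<^sup>2" using X \<epsilon> by simp
    ultimately have "(norm (a n))\<^sup>2 \<le> (M / \<delta>)\<^sup>2 / (X * \<epsilon>\<^sup>2)" by (simp only: pos_le_divide_eq)
    also have "\<dots> = (M / \<delta>)\<^sup>2 / \<epsilon>\<^sup>2 * inverse X" by (simp only: divide_inverse inverse_mult_distrib mult_ac)
    finally have "(norm (a n))\<^sup>2 \<le> (M / \<delta>)\<^sup>2 / \<epsilon>\<^sup>2 * inverse X" .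
    then show ?thesis by (simp add: X_def y_def exp_minus)
  qed
  moreover have "0 < \<epsilon>\<^sup>2" using \<epsilon> by simp
  ultimately show ?thesis by blast
qed

section \<open>Outer functions\<close>

definition Herglotz :: "complex \<Rightarrow> complex \<Rightarrow> complex" where
  "Herglotz \<xi> z = (\<xi> + z) / (\<xi> - z)"

lemma Herglotz_bound:
  assumes "norm \<xi> = 1" "norm z < 1" shows "norm (Herglotz \<xi> z) \<le> 2 / (1 - norm z)"
  unfolding Herglotz_def norm_divide
  using norm_triangle_ineq[of \<xi> z] norm_triangle_ineq2[of \<xi> z] assms by (intro frac_le) auto

lemma Re_Herglotz:
  assumes "norm \<xi> = 1" shows "Re (Herglotz \<xi> z) = (1 - (norm z)\<^sup>2) / (norm (\<xi> - z))\<^sup>2"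
proof -
  have "Re (Herglotz \<xi> z) = Re ((\<xi> + z) * cnj (\<xi> - z)) / (norm (\<xi> - z))\<^sup>2"
    unfolding Herglotz_def by (subst complex_div_cnj) (simp add: Re_divide_of_real flip: of_real_power)
  also have "Re ((\<xi> + z) * cnj (\<xi> - z)) = (norm \<xi>)\<^sup>2 - (norm z)\<^sup>2"
    unfolding cmod_power2 by (simp add: algebra_simps power2_eq_square)
  finally show ?thesis using assms by simp
qed

lemma Herglotz_measurable [measurable]: "(\<lambda>\<xi>. Herglotz \<xi> z) \<in> borel_measurable borel"
  unfolding Herglotz_def by measurable

lemma Herglotz_integrable:
  assumes w: "integrable circle_measure w" and z: "norm z < 1"
  shows "integrable circle_measure (\<lambda>\<xi>. Herglotz \<xi> z * complex_of_real (w \<xi>))"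
proof (rule Bochner_Integration.integrable_bound)
  show "integrable circle_measure (\<lambda>\<xi>. 2 / (1 - norm z) * w \<xi>)" using w by simp
  have "w \<in> borel_measurable circle_measure" using w by (rule borel_measurable_integrable)
  then show "(\<lambda>\<xi>. Herglotz \<xi> z * complex_of_real (w \<xi>)) \<in> borel_measurable circle_measure"
    by measurable
  show "AE \<xi> in circle_measure. norm (Herglotz \<xi> z * complex_of_real (w \<xi>)) \<le> norm (2 / (1 - norm z) * w \<xi>)"
    using AE_circle_norm
  proof eventually_elim
    case (elim \<xi>)
    have "norm (Herglotz \<xi> z) * \<bar>w \<xi>\<bar> \<le> 2 / (1 - norm z) * \<bar>w \<xi>\<bar>"
      by (intro mult_right_mono Herglotz_bound elim z) simp
    then show ?case using z by (simp add: norm_mult abs_mult)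
  qed
qed

lemma Re_Herglotz_integral:
  assumes w: "integrable circle_measure w" and z: "norm z < 1"
  shows "Re (LINT \<xi>|circle_measure. Herglotz \<xi> z * complex_of_real (w \<xi>))
     = (LINT \<xi>|circle_measure. (1 - (norm z)\<^sup>2) / (norm (\<xi> - z))\<^sup>2 * w \<xi>)"
    and "integrable circle_measure (\<lambda>\<xi>. (1 - (norm z)\<^sup>2) / (norm (\<xi> - z))\<^sup>2 * w \<xi>)"
proof -
  have wm: "w \<in> borel_measurable circle_measure" using w by (rule borel_measurable_integrable)
  have m: "(\<lambda>\<xi>. (1 - (norm z)\<^sup>2) / (norm (\<xi> - z))\<^sup>2 * w \<xi>) \<in> borel_measurable circle_measure"
    using wm by measurable
  have m': "(\<lambda>\<xi>. Re (Herglotz \<xi> z * complex_of_real (w \<xi>))) \<in> borel_measurable circle_measure"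
    using wm by measurable
  have AE: "AE \<xi> in circle_measure. Re (Herglotz \<xi> z * complex_of_real (w \<xi>)) = (1 - (norm z)\<^sup>2) / (norm (\<xi> - z))\<^sup>2 * w \<xi>"
    using AE_circle_norm by eventually_elim (simp add: Re_Herglotz)
  have i: "integrable circle_measure (\<lambda>\<xi>. Re (Herglotz \<xi> z * complex_of_real (w \<xi>)))"
    by (intro integrable_Re Herglotz_integrable w z)
  show "Re (LINT \<xi>|circle_measure. Herglotz \<xi> z * complex_of_real (w \<xi>))
     = (LINT \<xi>|circle_measure. (1 - (norm z)\<^sup>2) / (norm (\<xi> - z))\<^sup>2 * w \<xi>)"
    unfolding integral_Re[OF Herglotz_integrable[OF w z], symmetric] by (rule integral_cong_AE[OF m' m AE])
  show "integrable circle_measure (\<lambda>\<xi>. (1 - (norm z)\<^sup>2) / (norm (\<xi> - z))\<^sup>2 * w \<xi>)"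
    by (rule integrable_cong_AE_imp[OF i m]) (use AE in \<open>auto elim: eventually_mono\<close>)
qed

lemma Herglotz_sums:
  assumes \<xi>: "norm \<xi> = 1" and z: "norm z < 1"
  shows "(\<lambda>n. (if n = 0 then 1 else 2) * (cnj \<xi> * z) ^ n) sums Herglotz \<xi> z"
proof -
  let ?u = "cnj \<xi> * z"
  have u: "norm ?u < 1" using \<xi> z by (simp add: norm_mult)
  have "(\<lambda>n. 2 * ?u ^ n - (if n = 0 then ?u ^ n else 0)) sums (2 * (1 / (1 - ?u)) - ?u ^ 0)"
    by (intro sums_diff sums_mult geometric_sums u sums_single)
  also have "(\<lambda>n. 2 * ?u ^ n - (if n = 0 then ?u ^ n else 0)) = (\<lambda>n. (if n = 0 then 1 else 2) * ?u ^ n)" by auto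
  also have "2 * (1 / (1 - ?u)) - ?u ^ 0 = Herglotz \<xi> z"
  proof -
    have x: "\<xi> * cnj \<xi> = 1" using \<xi> by (simp add: complex_norm_square[symmetric])
    have n1: "1 - ?u \<noteq> 0" using u by auto
    have n2: "\<xi> - z \<noteq> 0" using \<xi> z by auto
    have u': "\<xi> * ?u = z" unfolding mult.assoc[symmetric] x by (rule mult_1)
    have "\<xi> - z = \<xi> * (1 - ?u)" unfolding right_diff_distrib u' mult_1_right ..
    moreover have "\<xi> + z = \<xi> * (1 + ?u)" unfolding distrib_left u' mult_1_right ..
    moreover have "\<xi> \<noteq> 0" using \<xi> by auto
    ultimately have "Herglotz \<xi> z = (\<xi> * (1 + ?u)) / (\<xi> * (1 - ?u))" by (simp only: Herglotz_def)
    also have "\<dots> = (1 + ?u) / (1 - ?u)" by (rule mult_divide_mult_cancel_left) (use \<xi> in auto)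
    also have "\<dots> = 2 * (1 / (1 - ?u)) - ?u ^ 0" using n1 by (simp add: field_simps)
    finally show ?thesis by simp
  qed
  finally show ?thesis .
qed

text \<open>The kernel expands as \<open>1 + 2 * u + 2 * u^2 + ...\<close> in
  \<open>u = cnj \<xi> * z\<close>, with partial sums of modulus at most
  \<open>2 / (1 - |z|)\<close>. Termwise integration displays the integral as a power series in
  \<open>z\<close>.\<close>

lemma Herglotz_integral_holomorphic:
  assumes w: "integrable circle_measure w"
  shows "(\<lambda>z. LINT \<xi>|circle_measure. Herglotz \<xi> z * complex_of_real (w \<xi>)) holomorphic_on ball 0 1"
proof -
  have wm: "w \<in> borel_measurable circle_measure" using w by (rule borel_measurable_integrable)
  let ?e = "\<lambda>n. if n = 0 then 1 else 2 :: complex"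
  let ?c = "\<lambda>n. ?e n * (LINT \<xi>|circle_measure. cnj \<xi> ^ n * complex_of_real (w \<xi>))"
  show ?thesis
  proof (rule power_series_holomorphic)
    fix z :: complex assume "z \<in> ball 0 1"
    then have z: "norm z < 1" by simp
    let ?S = "\<lambda>N \<xi>. \<Sum>n<N. ?e n * (cnj \<xi> * z) ^ n"
    have Sm: "?S N \<in> borel_measurable borel" for N
      by (intro borel_measurable_continuous_onI continuous_intros)
    have iw: "integrable circle_measure (\<lambda>\<xi>. cnj \<xi> ^ n * complex_of_real (w \<xi>))" for n
    proof (rule Bochner_Integration.integrable_bound[OF w])
      show "(\<lambda>\<xi>. cnj \<xi> ^ n * complex_of_real (w \<xi>)) \<in> borel_measurable circle_measure"
        using wm by measurable
      show "AE \<xi> in circle_measure. norm (cnj \<xi> ^ n * complex_of_real (w \<xi>)) \<le> norm (w \<xi>)"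
        using AE_circle_norm by eventually_elim (simp add: norm_mult norm_power)
    qed
    have "(\<lambda>N. LINT \<xi>|circle_measure. ?S N \<xi> * complex_of_real (w \<xi>)) \<longlonglongrightarrow> (LINT \<xi>|circle_measure. Herglotz \<xi> z * complex_of_real (w \<xi>))"
    proof (rule integral_dominated_convergence)
      show "(\<lambda>\<xi>. Herglotz \<xi> z * complex_of_real (w \<xi>)) \<in> borel_measurable circle_measure"
        using wm by measurable
      show "(\<lambda>\<xi>. ?S N \<xi> * complex_of_real (w \<xi>)) \<in> borel_measurable circle_measure" for N
        using wm Sm[of N] by simp
      show "integrable circle_measure (\<lambda>\<xi>. 2 / (1 - norm z) * \<bar>w \<xi>\<bar>)" using w by simp
      show "AE \<xi> in circle_measure. (\<lambda>N. ?S N \<xi> * complex_of_real (w \<xi>)) \<longlonglongrightarrow> Herglotz \<xi> z * complex_of_real (w \<xi>)"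
        using AE_circle_norm
      proof eventually_elim
        case (elim \<xi>)
        from Herglotz_sums[OF elim z] show ?case unfolding sums_def by (intro tendsto_mult tendsto_const)
      qed
      show "AE \<xi> in circle_measure. norm (?S N \<xi> * complex_of_real (w \<xi>)) \<le> 2 / (1 - norm z) * \<bar>w \<xi>\<bar>" for N
        using AE_circle_norm
      proof eventually_elim
        case (elim \<xi>)
        have "norm (?S N \<xi>) \<le> (\<Sum>n<N. norm (?e n * (cnj \<xi> * z) ^ n))" by (rule norm_sum)
        also have "\<dots> \<le> (\<Sum>n<N. 2 * norm z ^ n)"
          by (intro sum_mono) (simp add: norm_mult norm_power elim)
        also have "\<dots> \<le> (\<Sum>n. 2 * norm z ^ n)"
          using z by (intro sum_le_suminf summable_mult summable_geometric) auto
        also have "\<dots> = 2 * (1 / (1 - norm z))"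
          using z by (simp add: suminf_mult suminf_geometric summable_geometric)
        finally have "norm (?S N \<xi>) * \<bar>w \<xi>\<bar> \<le> 2 * (1 / (1 - norm z)) * \<bar>w \<xi>\<bar>" by (rule mult_right_mono) simp
        then show ?case unfolding norm_mult norm_of_real by simp
      qed
    qed
    moreover have "(LINT \<xi>|circle_measure. ?S N \<xi> * complex_of_real (w \<xi>)) = (\<Sum>n<N. ?c n * (z - 0) ^ n)" for N
    proof -
      have "(LINT \<xi>|circle_measure. ?S N \<xi> * complex_of_real (w \<xi>))
         = (LINT \<xi>|circle_measure. (\<Sum>n<N. (?e n * z ^ n) * (cnj \<xi> ^ n * complex_of_real (w \<xi>))))"
        by (intro Bochner_Integration.integral_cong refl, unfold sum_distrib_right, intro sum.cong refl)
           (simp only: power_mult_distrib mult_ac)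
      also have "\<dots> = (\<Sum>n<N. (?e n * z ^ n) * (LINT \<xi>|circle_measure. cnj \<xi> ^ n * complex_of_real (w \<xi>)))"
        using iw by (subst Bochner_Integration.integral_sum) auto
      finally show ?thesis by (simp only: diff_zero mult_ac)
    qed
    ultimately show "(\<lambda>n. ?c n * (z - 0) ^ n) sums (LINT \<xi>|circle_measure. Herglotz \<xi> z * complex_of_real (w \<xi>))"
      by (simp only: sums_def)
  qed
qed

section \<open>Moduli of outer functions as exponentials of Poisson integrals\<close>

lemma outer_norm:
  assumes "\<phi> \<in> outer"
  obtains w where "integrable circle_measure w"
    "\<And>z. norm z < 1 \<Longrightarrow> norm (\<phi> z) = exp (LINT \<xi>|circle_measure. (1 - (norm z)\<^sup>2) / (norm (\<xi> - z))\<^sup>2 * w \<xi>)"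
proof -
  from assms obtain \<gamma> and W :: "complex \<Rightarrow> ereal" where \<gamma>: "norm \<gamma> = 1"
    and W: "integrable circle_measure (\<lambda>\<xi>. real_of_ereal (W \<xi>))"
    and \<phi>: "\<And>z. z \<in> ball 0 1 \<Longrightarrow> \<phi> z = \<gamma> * exp (LINT \<xi>|circle_measure. (\<xi> + z) / (\<xi> - z) * of_real (real_of_ereal (W \<xi>)))"
    unfolding outer_def by blast
  show ?thesis
  proof (rule that[OF W])
    fix z :: complex assume z: "norm z < 1"
    then have "norm (\<phi> z) = exp (Re (LINT \<xi>|circle_measure. Herglotz \<xi> z * of_real (real_of_ereal (W \<xi>))))"
      using \<phi>[of z] \<gamma> by (simp add: norm_mult Herglotz_def)
    then show "norm (\<phi> z) = exp (LINT \<xi>|circle_measure. (1 - (norm z)\<^sup>2) / (norm (\<xi> - z))\<^sup>2 * real_of_ereal (W \<xi>))"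
      by (simp only: Re_Herglotz_integral(1)[OF W z])
  qed
qed

text \<open>The boundary values of \<open>log |\<phi>|\<close> are prescribed as \<open>- w\<close>;
  the sign of \<open>w\<close> keeps \<open>|\<phi>|\<close> at most \<open>1\<close>.\<close>

lemma outer_exists:
  assumes w: "integrable circle_measure w" and w0: "\<And>\<xi>. 0 \<le> w \<xi>"
  obtains \<phi> where "\<phi> \<in> Hinf \<inter> outer"
    "\<And>z. norm z < 1 \<Longrightarrow> norm (\<phi> z) = exp (- (LINT \<xi>|circle_measure. (1 - (norm z)\<^sup>2) / (norm (\<xi> - z))\<^sup>2 * w \<xi>))"
proof -
  have w': "integrable circle_measure (\<lambda>\<xi>. - w \<xi>)" using w by simp
  let ?E = "\<lambda>z. exp (LINT \<xi>|circle_measure. Herglotz \<xi> z * complex_of_real (- w \<xi>))"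
  define \<phi> where "\<phi> = (\<lambda>z. if norm z < 1 then ?E z else 0)"
  have n: "norm (?E z) = exp (- (LINT \<xi>|circle_measure. (1 - (norm z)\<^sup>2) / (norm (\<xi> - z))\<^sup>2 * w \<xi>))" if z: "norm z < 1" for z
    unfolding norm_exp_eq_Re Re_Herglotz_integral(1)[OF w' z] by simp
  have "\<phi> \<in> Hinf" unfolding \<phi>_def
  proof (rule HinfI)
    show "?E holomorphic_on ball 0 1" by (intro holomorphic_intros Herglotz_integral_holomorphic w')
    fix z :: complex assume z: "norm z < 1"
    have "0 \<le> (LINT \<xi>|circle_measure. (1 - (norm z)\<^sup>2) / (norm (\<xi> - z))\<^sup>2 * w \<xi>)"
      using w0 z by (intro Bochner_Integration.integral_nonneg) (auto simp: abs_square_le_1)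
    then show "norm (?E z) \<le> 1" unfolding n[OF z] by simp
  qed
  moreover have "\<phi> \<in> outer"
  proof -
    have wm: "w \<in> borel_measurable circle_measure" using w by (rule borel_measurable_integrable)
    have "(\<lambda>\<xi>. ereal (- w \<xi>)) \<in> borel_measurable circle_measure" using wm by measurable
    then show ?thesis
      unfolding outer_def using w
      by (auto intro!: exI[of _ 1] exI[of _ "\<lambda>\<xi>. ereal (- w \<xi>)"] simp: \<phi>_def Herglotz_def)
  qed
  ultimately show ?thesis using n by (intro that[of \<phi>]) (auto simp: \<phi>_def)
qed

text \<open>An outer function decays more slowly than \<open>exp (- c / (1 - x))\<close> for every \<open>c > 0\<close>: the Poisson
  kernel times \<open>1 - x\<close> is bounded and tends to \<open>0\<close> off the point \<open>1\<close>.\<close>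

lemma outer_decay:
  assumes \<phi>: "\<phi> \<in> outer" and l: "\<And>n. 0 < l n" "\<And>n. l n < 1" and lim: "l \<longlonglongrightarrow> 1" and c: "0 < c"
  shows "eventually (\<lambda>n. exp (- c / (1 - l n)) \<le> norm (\<phi> (complex_of_real (l n)))) sequentially"
proof -
  from outer_norm[OF \<phi>] obtain w where w: "integrable circle_measure w"
    and n\<phi>: "\<And>z. norm z < 1 \<Longrightarrow> norm (\<phi> z) = exp (LINT \<xi>|circle_measure. (1 - (norm z)\<^sup>2) / (norm (\<xi> - z))\<^sup>2 * w \<xi>)"
    by metis
  have wm: "w \<in> borel_measurable circle_measure" using w by (rule borel_measurable_integrable)
  let ?P = "\<lambda>n \<xi>. (1 - (l n)\<^sup>2) / (norm (\<xi> - of_real (l n)))\<^sup>2"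
  have "(\<lambda>n. LINT \<xi>|circle_measure. (1 - l n) * (?P n \<xi> * w \<xi>)) \<longlonglongrightarrow> (LINT \<xi>|circle_measure. 0)"
  proof (rule integral_dominated_convergence)
    show "(\<lambda>\<xi>. (1 - l n) * (?P n \<xi> * w \<xi>)) \<in> borel_measurable circle_measure" for n
      using wm by measurable
    show "integrable circle_measure (\<lambda>\<xi>. 2 * \<bar>w \<xi>\<bar>)" using w by simp
    show "AE \<xi> in circle_measure. (\<lambda>n. (1 - l n) * (?P n \<xi> * w \<xi>)) \<longlonglongrightarrow> 0"
      using AE_circle_neq_1
    proof eventually_elim
      case (elim \<xi>)
      have "(\<lambda>n. (1 - l n) * (?P n \<xi> * w \<xi>)) \<longlonglongrightarrow> (1 - 1) * ((1 - 1\<^sup>2) / (norm (\<xi> - of_real 1))\<^sup>2 * w \<xi>)"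
        using elim by (intro tendsto_intros lim) auto
      then show ?case by simp
    qed
    show "AE \<xi> in circle_measure. norm ((1 - l n) * (?P n \<xi> * w \<xi>)) \<le> 2 * \<bar>w \<xi>\<bar>" for n
      using AE_circle_norm
    proof eventually_elim
      case (elim \<xi>)
      \<comment> \<open>From \<open>|\<xi> - l n| >= 1 - l n\<close> and
        \<open>1 + l n <= 2\<close>, the quotient
        \<open>(1 - l n)^2 * (1 + l n) / |\<xi> - l n|^2\<close> is at most \<open>2\<close>, the
        factor in the dominating function.\<close>
      have d: "1 - l n \<le> norm (\<xi> - of_real (l n))"
        using norm_triangle_ineq2[of \<xi> "of_real (l n)"] elim l[of n] by simp
      have "(1 - l n)\<^sup>2 * (1 + l n) \<le> (norm (\<xi> - of_real (l n)))\<^sup>2 * 2"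
        using d l[of n] by (intro mult_mono power_mono) auto
      moreover have "0 < (norm (\<xi> - of_real (l n)))\<^sup>2" using d l[of n] by (intro zero_less_power) linarith
      ultimately have "(1 - l n)\<^sup>2 * (1 + l n) / (norm (\<xi> - of_real (l n)))\<^sup>2 \<le> 2" by (simp add: pos_divide_le_eq mult.commute)
      moreover have "(1 - l n) * ?P n \<xi> = (1 - l n)\<^sup>2 * (1 + l n) / (norm (\<xi> - of_real (l n)))\<^sup>2"
        by (simp add: power2_eq_square algebra_simps)
      moreover have "0 \<le> (1 - l n) * ?P n \<xi>" using l[of n] by (auto simp: abs_square_le_1)
      ultimately have "\<bar>(1 - l n) * ?P n \<xi>\<bar> \<le> 2" by (simp only: abs_of_nonneg)
      then have "\<bar>(1 - l n) * ?P n \<xi>\<bar> * \<bar>w \<xi>\<bar> \<le> 2 * \<bar>w \<xi>\<bar>" by (rule mult_right_mono) simp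
      then show ?case unfolding real_norm_def abs_mult[symmetric] by (simp only: mult.assoc)
    qed
  qed simp
  then have "(\<lambda>n. (1 - l n) * (LINT \<xi>|circle_measure. ?P n \<xi> * w \<xi>)) \<longlonglongrightarrow> 0"
    unfolding integral_mult_right_zero Bochner_Integration.integral_zero .
  from order_tendstoD(1)[OF this, of "- c"] c
  have "eventually (\<lambda>n. - c < (1 - l n) * (LINT \<xi>|circle_measure. ?P n \<xi> * w \<xi>)) sequentially" by simp
  then show ?thesis
  proof eventually_elim
    case (elim n)
    have "norm (\<phi> (of_real (l n))) = exp (LINT \<xi>|circle_measure. ?P n \<xi> * w \<xi>)"
      using n\<phi>[of "of_real (l n)"] l[of n] by simp
    moreover have "- c / (1 - l n) \<le> (LINT \<xi>|circle_measure. ?P n \<xi> * w \<xi>)"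
    proof -
      have "0 < 1 - l n" using l[of n] by simp
      from iffD2[OF pos_divide_le_eq[OF this]] elim show ?thesis
        by (simp only: mult.commute[of _ "1 - l n"] less_imp_le)
    qed
    ultimately show ?case by simp
  qed
qed

section \<open>Decreasing weights\<close>

text \<open>The constant \<open>8 * pi\<close> makes up for the normalization
  \<open>1 / (2 * pi)\<close> of the measure and for the \<open>4\<close> in
  \<open>1 / (4 * y)\<close>, a lower bound for the Poisson kernel at \<open>x = 1 - y\<close> on
  the arc \<open>0 < t <= y\<close>. What remains is exactly \<open>1 / y\<close>.\<close>

lemma outer_for_weight:
  assumes h: "decreasing_weight h"
  obtains \<phi> where "\<phi> \<in> Hinf \<inter> outer"
    "\<And>x. 0 < x \<Longrightarrow> x < 1 \<Longrightarrow> norm (\<phi> (complex_of_real x)) \<le> exp (- (1 / (1 - x) * (LBINT t:{0..1 - x}. real_of_ereal (h t))))"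
proof -
  let ?g = "\<lambda>t. real_of_ereal (h t)"
  \<comment> \<open>The point \<open>0\<close> is left out: \<open>h 0\<close> may be infinite, and
    at the real point \<open>cis 0\<close> the function \<open>w\<close> below is zero.\<close>
  define hr where "hr = (\<lambda>t. indicat_real {0<..1} t * ?g t)"
  have g0: "0 \<le> ?g t" if "t \<in> {0..1}" for t
    using h that unfolding decreasing_weight_def by (intro real_of_ereal_pos) (auto simp: less_imp_le)
  have hr0: "0 \<le> hr t" for t using g0[of t] by (auto simp: hr_def split: split_indicator)
  have "set_integrable lborel {0<..1} ?g"
    by (rule set_integrable_subset[of lborel "{0..1}"]) (use h in \<open>auto simp: decreasing_weight_def\<close>)
  then have hi: "integrable lborel hr" by (simp add: set_integrable_def hr_def)
  then have hm: "hr \<in> borel_measurable borel" using borel_measurable_integrable[OF hi] by simp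
  \<comment> \<open>Recovers the angle on the upper half circle from its cosine. The clamp to
    \<open>{-1..1}\<close> makes the function continuous on the whole line, hence Borel.\<close>
  define A where "A = (\<lambda>x::real. arccos (max (-1) (min 1 x)))"
  have "continuous_on UNIV A" unfolding A_def
    by (rule continuous_on_compose2[OF continuous_on_arccos']) (auto intro!: continuous_intros)
  then have Am: "A \<in> borel_measurable borel" by (rule borel_measurable_continuous_onI)
  define w where "w = (\<lambda>\<xi>. if 0 < Im \<xi> then 8 * pi * hr (A (Re \<xi>)) else 0)"
  have "(\<lambda>\<xi>. hr (A (Re \<xi>))) \<in> borel_measurable borel"
    by (rule measurable_compose[OF measurable_compose[OF _ Am] hm]) simp
  then have wm: "w \<in> borel_measurable borel" unfolding w_def by measurable
  have pi3: "pi > 3" using pi_gt3 .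
  have wcis: "w (cis t) = 8 * pi * hr t" if t: "t \<in> {0..<2*pi}" for t
  proof -
    consider "t = 0" | "0 < t" "t < pi" | "pi \<le> t" using t by force
    then show ?thesis
    proof cases
      case 2
      then have "0 < sin t" by (intro sin_gt_zero)
      moreover have "A (cos t) = t" using 2 by (simp add: A_def arccos_cos)
      ultimately show ?thesis by (simp add: w_def)
    next
      case 3
      then have "sin t \<le> 0" using t by (intro sin_le_zero) auto
      moreover have "hr t = 0" using 3 pi3 by (auto simp: hr_def)
      ultimately show ?thesis by (simp add: w_def)
    qed (simp add: w_def hr_def)
  qed
  have ind: "indicat_real {0..<2*pi} t *\<^sub>R w (cis t) = 8 * pi * hr t" for t
    using wcis[of t] pi3 by (auto simp: hr_def split: split_indicator)
  have wi: "integrable circle_measure w"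
    unfolding circle_integral(2)[OF wm] set_integrable_def ind using hi by simp
  have w0: "0 \<le> w \<xi>" for \<xi> using hr0 by (simp add: w_def)
  obtain \<phi> where \<phi>: "\<phi> \<in> Hinf \<inter> outer"
    and n\<phi>: "\<And>z. norm z < 1 \<Longrightarrow> norm (\<phi> z) = exp (- (LINT \<xi>|circle_measure. (1 - (norm z)\<^sup>2) / (norm (\<xi> - z))\<^sup>2 * w \<xi>))"
    using outer_exists[OF wi w0] by metis
  show ?thesis
  proof (rule that[OF \<phi>])
    fix x :: real assume x: "0 < x" "x < 1"
    define y where "y = 1 - x"
    have y: "0 < y" "y < 1" using x by (auto simp: y_def)
    have nx: "norm (complex_of_real x) < 1" using x by simp
    let ?P = "\<lambda>\<xi>. (1 - (norm (complex_of_real x))\<^sup>2) / (norm (\<xi> - complex_of_real x))\<^sup>2"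
    have P0: "0 \<le> ?P \<xi>" for \<xi> using x by (simp add: abs_square_le_1)
    \<comment> \<open>The squared distance is \<open>y^2 + 2 * x * (1 - cos t)\<close>, at most
      \<open>y^2 + t^2\<close> and so below \<open>4 * y^2\<close>, while the numerator is
      \<open>y * (1 + x) >= y\<close>.\<close>
    have Plow: "1 / (4 * y) \<le> ?P (cis t)" if t: "0 < t" "t \<le> y" for t
    proof -
      have "(norm (cis t - complex_of_real x))\<^sup>2 = (cos t - x)\<^sup>2 + (sin t)\<^sup>2" unfolding cmod_power2 by simp
      also have "\<dots> = 1 - 2 * x * cos t + x\<^sup>2"
        using sin_cos_squared_add[of t] by (simp add: power2_diff)
      also have "\<dots> = y\<^sup>2 + 2 * x * (1 - cos t)" by (simp add: y_def power2_eq_square algebra_simps)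
      also have "\<dots> \<le> y\<^sup>2 + 2 * 1 * (t\<^sup>2 / 2)"
      proof (intro add_left_mono mult_mono)
        have "1 - cos t = 2 * (sin (t / 2))\<^sup>2" using cos_double_sin[of "t / 2"] by simp
        also have "\<dots> \<le> 2 * (t / 2)\<^sup>2"
          using abs_sin_x_le_abs_x[of "t / 2"] by (intro mult_left_mono) (auto simp: abs_le_square_iff[symmetric])
        finally show "1 - cos t \<le> t\<^sup>2 / 2" by (simp add: power_divide)
      qed (use x in auto)
      also have "\<dots> \<le> 4 * y\<^sup>2"
      proof -
        have "t\<^sup>2 \<le> y\<^sup>2" using t by (intro power_mono) auto
        then show ?thesis using zero_le_power2[of y] by linarith
      qed
      finally have D: "(norm (cis t - complex_of_real x))\<^sup>2 \<le> 4 * y\<^sup>2" .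
      have "cis t \<noteq> complex_of_real x"
      proof
        assume "cis t = complex_of_real x"
        then have "norm (cis t) = norm (complex_of_real x)" by simp
        then show False using x by simp
      qed
      then have D0: "0 < (norm (cis t - complex_of_real x))\<^sup>2" by simp
      have "1 - (norm (complex_of_real x))\<^sup>2 = y * (1 + x)" by (simp add: y_def power2_eq_square algebra_simps)
      then have "y \<le> 1 - (norm (complex_of_real x))\<^sup>2" using y x by simp
      then have "y / (4 * y\<^sup>2) \<le> ?P (cis t)" using D D0 y by (intro frac_le) auto
      then show ?thesis using y by (simp add: power2_eq_square)
    qed
    have Pi: "integrable circle_measure (\<lambda>\<xi>. ?P \<xi> * w \<xi>)"
      by (rule Re_Herglotz_integral(2)[OF wi nx])
    have Pm: "(\<lambda>\<xi>. ?P \<xi> * w \<xi>) \<in> borel_measurable borel" using wm by measurable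
    have gy: "set_integrable lborel {0..y} ?g"
      by (rule set_integrable_subset[of lborel "{0..1}"]) (use h y in \<open>auto simp: decreasing_weight_def\<close>)
    have "2 * pi / y * (LBINT t:{0..y}. ?g t) = (LBINT t. 2 * pi / y * (indicat_real {0..y} t *\<^sub>R ?g t))"
      unfolding set_lebesgue_integral_def by (rule integral_mult_right_zero[symmetric])
    also have "\<dots> \<le> (LBINT t:{0..<2*pi}. ?P (cis t) * w (cis t))"
      unfolding set_lebesgue_integral_def
    proof (rule integral_mono_AE)
      show "integrable lborel (\<lambda>t. 2 * pi / y * (indicat_real {0..y} t *\<^sub>R ?g t))"
        using gy unfolding set_integrable_def by (rule integrable_mult_right)
      show "integrable lborel (\<lambda>t. indicat_real {0..<2*pi} t *\<^sub>R (?P (cis t) * w (cis t)))"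
        using Pi unfolding circle_integral(2)[OF Pm] set_integrable_def .
      show "AE t in lborel. 2 * pi / y * (indicat_real {0..y} t *\<^sub>R ?g t) \<le> indicat_real {0..<2*pi} t *\<^sub>R (?P (cis t) * w (cis t))"
        using AE_lborel_singleton[of "0::real"]
      proof eventually_elim
        case (elim t)
        show ?case
        proof (cases "0 < t \<and> t \<le> y")
          case True
          then have t: "t \<in> {0..<2*pi}" "t \<in> {0..y}" "t \<in> {0<..1}" using y pi3 by auto
          have "1 / (4 * y) * (8 * pi * ?g t) \<le> ?P (cis t) * (8 * pi * ?g t)"
            using True g0[of t] t by (intro mult_right_mono Plow) auto
          moreover have "w (cis t) = 8 * pi * ?g t" using wcis[OF t(1)] t(3) by (simp add: hr_def)
          moreover have "1 / (4 * y) * (8 * pi * ?g t) = 2 * pi / y * ?g t" by simp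
          ultimately show ?thesis using t(1,2) by (simp only: indicator_simps(1) scaleR_one)
        next
          case False
          then have "indicat_real {0..y} t = 0" using elim by auto
          moreover have "0 \<le> indicat_real {0..<2*pi} t *\<^sub>R (?P (cis t) * w (cis t))"
            using P0 w0 by (intro scaleR_nonneg_nonneg mult_nonneg_nonneg) auto
          ultimately show ?thesis by simp
        qed
      qed
    qed
    also have "\<dots> = 2 * pi * (LINT \<xi>|circle_measure. ?P \<xi> * w \<xi>)"
      unfolding circle_integral(1)[OF Pm] by simp
    finally have "1 / y * (LBINT t:{0..y}. ?g t) \<le> (LINT \<xi>|circle_measure. ?P \<xi> * w \<xi>)"
    proof -
      assume "2 * pi / y * (LBINT t:{0..y}. ?g t) \<le> 2 * pi * (LINT \<xi>|circle_measure. ?P \<xi> * w \<xi>)"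
      moreover have "2 * pi / y * (LBINT t:{0..y}. ?g t) = 2 * pi * (1 / y * (LBINT t:{0..y}. ?g t))" by simp
      ultimately have "2 * pi * (1 / y * (LBINT t:{0..y}. ?g t)) \<le> 2 * pi * (LINT \<xi>|circle_measure. ?P \<xi> * w \<xi>)"
        by (simp only:)
      then show ?thesis by (rule mult_left_le_imp_le) simp
    qed
    then show "norm (\<phi> (complex_of_real x)) \<le> exp (- (1 / (1 - x) * (LBINT t:{0..1 - x}. ?g t)))"
      unfolding n\<phi>[OF nx] exp_le_cancel_iff y_def by (rule le_imp_neg_le)
  qed
qed

text \<open>If \<open>x n\<close> is not \<open>O(exp (- c / y n))\<close> for any \<open>c\<close>, then along a sparse subsequence it exceeds
  \<open>exp (- c\<^sub>j / y)\<close> with \<open>c\<^sub>j\<close> tending to \<open>0\<close>, and a weight made of blocks of mass \<open>2 c\<^sub>j\<close> on \<open>[0, y]\<close>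
  violates the hypothesis.\<close>

lemma weight_bound_imp_decay:
  fixes x y :: "nat \<Rightarrow> real"
  assumes y: "\<And>n. 0 < y n" "\<And>n. y n < 1" and x: "\<And>n. 0 \<le> x n" "\<And>n. x n \<le> A"
    and wt: "\<And>h. decreasing_weight h \<Longrightarrow> \<exists>C. \<forall>n. x n * exp (1 / y n * (LBINT t:{0..y n}. real_of_ereal (h t))) \<le> C"
  shows "\<exists>C c. 0 < c \<and> (\<forall>n. x n \<le> C * exp (- c / y n))"
proof (rule ccontr)
  assume neg: "\<not> ?thesis"
  have A: "0 \<le> A" using x[of 0] by linarith
  \<comment> \<open>Decay with rate \<open>c\<close> is refuted with a constant so large that
    indices with \<open>y n >= \<eta>\<close> satisfy the bound simply because
    \<open>x n <= A\<close>. The failing index therefore has \<open>y n < \<eta>\<close>.\<close>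
  have "\<exists>n. y n < (1/4) ^ j \<and> exp (- ((1/2) ^ j / 2) / y n) < x n" for j :: nat
  proof -
    define c where "c = (1/2 :: real) ^ j / 2"
    define \<eta> where "\<eta> = (1/4 :: real) ^ j"
    have c: "0 < c" and \<eta>: "0 < \<eta>" by (auto simp: c_def \<eta>_def)
    have "\<not> (\<forall>n. x n \<le> (1 + A * exp (c / \<eta>)) * exp (- c / y n))" using neg c by blast
    then obtain n where n: "(1 + A * exp (c / \<eta>)) * exp (- c / y n) < x n" by (auto simp: not_le)
    have "exp (- c / y n) \<le> (1 + A * exp (c / \<eta>)) * exp (- c / y n)"
      using A by (simp add: distrib_right)
    with n have "exp (- c / y n) < x n" by linarith
    moreover have "y n < \<eta>"
    proof (rule ccontr)
      assume "\<not> y n < \<eta>"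
      then have "c / y n \<le> c / \<eta>" using c \<eta> by (intro divide_left_mono) auto
      then have "1 \<le> exp (c / \<eta>) * exp (- c / y n)" by (simp flip: exp_add)
      then have "A * 1 \<le> A * (exp (c / \<eta>) * exp (- c / y n))" using A by (rule mult_left_mono)
      also have "\<dots> \<le> (1 + A * exp (c / \<eta>)) * exp (- c / y n)" by (simp add: distrib_right)
      finally show False using n x(2)[of n] by simp
    qed
    ultimately show ?thesis unfolding c_def \<eta>_def by blast
  qed
  then obtain \<nu> where \<nu>: "\<And>j. y (\<nu> j) < (1/4) ^ j" "\<And>j. exp (- ((1/2) ^ j / 2) / y (\<nu> j)) < x (\<nu> j)" by metis
  \<comment> \<open>Blocks of height \<open>(1/2) ^ j / y (\<nu> j)\<close> and mass
    \<open>(1/2) ^ j\<close>. At \<open>0\<close> their sum diverges, but only finitely many of them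
    reach a given \<open>t > 0\<close>, since \<open>y (\<nu> j) < (1/4) ^ j\<close>.\<close>
  define f where "f = (\<lambda>j t. (1/2) ^ j / y (\<nu> j) * indicat_real {0..y (\<nu> j)} t)"
  have f0: "0 \<le> f j t" for j t using y(1)[of "\<nu> j"] by (simp add: f_def)
  have sf: "summable (\<lambda>j. f j t)" if "t \<noteq> 0" for t
  proof (cases "t < 0")
    case True
    then have "(\<lambda>j. f j t) = (\<lambda>_. 0)" by (auto simp: f_def)
    then show ?thesis by simp
  next
    case False
    then have t: "0 < t" using that by simp
    have "(\<lambda>j. (1/4 :: real) ^ j) \<longlonglongrightarrow> 0" by (rule LIMSEQ_power_zero) simp
    from order_tendstoD(2)[OF this t] obtain J where J: "\<And>j. J \<le> j \<Longrightarrow> (1/4) ^ j < t"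
      by (auto simp: eventually_sequentially)
    show ?thesis
    proof (rule summable_finite[of "{..<J}"])
      fix j assume "j \<notin> {..<J}"
      then have "(1/4) ^ j < t" by (intro J) auto
      with \<nu>(1)[of j] have "\<not> t \<le> y (\<nu> j)" by linarith
      then show "f j t = 0" by (simp add: f_def)
    qed simp
  qed
  define H where "H t = (\<Sum>j. f j t)" for t
  have H0: "0 \<le> H t" if "t \<noteq> 0" for t unfolding H_def by (rule suminf_nonneg[OF sf[OF that] f0])
  have fi: "integrable lborel (f j)" for j
    unfolding f_def using y(1)[of "\<nu> j"]
    by (intro integrable_mult_right integrable_real_indicator) (auto simp: less_imp_le)
  have fI: "(LBINT t. f j t) = (1/2) ^ j" for j
    unfolding f_def using y(1)[of "\<nu> j"] by simp
  have Hi: "integrable lborel H"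
    unfolding H_def
  proof (rule integrable_suminf[OF fi])
    show "AE t in lborel. summable (\<lambda>j. norm (f j t))"
      using AE_lborel_singleton[of "0::real"] by eventually_elim (use sf f0 in simp)
    show "summable (\<lambda>j. LBINT t. norm (f j t))"
      using f0 by (simp add: fI summable_geometric)
  qed
  \<comment> \<open>The summand \<open>1\<close> gives positivity where no block reaches.
    Monotonicity forces the value infinity at \<open>0\<close>, as \<open>H\<close> is unbounded
    near it.\<close>
  define h where "h t = (if 0 < t then ereal (1 + H t) else \<infinity>)" for t
  have rh: "real_of_ereal (h t) = 1 + H t" if "0 < t" for t using that by (simp add: h_def)
  have hint: "set_integrable lborel {0..1} (\<lambda>t. real_of_ereal (h t))"
    unfolding set_integrable_def
  proof (rule integrable_cong_AE_imp)
    show i: "integrable lborel (\<lambda>t. indicat_real {0..1} t *\<^sub>R (1 + H t))"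
      using set_integrable_subset[of lborel UNIV H "{0..1}"] Hi
      by (simp add: set_integrable_def distrib_left)
    show AE: "AE t in lborel. indicat_real {0..1} t *\<^sub>R (1 + H t) = indicat_real {0..1} t *\<^sub>R real_of_ereal (h t)"
      using AE_lborel_singleton[of "0::real"]
      by eventually_elim (auto simp: rh split: split_indicator)
    have Hm: "H \<in> borel_measurable borel" using borel_measurable_integrable[OF Hi] by simp
    \<comment> \<open>\<open>real_of_ereal\<close> sends infinity to \<open>0\<close>, which gives
      the second branch.\<close>
    have "(\<lambda>t. real_of_ereal (h t)) = (\<lambda>t. if 0 < t then 1 + H t else 0)" by (auto simp: h_def)
    also have "\<dots> \<in> borel_measurable borel" using Hm by measurable
    finally show "(\<lambda>t. indicat_real {0..1} t *\<^sub>R real_of_ereal (h t)) \<in> borel_measurable lborel" by simp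
  qed
  have dec: "decreasing_weight h"
    unfolding decreasing_weight_def
  proof (intro conjI ballI impI hint)
    show "0 < h t" if "t \<in> {0..1}" for t
    proof (cases "0 < t")
      case True
      then have "0 < 1 + H t" using H0[of t] by (simp add: add_pos_nonneg)
      then show ?thesis using True by (simp add: h_def)
    qed (simp add: h_def)
    show "h t < \<infinity>" if "t \<in> {0<..1}" for t using that by (simp add: h_def)
    show "h t \<le> h s" if "s \<in> {0..1}" "t \<in> {0..1}" "s \<le> t" for s t
    proof (cases "0 < s")
      case True
      then have "H t \<le> H s" unfolding H_def using that y
        by (intro suminf_le sf) (auto simp: f_def less_imp_le split: split_indicator)
      then show ?thesis using True that by (simp add: h_def)
    qed (simp add: h_def)
  qed
  obtain C where C: "\<And>n. x n * exp (1 / y n * (LBINT t:{0..y n}. real_of_ereal (h t))) \<le> C" using wt[OF dec] by blast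
  obtain j :: nat where j: "2 * C < 2 ^ j" using real_arch_pow[of 2 "2 * C"] by auto
  define n where "n = \<nu> j"
  have int: "(1/2) ^ j \<le> (LBINT t:{0..y n}. real_of_ereal (h t))"
    unfolding fI[of j, symmetric] set_lebesgue_integral_def
  proof (rule integral_mono_AE[OF fi])
    show "integrable lborel (\<lambda>t. indicat_real {0..y n} t *\<^sub>R real_of_ereal (h t))"
      using set_integrable_subset[OF hint, of "{0..y n}"] y(2)[of n] by (simp add: set_integrable_def)
    show "AE t in lborel. f j t \<le> indicat_real {0..y n} t *\<^sub>R real_of_ereal (h t)"
      using AE_lborel_singleton[of "0::real"]
    proof eventually_elim
      case (elim t)
      show ?case
      proof (cases "t \<in> {0..y n}")
        case True
        have "f j t \<le> H t"
          unfolding H_def using sum_le_suminf[OF sf[OF elim], of "{j}"] f0 by simp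
        then show ?thesis using True elim by (simp add: rh)
      qed (simp add: f_def n_def)
    qed
  qed
  \<comment> \<open>\<open>x n\<close> is at least \<open>exp (- u)\<close>, and a block of mass
    \<open>(1/2) ^ j\<close> raises the exponential weight to at least \<open>exp (2 * u)\<close>,
    so the product is at least \<open>exp u\<close>. Because \<open>y n < (1/4) ^ j\<close>, the
    exponent \<open>u\<close> is at least \<open>2 ^ j / 2\<close>.\<close>
  define u where "u = (1/2) ^ j / 2 / y n"
  have u: "2 ^ j / 2 \<le> u"
  proof -
    have "(2::real) ^ j * y n \<le> 2 ^ j * (1/4) ^ j" using \<nu>(1)[of j] by (intro mult_left_mono) (auto simp: n_def)
    also have "\<dots> = (1/2) ^ j" by (simp flip: power_mult_distrib)
    finally show ?thesis using y(1)[of n] by (simp add: u_def field_simps)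
  qed
  have "exp u = exp (- u) * exp (2 * u)" by (simp flip: exp_add)
  also have "\<dots> \<le> x n * exp (1 / y n * (LBINT t:{0..y n}. real_of_ereal (h t)))"
  proof (intro mult_mono)
    show "exp (- u) \<le> x n" using \<nu>(2)[of j] by (simp add: u_def n_def)
    have "2 * u = 1 / y n * (1/2) ^ j" by (simp add: u_def)
    also have "\<dots> \<le> 1 / y n * (LBINT t:{0..y n}. real_of_ereal (h t))"
      using int y(1)[of n] by (intro mult_left_mono) auto
    finally show "exp (2 * u) \<le> exp (1 / y n * (LBINT t:{0..y n}. real_of_ereal (h t)))" by simp
  qed (use x in auto)
  also have "\<dots> \<le> C" by (rule C)
  finally have "exp u \<le> C" .
  moreover have "u \<le> exp u" using exp_ge_add_one_self[of u] by linarith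
  ultimately show False using u j by linarith
qed

text \<open>Absolute continuity of the integral. The exponent in condition (iii) is therefore
  \<open>o (1 / y n)\<close> and is absorbed by any exponential decay.\<close>

lemma weight_integral_tendsto_zero:
  assumes h: "decreasing_weight h" and y: "\<And>n. 0 < y n" "\<And>n. y n < 1" and lim: "y \<longlonglongrightarrow> 0"
  shows "(\<lambda>n. LBINT t:{0..y n}. real_of_ereal (h t)) \<longlonglongrightarrow> 0"
proof -
  have hi: "integrable lborel (\<lambda>t. indicat_real {0..1} t *\<^sub>R real_of_ereal (h t))"
    using h by (simp add: decreasing_weight_def set_integrable_def)
  have hy: "integrable lborel (\<lambda>t. indicat_real {0..y n} t *\<^sub>R real_of_ereal (h t))" for n
    using set_integrable_subset[of lborel "{0..1}" "\<lambda>t. real_of_ereal (h t)" "{0..y n}"] hi y(2)[of n]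
    by (simp add: set_integrable_def)
  have "(\<lambda>n. LBINT t. indicat_real {0..y n} t *\<^sub>R real_of_ereal (h t)) \<longlonglongrightarrow> (LBINT (t::real). 0)"
  proof (rule integral_dominated_convergence)
    show "(\<lambda>t. indicat_real {0..y n} t *\<^sub>R real_of_ereal (h t)) \<in> borel_measurable lborel" for n
      by (rule borel_measurable_integrable[OF hy])
    show "integrable lborel (\<lambda>t. norm (indicat_real {0..1} t *\<^sub>R real_of_ereal (h t)))"
      by (rule integrable_norm[OF hi])
    show "AE t in lborel. (\<lambda>n. indicat_real {0..y n} t *\<^sub>R real_of_ereal (h t)) \<longlonglongrightarrow> 0"
      using AE_lborel_singleton[of "0::real"]
    proof eventually_elim
      case (elim t)
      have "eventually (\<lambda>n. t \<notin> {0..y n}) sequentially"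
      proof (cases "t < 0")
        case False
        with elim have "0 < t" by simp
        from order_tendstoD(2)[OF lim this] show ?thesis by eventually_elim auto
      qed auto
      then have "eventually (\<lambda>n. indicat_real {0..y n} t *\<^sub>R real_of_ereal (h t) = 0) sequentially"
        by eventually_elim simp
      then show ?case by (rule tendsto_eventually)
    qed
    show "AE t in lborel. norm (indicat_real {0..y n} t *\<^sub>R real_of_ereal (h t)) \<le> norm (indicat_real {0..1} t *\<^sub>R real_of_ereal (h t))" for n
    proof (intro AE_I2)
      fix t
      show "norm (indicat_real {0..y n} t *\<^sub>R real_of_ereal (h t)) \<le> norm (indicat_real {0..1} t *\<^sub>R real_of_ereal (h t))"
      proof (cases "t \<in> {0..y n}")
        case True
        then have "t \<in> {0..1}" using y(2)[of n] by simp
        with True show ?thesis by (simp only: indicator_simps(1))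
      next
        case False
        then have "norm (indicat_real {0..y n} t *\<^sub>R real_of_ereal (h t)) = 0" by simp
        then show ?thesis by (simp only: norm_ge_zero)
      qed
    qed
  qed simp
  then show ?thesis by (simp add: set_lebesgue_integral_def)
qed

section \<open>The equivalences\<close>

text \<open>The Cauchy kernel at \<open>\<Lambda> n\<close> is an eigenvector of the Toeplitz
  operator with eigenvalue \<open>cnj (\<phi> (\<Lambda> n))\<close>, so the preimage has
  coefficients \<open>a n / cnj (\<phi> (\<Lambda> n))\<close>. By \<open>outer_decay\<close> the
  division eventually costs at most half of the exponent. The preimage is orthogonal to the
  multiples of \<open>B\<close> because \<open>B\<close> vanishes at every
  \<open>\<Lambda> n\<close>.\<close>

lemma decay_imp_common_range:
  assumes B: "interpolating_Blaschke_product (\<lambda>n. complex_of_real (\<Lambda> n)) B" and \<Lambda>: "range \<Lambda> \<subseteq> {0<..<1}"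
    and f: "H2_sums (\<lambda>n z. a n * cauchy_kernel (complex_of_real (\<Lambda> n)) z) f"
    and c: "0 < c" and a: "\<And>n. norm (a n) \<le> C * exp (- c / (1 - \<Lambda> n))"
    and sm: "summable (\<lambda>n. 1 - \<Lambda> n)"
    and \<phi>: "\<phi> \<in> Hinf \<inter> outer"
  shows "f \<in> coanalytic_Toeplitz \<phi> ` model_space B"
proof -
  let ?l = "\<lambda>n. complex_of_real (\<Lambda> n)"
  have L: "0 < \<Lambda> n" "\<Lambda> n < 1" for n using subsetD[OF \<Lambda> rangeI[of \<Lambda> n]] by auto
  have l: "norm (?l n) < 1" and ln: "norm (?l n) = \<Lambda> n" for n using L[of n] by auto
  have fH: "f \<in> H2" using f by (simp add: H2_sums_def)
  have \<phi>H: "\<phi> \<in> Hinf" and \<phi>o: "\<phi> \<in> outer" using \<phi> by auto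
  have nz: "\<phi> (?l n) \<noteq> 0" for n
  proof -
    obtain w where "norm (\<phi> (?l n)) = exp (LINT \<xi>|circle_measure. (1 - (norm (?l n))\<^sup>2) / (norm (\<xi> - ?l n))\<^sup>2 * w \<xi>)"
      using outer_norm[OF \<phi>o] l[of n] by metis
    then show ?thesis by (metis exp_not_eq_zero norm_zero)
  qed
  have "(\<lambda>n. 1 - (1 - \<Lambda> n)) \<longlonglongrightarrow> 1 - 0" by (intro tendsto_intros summable_LIMSEQ_zero[OF sm])
  then have lim: "\<Lambda> \<longlonglongrightarrow> 1" by simp
  define b where "b n = a n / cnj (\<phi> (?l n))" for n
  have "eventually (\<lambda>n. norm (b n) \<le> C * exp (- (c / 2) / (1 - \<Lambda> n))) sequentially"
    using outer_decay[OF \<phi>o L lim half_gt_zero[OF c]]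
  proof eventually_elim
    case (elim n)
    have C: "0 \<le> C" using order_trans[OF norm_ge_zero a[of n]] by (simp add: zero_le_mult_iff)
    have "norm (b n) = norm (a n) / norm (\<phi> (?l n))" by (simp add: b_def norm_divide)
    also have "\<dots> \<le> (C * exp (- c / (1 - \<Lambda> n))) / exp (- (c / 2) / (1 - \<Lambda> n))"
      using elim a[of n] C by (intro frac_le) auto
    also have "\<dots> = C * exp (- c / (1 - \<Lambda> n) - (- (c / 2) / (1 - \<Lambda> n)))" by (simp only: exp_diff times_divide_eq_right)
    also have "- c / (1 - \<Lambda> n) - (- (c / 2) / (1 - \<Lambda> n)) = - (c / 2) / (1 - \<Lambda> n)"
      unfolding diff_divide_distrib[symmetric] by simp
    finally show ?case .
  qed
  then obtain C' where b: "\<And>n. norm (b n) \<le> C' * exp (- (c / 2) / (1 - \<Lambda> n))"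
    by (rule bound_from_eventually) auto
  obtain K where SK: "\<forall>N. summable (\<lambda>n. norm (b n) * sqrt (1 - (\<Lambda> n)\<^sup>2) * \<Lambda> n ^ N) \<and>
    (\<Sum>n. norm (b n) * sqrt (1 - (\<Lambda> n)\<^sup>2) * \<Lambda> n ^ N) \<le> K * exp (- sqrt (2 * (c / 2)) * sqrt (real N))"
    using exponential_decay_sums[OF L sm b half_gt_zero[OF c]] ..
  have S: "summable (\<lambda>n. norm (b n) * sqrt (1 - (\<Lambda> n)\<^sup>2) * \<Lambda> n ^ N)"
    and K: "(\<Sum>n. norm (b n) * sqrt (1 - (\<Lambda> n)\<^sup>2) * \<Lambda> n ^ N) \<le> K * exp (- sqrt (2 * (c / 2)) * sqrt (real N))" for N
    using spec[OF SK, of N] by simp_all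
  have "summable (\<lambda>N. K * exp (- sqrt (2 * (c / 2)) * sqrt (real N)))"
    by (intro summable_mult exp_neg_sqrt_summable) (use c in simp)
  then have "summable (\<lambda>N. \<Sum>n. norm (b n) * sqrt (1 - (\<Lambda> n)\<^sup>2) * \<Lambda> n ^ N)"
  proof (rule summable_comparison_test')
    fix N
    have "0 \<le> (\<Sum>n. norm (b n) * sqrt (1 - (\<Lambda> n)\<^sup>2) * \<Lambda> n ^ N)"
      using L by (intro suminf_nonneg S mult_nonneg_nonneg zero_le_power) (auto simp: abs_square_le_1 less_imp_le)
    then show "norm (\<Sum>n. norm (b n) * sqrt (1 - (\<Lambda> n)\<^sup>2) * \<Lambda> n ^ N) \<le> K * exp (- sqrt (2 * (c / 2)) * sqrt (real N))"
      using K[of N] by simp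
  qed
  then obtain g where gH: "g \<in> H2"
    and g: "\<And>k. k \<in> H2 \<Longrightarrow> (\<lambda>n. b n * of_real (sqrt (1 - (\<Lambda> n)\<^sup>2)) * cnj (k (?l n))) sums L2_inner (bdry g) (bdry k)"
  proof (rule kernel_series_exists[OF L S])
    fix g assume "g \<in> H2"
      and "\<And>k. k \<in> H2 \<Longrightarrow> (\<lambda>n. b n * of_real (sqrt (1 - (\<Lambda> n)\<^sup>2)) * cnj (k (?l n))) sums L2_inner (bdry g) (bdry k)"
    then show thesis by (rule that)
  qed
  obtain p where phol: "\<And>n. p n holomorphic_on ball 0 1"
    and p1: "\<And>n z. norm z < 1 \<Longrightarrow> norm (p n z) \<le> 1"
    and Bp: "\<And>n z. norm z < 1 \<Longrightarrow> B z = (?l n - z) / (1 - ?l n * z) * p n z"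
  proof (rule Blaschke_split[OF B \<Lambda>])
    fix p :: "nat \<Rightarrow> complex \<Rightarrow> complex"
    assume "\<And>n. p n holomorphic_on ball 0 1" "\<And>n z. norm z < 1 \<Longrightarrow> norm (p n z) \<le> 1"
      "\<And>n z. norm z < 1 \<Longrightarrow> B z = (?l n - z) / (1 - ?l n * z) * p n z"
    then show thesis by (rule that)
  qed
  have nzl: "1 - ?l n * z \<noteq> 0" if "norm z < 1" for n z
    using kernel_denom_nonzero[OF l[of n], of z] that by simp
  have B1: "(\<lambda>z. if norm z < 1 then B z else 0) \<in> Hinf"
  proof (rule HinfI)
    have "(\<lambda>z. (?l 0 - z) / (1 - ?l 0 * z) * p 0 z) holomorphic_on ball 0 1"
      by (intro holomorphic_intros phol) (use nzl in auto)
    then show "B holomorphic_on ball 0 1" by (rule holomorphic_transform) (use Bp in auto)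
    fix z :: complex assume z: "norm z < 1"
    have "norm ((?l 0 - z) / (1 - ?l 0 * z)) \<le> 1"
      using Moebius_function_norm_lt_1[of "?l 0" z 0] z l[of 0]
      by (simp add: Moebius_function_simple norm_divide norm_minus_commute)
    then have "norm ((?l 0 - z) / (1 - ?l 0 * z)) * norm (p 0 z) \<le> 1 * 1"
      using p1[OF z] by (intro mult_mono) auto
    then show "norm (B z) \<le> 1" unfolding Bp[OF z, of 0] norm_mult by simp
  qed
  have BL: "B (?l n) = 0" for n using Bp[OF l, of n n] by simp
  have "L2_inner (bdry g) (bdry (\<lambda>z. B z * k z)) = 0" if k: "k \<in> H2" for k
  proof -
    \<comment> \<open>\<open>B\<close> is arbitrary outside the disk, but the factor
      \<open>k\<close> vanishes there, so the cut-off does not change the product.\<close>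
    have e: "(\<lambda>z. B z * k z) = (\<lambda>z. (if norm z < 1 then B z else 0) * k z)"
      using analytic_disk_outside[OF H2_analytic[OF k]] by auto
    have "(\<lambda>z. B z * k z) \<in> H2" unfolding e by (rule H2_mult_Hinf[OF B1 k])
    from g[OF this] show ?thesis by (simp add: BL sums_iff)
  qed
  then have gK: "g \<in> model_space B" using gH by (simp add: model_space_def)
  have "f = coanalytic_Toeplitz \<phi> g"
    unfolding coanalytic_Toeplitz_iff[OF \<phi>H gH]
  proof (intro conjI ballI fH)
    fix k assume k: "k \<in> H2"
    have "(\<lambda>n. b n * of_real (sqrt (1 - (\<Lambda> n)\<^sup>2)) * cnj (\<phi> (?l n) * k (?l n))) sums L2_inner (bdry g) (bdry (\<lambda>z. \<phi> z * k z))"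
      by (rule g[OF H2_mult_Hinf[OF \<phi>H k]])
    moreover have "b n * of_real (sqrt (1 - (\<Lambda> n)\<^sup>2)) * cnj (\<phi> (?l n) * k (?l n))
        = a n * of_real (sqrt (1 - (\<Lambda> n)\<^sup>2)) * cnj (k (?l n))" for n
      using nz[of n] by (simp add: b_def)
    moreover have "(\<lambda>n. a n * of_real (sqrt (1 - (\<Lambda> n)\<^sup>2)) * cnj (k (?l n))) sums L2_inner (bdry f) (bdry k)"
      using H2_sums_inner[OF l f k] by (simp only: ln)
    ultimately show "L2_inner (bdry g) (bdry (\<lambda>z. \<phi> z * k z)) = L2_inner (bdry f) (bdry k)"
      by (simp only: sums_unique2)
  qed
  with gK show ?thesis by blast
qed

text \<open>Serves conditions (ii) and (iii) alike: a factor up to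
  \<open>exp ((c / 2) / y n)\<close> leaves \<open>exp (- (c / 2) / y n)\<close>, which is at most
  \<open>2 / c\<close> times the summable \<open>y n\<close>.\<close>

lemma decay_imp_summable:
  fixes x y e :: "nat \<Rightarrow> real"
  assumes y: "\<And>n. 0 < y n" and sm: "summable y" and c: "0 < c"
    and x: "\<And>n. 0 \<le> x n" "\<And>n. x n \<le> C * exp (- c / y n)"
    and e: "\<And>n. 0 \<le> e n" "eventually (\<lambda>n. e n \<le> exp ((c / 2) / y n)) sequentially"
  shows "summable (\<lambda>n. x n * e n)"
proof (rule summable_comparison_test_ev[OF _ summable_mult[OF sm, of "C * (2 / c)"]])
  have C: "0 \<le> C" using order_trans[OF x(1) x(2)[of 0]] by (simp add: zero_le_mult_iff)
  show "\<forall>\<^sub>F n in sequentially. norm (x n * e n) \<le> C * (2 / c) * y n"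
    using e(2)
  proof eventually_elim
    case (elim n)
    have "x n * e n \<le> (C * exp (- c / y n)) * exp ((c / 2) / y n)"
      using x e(1) elim C by (intro mult_mono) auto
    also have "\<dots> = C * exp (- c / y n + (c / 2) / y n)" by (simp only: exp_add mult.assoc)
    also have "- c / y n + (c / 2) / y n = - (c / 2) / y n" unfolding add_divide_distrib[symmetric] by simp
    also have "C * exp (- (c / 2) / y n) \<le> C * (y n / (c / 2))"
      using c y C by (intro mult_left_mono exp_neg_inverse_le) auto
    finally show ?case using x(1)[of n] e(1)[of n] by (simp add: mult_ac)
  qed
qed

theorem theorem9p4:
  fixes \<Lambda> :: "nat \<Rightarrow> real" and B f :: "complex \<Rightarrow> complex" and a :: "nat \<Rightarrow> complex"
  assumes "interpolating_Blaschke_product (\<lambda>n. complex_of_real (\<Lambda> n)) B"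
    and "range \<Lambda> \<subseteq> {0<..<1}"
    and "summable (\<lambda>n. (norm (a n))\<^sup>2)"
    and "H2_sums (\<lambda>n z. a n * cauchy_kernel (complex_of_real (\<Lambda> n)) z) f"
  shows "(f \<in> common_range (model_space B) \<longleftrightarrow>
           (\<forall>\<phi>\<in>Hinf \<inter> outer.
              summable (\<lambda>n. (norm (a n))\<^sup>2 / norm (\<phi> (complex_of_real (\<Lambda> n))))))
       \<and> (f \<in> common_range (model_space B) \<longleftrightarrow>
           (\<forall>h. decreasing_weight h \<longrightarrow>
              summable (\<lambda>n. (norm (a n))\<^sup>2 *
                exp (1 / (1 - \<Lambda> n) * (LBINT t:{0..1 - \<Lambda> n}. real_of_ereal (h t))))))
       \<and> (f \<in> common_range (model_space B) \<longleftrightarrow>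
           (\<exists>c>0.
              (\<lambda>N. norm (\<Sum>n. a n * complex_of_real (sqrt (1 - \<bar>\<Lambda> n\<bar>\<^sup>2)) * complex_of_real (\<Lambda> n) ^ N))
                \<in> O(\<lambda>N. exp (- c * sqrt (real N)))))"
proof -
  let ?l = "\<lambda>n. complex_of_real (\<Lambda> n)"
  define y where "y n = 1 - \<Lambda> n" for n
  have L: "0 < \<Lambda> n" "\<Lambda> n < 1" for n using subsetD[OF assms(2) rangeI[of \<Lambda> n]] by auto
  have l: "norm (?l n) < 1" for n using L[of n] by simp
  have y: "0 < y n" "y n < 1" for n using L[of n] by (auto simp: y_def)
  have "summable (\<lambda>n. 1 - norm (?l n))"
    using assms(1) by (simp add: interpolating_Blaschke_product_def Blaschke_product_def)
  moreover have "norm (?l n) = \<Lambda> n" for n using L[of n] by simp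
  ultimately have sm: "summable (\<lambda>n. 1 - \<Lambda> n)" by (simp only:)
  have smy: "summable y" using sm by (simp add: y_def[abs_def])
  have ylim: "y \<longlonglongrightarrow> 0" by (rule summable_LIMSEQ_zero[OF smy])
  have "(\<lambda>n. 1 - (1 - \<Lambda> n)) \<longlonglongrightarrow> 1 - 0" by (intro tendsto_intros summable_LIMSEQ_zero[OF sm])
  then have lim: "\<Lambda> \<longlonglongrightarrow> 1" by simp
  \<comment> \<open>\<open>P1\<close> to \<open>P4\<close> below stand for conditions (i) to (iv);
    every implication between them passes through \<open>V\<close>.\<close>
  define V where "V \<longleftrightarrow> (\<exists>C c. 0 < c \<and> (\<forall>n. (norm (a n))\<^sup>2 \<le> C * exp (- c / y n)))"
  define P1 where "P1 \<longleftrightarrow> f \<in> common_range (model_space B)"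
  define P2 where "P2 \<longleftrightarrow> (\<forall>\<phi>\<in>Hinf \<inter> outer. summable (\<lambda>n. (norm (a n))\<^sup>2 / norm (\<phi> (?l n))))"
  define P3 where "P3 \<longleftrightarrow> (\<forall>h. decreasing_weight h \<longrightarrow>
     summable (\<lambda>n. (norm (a n))\<^sup>2 * exp (1 / (1 - \<Lambda> n) * (LBINT t:{0..1 - \<Lambda> n}. real_of_ereal (h t)))))"
  define P4 where "P4 \<longleftrightarrow> (\<exists>c>0. (\<lambda>N. norm (\<Sum>n. a n * complex_of_real (sqrt (1 - \<bar>\<Lambda> n\<bar>\<^sup>2)) * ?l n ^ N))
     \<in> O(\<lambda>N. exp (- c * sqrt (real N))))"
  obtain A where A: "\<And>n. (norm (a n))\<^sup>2 \<le> A"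
    using convergent_imp_Bseq[OF convergentI[OF summable_LIMSEQ_zero[OF assms(3)]]]
    unfolding Bseq_def by auto
  have nz: "0 < norm (\<phi> (?l n))" if \<phi>: "\<phi> \<in> outer" for \<phi> n
  proof -
    obtain w where "norm (\<phi> (?l n)) = exp (LINT \<xi>|circle_measure. (1 - (norm (?l n))\<^sup>2) / (norm (\<xi> - ?l n))\<^sup>2 * w \<xi>)"
      using outer_norm[OF \<phi>] l[of n] by metis
    then show ?thesis by (metis exp_gt_zero)
  qed
  have bounded_terms: "\<exists>C. \<forall>n. u n \<le> C" if "summable u" for u :: "nat \<Rightarrow> real"
    using convergent_imp_Bseq[OF convergentI[OF summable_LIMSEQ_zero[OF that]]]
    unfolding Bseq_def real_norm_def by (meson abs_le_D1)
  have V_weight: V if wt: "\<And>h. decreasing_weight h \<Longrightarrow>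
     \<exists>C. \<forall>n. (norm (a n))\<^sup>2 * exp (1 / y n * (LBINT t:{0..y n}. real_of_ereal (h t))) \<le> C"
    unfolding V_def by (rule weight_bound_imp_decay[OF y _ A wt]) auto
  \<comment> \<open>The pointwise bound common to (i) and (ii). For (ii) it is the boundedness of
    the terms of a convergent series.\<close>
  have V_outer: V if out: "\<And>\<phi>. \<phi> \<in> Hinf \<inter> outer \<Longrightarrow> \<exists>C. \<forall>n. (norm (a n))\<^sup>2 \<le> C * norm (\<phi> (?l n))"
  proof (rule V_weight)
    fix h assume h: "decreasing_weight h"
    obtain \<phi> where \<phi>: "\<phi> \<in> Hinf \<inter> outer"
      and n\<phi>: "\<And>x. 0 < x \<Longrightarrow> x < 1 \<Longrightarrow> norm (\<phi> (complex_of_real x)) \<le> exp (- (1 / (1 - x) * (LBINT t:{0..1 - x}. real_of_ereal (h t))))"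
      using outer_for_weight[OF h] by metis
    obtain C where C: "\<And>n. (norm (a n))\<^sup>2 \<le> C * norm (\<phi> (?l n))" using out[OF \<phi>] by blast
    have C0: "0 \<le> C"
      using order_trans[OF zero_le_power2 C[of 0]] nz[of \<phi> 0] \<phi> by (simp add: zero_le_mult_iff)
    have "(norm (a n))\<^sup>2 * exp (1 / y n * (LBINT t:{0..y n}. real_of_ereal (h t))) \<le> C" for n
    proof -
      define I where "I = 1 / y n * (LBINT t:{0..y n}. real_of_ereal (h t))"
      have "(norm (a n))\<^sup>2 \<le> C * exp (- I)"
        using order_trans[OF C[of n] mult_left_mono[OF n\<phi>[OF L] C0]] by (simp only: I_def y_def)
      then have "(norm (a n))\<^sup>2 * exp I \<le> C * exp (- I) * exp I" by (rule mult_right_mono) simp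
      also have "\<dots> = C" by (simp add: mult.assoc flip: exp_add)
      finally show ?thesis unfolding I_def .
    qed
    then show "\<exists>C. \<forall>n. (norm (a n))\<^sup>2 * exp (1 / y n * (LBINT t:{0..y n}. real_of_ereal (h t))) \<le> C" by blast
  qed
  have "P1 \<Longrightarrow> V"
  proof (rule V_outer)
    fix \<phi> assume P1 and \<phi>: "\<phi> \<in> Hinf \<inter> outer"
    then have fT: "f \<in> coanalytic_Toeplitz \<phi> ` model_space B" by (auto simp: P1_def common_range_def)
    have \<phi>H: "\<phi> \<in> Hinf" using \<phi> by simp
    obtain C where C: "\<And>n. norm (a n) \<le> C * norm (\<phi> (?l n))"
      using Toeplitz_range_coefficient_bound[OF assms(1,2,4) \<phi>H fT] by blast
    obtain M where M: "0 < M" "\<And>z. norm (\<phi> z) \<le> M" using Hinf_bound[OF \<phi>H] by blast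
    \<comment> \<open>Condition (i) yields two factors \<open>|\<phi>|\<close> after squaring; one
      of them is replaced by the bound \<open>M\<close>.\<close>
    have "(norm (a n))\<^sup>2 \<le> C\<^sup>2 * M * norm (\<phi> (?l n))" for n
    proof -
      have "(norm (a n))\<^sup>2 \<le> (C * norm (\<phi> (?l n)))\<^sup>2" by (intro power_mono C) simp
      also have "\<dots> = C\<^sup>2 * norm (\<phi> (?l n)) * norm (\<phi> (?l n))" by (simp add: power2_eq_square)
      also have "\<dots> \<le> C\<^sup>2 * M * norm (\<phi> (?l n))" by (intro mult_right_mono mult_left_mono M) auto
      finally show ?thesis .
    qed
    then show "\<exists>C. \<forall>n. (norm (a n))\<^sup>2 \<le> C * norm (\<phi> (?l n))" by blast
  qed
  moreover have "P2 \<Longrightarrow> V"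
  proof (rule V_outer)
    fix \<phi> assume P2 and \<phi>: "\<phi> \<in> Hinf \<inter> outer"
    then have "summable (\<lambda>n. (norm (a n))\<^sup>2 / norm (\<phi> (?l n)))" by (simp add: P2_def)
    from bounded_terms[OF this] obtain C where C: "\<And>n. (norm (a n))\<^sup>2 / norm (\<phi> (?l n)) \<le> C" by blast
    have "(norm (a n))\<^sup>2 \<le> C * norm (\<phi> (?l n))" for n
      using C[of n] nz[of \<phi> n] \<phi> by (simp add: pos_divide_le_eq)
    then show "\<exists>C. \<forall>n. (norm (a n))\<^sup>2 \<le> C * norm (\<phi> (?l n))" by blast
  qed
  moreover have "P3 \<Longrightarrow> V"
  proof (rule V_weight)
    fix h assume P3 and h: "decreasing_weight h"
    then have "summable (\<lambda>n. (norm (a n))\<^sup>2 * exp (1 / y n * (LBINT t:{0..y n}. real_of_ereal (h t))))"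
      by (simp add: P3_def y_def)
    from bounded_terms[OF this]
    show "\<exists>C. \<forall>n. (norm (a n))\<^sup>2 * exp (1 / y n * (LBINT t:{0..y n}. real_of_ereal (h t))) \<le> C" .
  qed
  moreover have tay: "(\<Sum>n. a n * complex_of_real (sqrt (1 - \<bar>\<Lambda> n\<bar>\<^sup>2)) * ?l n ^ N) = taylor f N" for N
    using kernel_series_taylor[OF L assms(4), of N] by (simp add: sums_iff)
  have "P4 \<Longrightarrow> V"
  proof -
    assume P4
    then obtain c where c: "0 < c" and O: "(\<lambda>N. norm (taylor f N)) \<in> O(\<lambda>N. exp (- c * sqrt (real N)))"
      unfolding P4_def tay by blast
    \<comment> \<open>The Landau bound holds only for large \<open>N\<close>; enlarging the constant
      extends it to all \<open>N\<close>, as the summation over all Taylor coefficients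
      requires.\<close>
    from O obtain K where "eventually (\<lambda>N. norm (norm (taylor f N)) \<le> K * norm (exp (- c * sqrt (real N)))) sequentially"
      by (rule landau_o.bigE)
    then have "eventually (\<lambda>N. norm (taylor f N) \<le> K * exp (- c * sqrt (real N))) sequentially" by simp
    then obtain K' where "\<And>N. norm (taylor f N) \<le> K' * exp (- c * sqrt (real N))"
      by (rule bound_from_eventually) auto
    from coefficient_decay_from_taylor_decay[OF assms(1,2,4) c this] show V by (simp add: V_def y_def)
  qed
  moreover have "P1 \<and> P2 \<and> P3 \<and> P4" if V
  proof -
    from \<open>V\<close> obtain C c where c: "0 < c" and a: "\<And>n. (norm (a n))\<^sup>2 \<le> C * exp (- c / y n)" unfolding V_def by blast
    have C: "0 \<le> C" using order_trans[OF zero_le_power2 a[of 0]] by (simp add: zero_le_mult_iff)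
    have c2: "0 < c / 2" using c by simp
    have a1: "norm (a n) \<le> sqrt C * exp (- (c / 2) / (1 - \<Lambda> n))" for n
    proof -
      have "norm (a n) \<le> sqrt (C * exp (- c / y n))" using a[of n] by (rule real_le_rsqrt)
      also have "\<dots> = sqrt C * sqrt (exp (- c / y n))" by (rule real_sqrt_mult)
      also have "sqrt (exp (- c / y n)) = exp (- (c / 2) / y n)"
        by (rule real_sqrt_unique) (simp_all add: power2_eq_square flip: exp_add)
      finally show ?thesis by (simp add: y_def)
    qed
    have P1 unfolding P1_def common_range_def
      using decay_imp_common_range[OF assms(1,2,4) c2 a1 sm] by blast
    moreover have P2 unfolding P2_def
    proof
      fix \<phi> assume \<phi>: "\<phi> \<in> Hinf \<inter> outer"
      then have \<phi>o: "\<phi> \<in> outer" by simp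
      have "eventually (\<lambda>n. 1 / norm (\<phi> (?l n)) \<le> exp ((c / 2) / y n)) sequentially"
        using outer_decay[OF \<phi>o L lim c2]
      proof eventually_elim
        case (elim n)
        then have "inverse (norm (\<phi> (?l n))) \<le> inverse (exp (- (c / 2) / (1 - \<Lambda> n)))"
          by (rule le_imp_inverse_le) simp
        also have "exp (- (c / 2) / (1 - \<Lambda> n)) = inverse (exp ((c / 2) / y n))"
          unfolding minus_divide_left[symmetric] y_def by (rule exp_minus)
        finally show ?case by (simp only: inverse_inverse_eq inverse_eq_divide[symmetric])
      qed
      from decay_imp_summable[OF y(1) smy c zero_le_power2 a _ this]
      show "summable (\<lambda>n. (norm (a n))\<^sup>2 / norm (\<phi> (?l n)))" by simp
    qed
    moreover have P3 unfolding P3_def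
    proof (intro allI impI)
      fix h assume h: "decreasing_weight h"
      let ?I = "\<lambda>n. LBINT t:{0..y n}. real_of_ereal (h t)"
      from order_tendstoD(2)[OF weight_integral_tendsto_zero[OF h y ylim] c2]
      have "eventually (\<lambda>n. exp (1 / y n * ?I n) \<le> exp ((c / 2) / y n)) sequentially"
      proof eventually_elim
        case (elim n)
        then have "?I n / y n \<le> (c / 2) / y n" using y(1)[of n] by (intro divide_right_mono) auto
        then show ?case by simp
      qed
      from decay_imp_summable[OF y(1) smy c zero_le_power2 a _ this]
      show "summable (\<lambda>n. (norm (a n))\<^sup>2 * exp (1 / (1 - \<Lambda> n) * (LBINT t:{0..1 - \<Lambda> n}. real_of_ereal (h t))))"
        by (simp add: y_def)
    qed
    moreover have P4 unfolding P4_def tay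
    proof (intro exI conjI)
      \<comment> \<open>The rate that \<open>exponential_decay_sums\<close> gives for
        \<open>c / 2\<close>, the exponent left after passing from \<open>|a n|^2\<close> to
        \<open>|a n|\<close>.\<close>
      show "0 < sqrt (2 * (c / 2))" using c by simp
      obtain K where SK: "\<forall>N. summable (\<lambda>n. norm (a n) * sqrt (1 - (\<Lambda> n)\<^sup>2) * \<Lambda> n ^ N) \<and>
        (\<Sum>n. norm (a n) * sqrt (1 - (\<Lambda> n)\<^sup>2) * \<Lambda> n ^ N) \<le> K * exp (- sqrt (2 * (c / 2)) * sqrt (real N))"
        using exponential_decay_sums[OF L sm a1 c2] ..
      have S: "summable (\<lambda>n. norm (a n) * sqrt (1 - (\<Lambda> n)\<^sup>2) * \<Lambda> n ^ N)"
        and K: "(\<Sum>n. norm (a n) * sqrt (1 - (\<Lambda> n)\<^sup>2) * \<Lambda> n ^ N) \<le> K * exp (- sqrt (2 * (c / 2)) * sqrt (real N))" for N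
        using spec[OF SK, of N] by simp_all
      have tK: "norm (taylor f N) \<le> K * exp (- sqrt (2 * (c / 2)) * sqrt (real N))" for N
      proof -
        let ?t = "\<lambda>n. a n * complex_of_real (sqrt (1 - (\<Lambda> n)\<^sup>2)) * ?l n ^ N"
        have nt: "norm (?t n) = norm (a n) * sqrt (1 - (\<Lambda> n)\<^sup>2) * \<Lambda> n ^ N" for n
          using L[of n] by (simp add: norm_mult norm_power abs_square_le_1)
        have "taylor f N = (\<Sum>n. ?t n)" by (rule sums_unique[OF kernel_series_taylor[OF L assms(4)]])
        also have "norm \<dots> \<le> (\<Sum>n. norm (?t n))" by (rule summable_norm) (unfold nt, rule S)
        also have "\<dots> \<le> K * exp (- sqrt (2 * (c / 2)) * sqrt (real N))" unfolding nt by (rule K)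
        finally show ?thesis .
      qed
      show "(\<lambda>N. norm (taylor f N)) \<in> O(\<lambda>N. exp (- sqrt (2 * (c / 2)) * sqrt (real N)))"
      proof (intro landau_o.bigI[of "\<bar>K\<bar> + 1"] always_eventually allI)
        fix N
        have "K * exp (- sqrt (2 * (c / 2)) * sqrt (real N)) \<le> (\<bar>K\<bar> + 1) * exp (- sqrt (2 * (c / 2)) * sqrt (real N))"
          by (rule mult_right_mono) auto
        with tK[of N] show "norm (norm (taylor f N)) \<le> (\<bar>K\<bar> + 1) * norm (exp (- sqrt (2 * (c / 2)) * sqrt (real N)))"
          unfolding real_norm_def abs_exp_cancel abs_norm_cancel by (rule order_trans)
      qed simp
    qed
    ultimately show ?thesis by blast
  qed
  ultimately have "(P1 \<longleftrightarrow> P2) \<and> (P1 \<longleftrightarrow> P3) \<and> (P1 \<longleftrightarrow> P4)" by blast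
  then show ?thesis unfolding P1_def P2_def P3_def P4_def .
qed

end
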